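(* For every $n\ge1$ there is a constant $C_n>0$, depending only on $n$, with the following property. Let $M_i,H_i\ge0$ with $M_i+H_i>0$ and $0\le\nu_i\le1$ for $1\le i\le n$; suppose that for every $i$ the operator $Q_i$ is monotone and $M_i$-Lipschitz on $\mathcal Z$ with respect to $\|\cdot\|_{\mathbf P}$, that $p_i$ is convex and satisfies the $(\nu_i,H_i)$-Hölder condition on $\mathcal Z$ with respect to $\|\cdot\|_{\mathbf P}$, and that $\Omega:=\sup_{z\in\mathcal Z}\|z_{\mathrm{in}}-z\|_{\mathbf P}^2<\infty$. For $\varepsilon>0$ define $$R_i:=\max\left\{\left(\frac{H_i\Omega^{(1+\nu_i)/2}}{\varepsilon}\right)^{\frac2{1+3\nu_i}},\ \frac{M_i\Omega}{\varepsilon},\ 1\right\},\qquad i=1,\dots,n,$$ and relabel the component pairs $(p_i,Q_i)$ so that $R_1\le R_2\le\cdots\le R_n$. Then performing no more than $C_nR_i$ evaluations of the subgradient $p_i'$ and of the operator $Q_i$, for each $1\le i\le n$, is sufficient to ensure $$\sup_{z\in\mathcal Z}\left\{p(z_{\mathrm{out}})-p(z)+\langle Q(z),z_{\mathrm{out}}-z\rangle\right\}\le n\varepsilon;$$ that is, there are positive integers $T_1,\dots,T_n$ such that the Sliding Algorithm started at $z_{\mathrm{in}}$ with the parameters given in the context uses, for each $i$, at most $C_nR_i$ evaluations of $p_i'$ and at most $C_nR_i$ evaluations of $Q_i$, and its output $z_{\mathrm{out}}$ satisfies this bound.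
   Context: Setting. $\mathcal Z\subseteq\mathbb R^{d_z}$ is nonempty, closed and convex, $z_{\mathrm{in}}\in\mathcal Z$; $p=\sum_{i=1}^np_i$ and $Q=\sum_{i=1}^nQ_i$, where each $p_i:\mathcal Z\to\mathbb R$ is convex and each $Q_i:\mathcal Z\to\mathbb R^{d_z}$ is continuous and monotone. $\mathbf P$ is a symmetric positive definite matrix, $\|z\|_{\mathbf P}=\langle\mathbf Pz,z\rangle^{1/2}$ and $\|s\|_{\mathbf P^{-1}}=\langle\mathbf P^{-1}s,s\rangle^{1/2}$. An operator $G$ is monotone if $\langle G(u)-G(v),u-v\rangle\ge0$, and $M$-Lipschitz with respect to $\|\cdot\|_{\mathbf P}$ if $\|G(u)-G(v)\|_{\mathbf P^{-1}}\le M\|u-v\|_{\mathbf P}$, for all $u,v\in\mathcal Z$. $h'(u)$ denotes an arbitrary element of the subdifferential $\partial h(u)$, assumed nonempty at every point of $\mathcal Z$. A function $h$ satisfies the $(\nu,H)$-Hölder condition on $\mathcal Z$ with respect to $\|\cdot\|_{\mathbf P}$ if $\|h'(u)-h'(v)\|_{\mathbf P^{-1}}\le H\|u-v\|_{\mathbf P}^\nu$ for all $u,v\in\mathcal Z$ and all choices of subgradients (for $\nu=0$ the right-hand side is $H$). Sliding Algorithm. Data: the pairs $(p_i,Q_i)$, $1\le i\le n$, with oracle vectors $\tilde\nabla p_i(\cdot)$; positive integers $T_1,\dots,T_n$; a sequence $(\alpha_t)_{t\ge0}$; step sizes $\eta^k_{\mathbf t}$ for $1\le k\le n$, $\mathbf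 t=(t_1,\dots,t_k)$, $0\le t_\ell\le T_\ell-1$; input $z_{\mathrm{in}}\in\mathcal Z$. Set $z^k_{(0,\dots,0)}=z_{\mathrm{in}}$ ($k$ zeros) for $k=1,\dots,n$. The output is $z_{\mathrm{out}}=\mathrm{Rec}(0,\varnothing)$, where for $0\le k\le n$ and $\mathbf t=(t_1,\dots,t_k)$ the procedure $\mathrm{Rec}(k,\mathbf t)$ is: (a) If $k=n$, return $\operatorname{argmin}_{z\in\mathcal Z}\sum_{i=1}^n\big\{\langle\tilde\nabla p_i(w^i_{(t_1,\dots,t_i)})+Q_i(z^i_{(t_1,\dots,t_i)}),z\rangle+\tfrac12\eta^i_{(t_1,\dots,t_i)}\|z-z^i_{(t_1,\dots,t_i)}\|_{\mathbf P}^2\big\}$. (b) If $k<n$, set $\bar z^{k+1}_{(\mathbf t,0)}=z^{k+1}_{(\mathbf t,0)}$. For $j=0,\dots,T_{k+1}-1$, with $\mathbf t'=(\mathbf t,j)$ and $\mathbf t''=(\mathbf t,j+1)$: set $\tilde z^{k+1}_{\mathbf t'}=\mathrm{Rec}(k+1,\mathbf t')$; $\bar z^{k+1}_{\mathbf t''}=\alpha_j\tilde z^{k+1}_{\mathbf t'}+(1-\alpha_j)\bar z^{k+1}_{\mathbf t'}$; $z^{k+1}_{\mathbf t''}=\operatorname{argmin}_{z\in\mathcal Z}\{\langle Q_{k+1}(\tilde z^{k+1}_{\mathbf t'})-Q_{k+1}(z^{k+1}_{\mathbf t'}),z\rangle+\tfrac12\eta^{k+1}_{\mathbf t'}\|z-\tilde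 z^{k+1}_{\mathbf t'}\|_{\mathbf P}^2\}$; and, for $\ell=k+2,\dots,n$, $z^\ell_{(\mathbf t'',0,\dots,0)}=z^\ell_{(\mathbf t',T_{k+2},0,\dots,0)}$ (padding by zeros to length $\ell$). Return $\bar z^{k+1}_{(\mathbf t,T_{k+1})}$. Here $w^i_{(t_1,\dots,t_i)}=(a_1\circ a_2\circ\cdots\circ a_i)(z^i_{(t_1,\dots,t_i)})$ with $a_\ell(z)=\alpha_{t_\ell}z+(1-\alpha_{t_\ell})\bar z^\ell_{(t_1,\dots,t_\ell)}$; the vectors $\tilde\nabla p_i(w^i_{\mathbf t})$ and $Q_i(z^i_{\mathbf t})$ are computed once per multi-index $\mathbf t$ of length $i$. The minimizations over $\mathcal Z$ (projections) are assumed exact and are not counted. Parameters. $\tilde\nabla p_i=p_i'$ (exact subgradients); $\alpha_0=1$, $\alpha_{t+1}=2/(1+\sqrt{1+4/\alpha_t^2})$; with $N_i=\prod_{j=1}^iT_j$, $\eta^k_{\mathbf t}=L_k^\circ\prod_{\ell=1}^k\alpha_{t_\ell}+M_k\prod_{\ell=1}^k\alpha_{t_\ell}/\alpha_{T_\ell-1}$, where $L_k^\circ=H_k$ if $\nu_k=1$, and for $\nu_k<1$, $L_k^\circ=K_k(\delta_k^\circ)^{-(1-\nu_k)/(1+\nu_k)}$ with $K_k=\big[\frac{1-\nu_k}{2(1+\nu_k)}\big]^{\frac{1-\nu_k}{1+\nu_k}}H_k^{\frac2{1+\nu_k}}$ and $\delta_k^\circ=\big[\frac{(1-\nu_k)2^{2k-1}K_k\Omega}{(1+\nu_k)N_k^3}\big]^{(1+\nu_k)/2}$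 ($L_k^\circ=0$ if $\delta_k^\circ=0$). *)

theory Defs
  imports "HOL-Analysis.Analysis" "HOL-Analysis.Finite_Function_Topology"
begin

section \<open>Euclidean spaces of varying dimension\<close>

text \<open>
  The constant in the theorem must not depend on the dimension of the ambient space, so the dimension
  has to be quantified inside the formula. Hence $\mathbb R^d$ is the subspace of the finitely supported
  sequences that vanish from index \<open>d\<close> on. On it, the norm topology of the type
  \<^typ>\<open>(nat, real) poly_mapping\<close> is the Euclidean topology (the library norm of this type is the
  sum norm; only its topology is used). Matrices are entry functions, of which only the entries with
  indices below \<open>d\<close> matter.
\<close>

type_synonym vect = "(nat, real) poly_mapping"

definition Rspace :: "nat \<Rightarrow> vect set" where
  "Rspace d = {x. Poly_Mapping.keys x \<subseteq> {..<d}}"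

definition ip :: "vect \<Rightarrow> vect \<Rightarrow> real" where
  "ip x y = (\<Sum>i\<in>Poly_Mapping.keys x. Poly_Mapping.lookup x i * Poly_Mapping.lookup y i)"

type_synonym matr = "nat \<Rightarrow> nat \<Rightarrow> real"

definition mat_app :: "nat \<Rightarrow> matr \<Rightarrow> vect \<Rightarrow> vect" where
  "mat_app d A x = (\<Sum>i<d. Poly_Mapping.single i (\<Sum>j<d. A i j * Poly_Mapping.lookup x j))"

definition sym_pos_def :: "nat \<Rightarrow> matr \<Rightarrow> bool" where
  "sym_pos_def d A \<longleftrightarrow>
     (\<forall>i<d. \<forall>j<d. A i j = A j i) \<and> (\<forall>x\<in>Rspace d. x \<noteq> 0 \<longrightarrow> ip (mat_app d A x) x > 0)"

definition mat_inv :: "nat \<Rightarrow> matr \<Rightarrow> matr" where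
  "mat_inv d A = (SOME B. \<forall>i<d. \<forall>j<d.
     (\<Sum>k<d. A i k * B k j) = (if i = j then 1 else 0) \<and>
     (\<Sum>k<d. B i k * A k j) = (if i = j then 1 else 0))"

definition wnorm :: "nat \<Rightarrow> matr \<Rightarrow> vect \<Rightarrow> real" where
  "wnorm d A x = sqrt (ip (mat_app d A x) x)"


section \<open>Operators and convex functions\<close>

definition monotone_op :: "vect set \<Rightarrow> (vect \<Rightarrow> vect) \<Rightarrow> bool" where
  "monotone_op Z F \<longleftrightarrow> (\<forall>u\<in>Z. \<forall>v\<in>Z. ip (F u - F v) (u - v) \<ge> 0)"

definition lipschitz_op :: "nat \<Rightarrow> matr \<Rightarrow> vect set \<Rightarrow> real \<Rightarrow> (vect \<Rightarrow> vect) \<Rightarrow> bool" where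
  "lipschitz_op d P Z M F \<longleftrightarrow>
     (\<forall>u\<in>Z. \<forall>v\<in>Z. wnorm d (mat_inv d P) (F u - F v) \<le> M * wnorm d P (u - v))"

text \<open>
  The subdifferential at \<open>u\<close> of a function \<open>h\<close> with domain \<open>D\<close> (that is, of the extension of \<open>h\<close>
  by $+\infty$ outside \<open>D\<close>). The domain is kept separate from the feasible set \<open>Z \<subseteq> D\<close>: for \<open>D = Z\<close> the
  subdifferential contains translates of the normal cone of \<open>Z\<close>, and is therefore unbounded at the
  boundary points of \<open>Z\<close>, whereas for \<open>D = Rspace d\<close> it is the subdifferential of a finite convex function
  on the whole space.
\<close>

definition subdifferential :: "nat \<Rightarrow> vect set \<Rightarrow> (vect \<Rightarrow> real) \<Rightarrow> vect \<Rightarrow> vect set" where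
  "subdifferential d D h u = {g \<in> Rspace d. \<forall>v\<in>D. h v \<ge> h u + ip g (v - u)}"

text \<open>
  The case distinction is needed because \<open>0 powr 0 = 0\<close>, while the bound for \<open>\<nu> = 0\<close> is \<open>H\<close>, also for
  two subgradients at the same point.
\<close>

definition holder_cond ::
  "nat \<Rightarrow> matr \<Rightarrow> vect set \<Rightarrow> vect set \<Rightarrow> real \<Rightarrow> real \<Rightarrow> (vect \<Rightarrow> real) \<Rightarrow> bool" where
  "holder_cond d P Z D \<nu> H h \<longleftrightarrow>
     (\<forall>u\<in>Z. \<forall>v\<in>Z. \<forall>g\<in>subdifferential d D h u. \<forall>g'\<in>subdifferential d D h v.
        wnorm d (mat_inv d P) (g - g') \<le> (if \<nu> = 0 then H else H * wnorm d P (u - v) powr \<nu>))"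


section \<open>The Sliding Algorithm\<close>

text \<open>
  A multi-index $(t_1,\dots,t_k)$ is the list \<open>[t\<^sub>1, ..., t\<^sub>k]\<close>; the superscript \<open>k\<close> of the quantities
  indexed by it is its length. Component pairs and the numbers \<open>T\<close> are indexed from 1, list positions
  from 0, so $t_{l+1}$ is \<open>t ! l\<close>.

  \<open>it_z\<close> and \<open>it_zbar\<close> hold $z^k_{\mathbf t}$ and $\bar z^k_{\mathbf t}$. \<open>memo_g\<close> and \<open>memo_q\<close> hold those
  vectors $\tilde\nabla p_i(w^i_{\mathbf t})$ and $Q_i(z^i_{\mathbf t})$ that have already been computed, and
  \<open>cnt_g i\<close> and \<open>cnt_q i\<close> are the numbers of evaluations of the oracle of $p_i$ and of $Q_i$ so far.
\<close>

record alg_state =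
  it_z :: "nat list \<Rightarrow> vect"
  it_zbar :: "nat list \<Rightarrow> vect"
  memo_g :: "nat list \<Rightarrow> vect option"
  memo_q :: "nat list \<Rightarrow> vect option"
  cnt_g :: "nat \<Rightarrow> nat"
  cnt_q :: "nat \<Rightarrow> nat"

text \<open>
  \<open>G i t w\<close> is the answer of the oracle of $p_i$ at the point \<open>w\<close>. It may depend on the multi-index \<open>t\<close>
  for which it is requested, so that the answers at equal points may differ.
\<close>

locale sliding =
  fixes d :: nat and n :: nat and Z :: "vect set" and P :: matr
    and Q :: "nat \<Rightarrow> vect \<Rightarrow> vect"
    and G :: "nat \<Rightarrow> nat list \<Rightarrow> vect \<Rightarrow> vect"
    and T :: "nat \<Rightarrow> nat" and \<alpha> :: "nat \<Rightarrow> real" and \<eta> :: "nat list \<Rightarrow> real"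
    and z_in :: vect
begin

definition w_point :: "alg_state \<Rightarrow> nat list \<Rightarrow> vect" where
  "w_point s t =
     foldr (\<lambda>l x. \<alpha> (t ! l) *\<^sub>R x + (1 - \<alpha> (t ! l)) *\<^sub>R it_zbar s (take (Suc l) t))
       [0..<length t] (it_z s t)"

definition require_g :: "nat list \<Rightarrow> alg_state \<Rightarrow> alg_state" where
  "require_g t s = (case memo_g s t of
      Some _ \<Rightarrow> s
    | None \<Rightarrow> s\<lparr>memo_g := (memo_g s)(t \<mapsto> G (length t) t (w_point s t)),
                cnt_g := (cnt_g s)(length t := Suc (cnt_g s (length t)))\<rparr>)"

definition require_q :: "nat list \<Rightarrow> alg_state \<Rightarrow> alg_state" where
  "require_q t s = (case memo_q s t of
      Some _ \<Rightarrow> s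
    | None \<Rightarrow> s\<lparr>memo_q := (memo_q s)(t \<mapsto> Q (length t) (it_z s t)),
                cnt_q := (cnt_q s)(length t := Suc (cnt_q s (length t)))\<rparr>)"

text \<open>Case (a), \<open>length t = n\<close>.\<close>

definition rec_leaf :: "nat list \<Rightarrow> alg_state \<Rightarrow> vect \<times> alg_state" where
  "rec_leaf t s =
     (let s' = fold (\<lambda>i s. require_q (take i t) (require_g (take i t) s)) [1..<Suc n] s
      in (arg_min_on
            (\<lambda>z. \<Sum>i=1..n. ip (the (memo_g s' (take i t)) + the (memo_q s' (take i t))) z
                   + 1/2 * \<eta> (take i t) * (wnorm d P (z - it_z s' (take i t)))\<^sup>2) Z,
          s'))"

text \<open>
  One pass, with index \<open>j\<close>, of the loop of case (b) for the multi-index \<open>t\<close> of length \<open>k < n\<close>; \<open>r\<close> is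
  the recursive procedure. The increment of \<open>cnt_q\<close> accounts for $Q_{k+1}(\tilde z^{k+1}_{\mathbf t'})$.
\<close>

definition loop_pass ::
  "(nat list \<Rightarrow> alg_state \<Rightarrow> vect \<times> alg_state) \<Rightarrow> nat list \<Rightarrow> nat \<Rightarrow> alg_state \<Rightarrow> alg_state" where
  "loop_pass r t j s =
     (let k = length t;
          t' = t @ [j];
          t'' = t @ [Suc j];
          (zt, s1) = r t' s;
          s2 = s1\<lparr>it_zbar := (it_zbar s1)(t'' := \<alpha> j *\<^sub>R zt + (1 - \<alpha> j) *\<^sub>R it_zbar s1 t')\<rparr>;
          s3 = require_q t' s2;
          q = Q (Suc k) zt;
          s4 = s3\<lparr>cnt_q := (cnt_q s3)(Suc k := Suc (cnt_q s3 (Suc k)))\<rparr>;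
          s5 = s4\<lparr>it_z := (it_z s4)(t'' :=
                 arg_min_on (\<lambda>z. ip (q - the (memo_q s4 t')) z
                               + 1/2 * \<eta> t' * (wnorm d P (z - zt))\<^sup>2) Z)\<rparr>
      in fold (\<lambda>l s. s\<lparr>it_z := (it_z s)(t'' @ replicate (l - (k + 1)) 0 :=
                                     it_z s (t' @ [T (k + 2)] @ replicate (l - (k + 2)) 0))\<rparr>)
           [k + 2..<Suc n] s5)"

text \<open>\<open>rec m t\<close> is $\mathrm{Rec}(k,\mathbf t)$ for \<open>k = length t\<close> and \<open>m = n - k\<close>.\<close>

primrec rec :: "nat \<Rightarrow> nat list \<Rightarrow> alg_state \<Rightarrow> vect \<times> alg_state" where
  "rec 0 t s = rec_leaf t s"
| "rec (Suc m) t s =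
     (let k = length t;
          s0 = s\<lparr>it_zbar := (it_zbar s)(t @ [0] := it_z s (t @ [0]))\<rparr>;
          s1 = fold (loop_pass (rec m) t) [0..<T (Suc k)] s0
      in (it_zbar s1 (t @ [T (Suc k)]), s1))"

definition init :: alg_state where
  "init = \<lparr>it_z = (\<lambda>t. if set t \<subseteq> {0} then z_in else undefined), it_zbar = (\<lambda>_. undefined),
           memo_g = Map.empty, memo_q = Map.empty, cnt_g = (\<lambda>_. 0), cnt_q = (\<lambda>_. 0)\<rparr>"

definition z_out :: vect where
  "z_out = fst (rec n [] init)"

definition p_evals :: "nat \<Rightarrow> nat" where
  "p_evals i = cnt_g (snd (rec n [] init)) i"

definition Q_evals :: "nat \<Rightarrow> nat" where
  "Q_evals i = cnt_q (snd (rec n [] init)) i"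

end


section \<open>Parameters of the algorithm\<close>

primrec alpha :: "nat \<Rightarrow> real" where
  "alpha 0 = 1"
| "alpha (Suc t) = 2 / (1 + sqrt (1 + 4 / (alpha t)\<^sup>2))"

definition K_par :: "real \<Rightarrow> real \<Rightarrow> real" where
  "K_par \<nu> H = ((1 - \<nu>) / (2 * (1 + \<nu>))) powr ((1 - \<nu>) / (1 + \<nu>)) * H powr (2 / (1 + \<nu>))"

definition N_par :: "(nat \<Rightarrow> nat) \<Rightarrow> nat \<Rightarrow> nat" where
  "N_par T k = (\<Prod>j=1..k. T j)"

definition delta_par :: "(nat \<Rightarrow> nat) \<Rightarrow> real \<Rightarrow> nat \<Rightarrow> real \<Rightarrow> real \<Rightarrow> real" where
  "delta_par T \<Omega> k \<nu> H =
     ((1 - \<nu>) * 2 ^ (2 * k - 1) * K_par \<nu> H * \<Omega> / ((1 + \<nu>) * real (N_par T k) ^ 3))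
       powr ((1 + \<nu>) / 2)"

definition L_par :: "(nat \<Rightarrow> nat) \<Rightarrow> real \<Rightarrow> nat \<Rightarrow> real \<Rightarrow> real \<Rightarrow> real" where
  "L_par T \<Omega> k \<nu> H =
     (if \<nu> = 1 then H
      else if delta_par T \<Omega> k \<nu> H = 0 then 0
      else K_par \<nu> H * delta_par T \<Omega> k \<nu> H powr (- ((1 - \<nu>) / (1 + \<nu>))))"

definition eta ::
  "(nat \<Rightarrow> nat) \<Rightarrow> real \<Rightarrow> (nat \<Rightarrow> real) \<Rightarrow> (nat \<Rightarrow> real) \<Rightarrow> (nat \<Rightarrow> real) \<Rightarrow> nat list \<Rightarrow> real" where
  "eta T \<Omega> M \<nu> H t =
     (let k = length t
      in L_par T \<Omega> k (\<nu> k) (H k) * (\<Prod>l<k. alpha (t ! l))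
         + M k * (\<Prod>l<k. alpha (t ! l) / alpha (T (Suc l) - 1)))"

definition R_par :: "real \<Rightarrow> real \<Rightarrow> real \<Rightarrow> real \<Rightarrow> real \<Rightarrow> real" where
  "R_par \<Omega> \<epsilon> M \<nu> H =
     Max {(H * \<Omega> powr ((1 + \<nu>) / 2) / \<epsilon>) powr (2 / (1 + 3 * \<nu>)), M * \<Omega> / \<epsilon>, 1}"

end

theory Submission
  imports Defs
begin

text \<open>
  The algorithm nests \<open>n\<close> accelerated extragradient loops. The mathematical core is an invariant of the
  recursive procedure. When it is called for a multi-index \<open>t\<close> of length \<open>k\<close>, the oracle answers of the
  components \<open>i \<le> k\<close> are fixed vectors, while each component \<open>i > k\<close> is still seen as a whole, but
  through the affine contraction \<open>avg s t\<close>, the composition \<open>a\<^sub>1 \<circ> \<dots> \<circ> a\<^sub>k\<close> of the averaging maps, whose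
  factor is \<open>coef t = \<alpha>\<^bsub>t1\<^esub> \<dots> \<alpha>\<^bsub>tk\<^esub>\<close>. The call approximately solves the variational inequality for the sum of

    \<^item> the fixed linear terms and the proximal terms of the components \<open>i \<le> k\<close>, and
    \<^item> the functions \<open>p\<^sub>i (avg s t x) / coef t\<close> and the operators \<open>Q\<^sub>i\<close> of the components \<open>i > k\<close>.

  Its quality is measured by the function \<open>gap\<close>, and \<open>rec_completes\<close> bounds it by \<open>gap_bound\<close>: for each
  deeper level a multiple of the decrease of the squared distance from an arbitrary point to the current
  iterate of that level, plus a smoothing error. At the leaves this is the optimality condition of the
  proximal step (\<open>prox_step\<close>). One loop of level \<open>k + 1\<close> turns the bounds for its passes into the bound
  for the whole call: the gap is convex, so the average over the passes obeys the recursion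
  \<open>V\<^bsub>j+1\<^esub> \<le> (1 - \<alpha>\<^sub>j) V\<^sub>j + \<alpha>\<^sub>j B\<^sub>j\<close> (\<open>gap_step\<close>). There, the linearisation of \<open>p\<^bsub>k+1\<^esub>\<close> is undone by
  smoothness and that of \<open>Q\<^bsub>k+1\<^esub>\<close> by the extragradient correction, and both costs are absorbed by the step
  size. The weights satisfy \<open>(1 - \<alpha>\<^sub>j) / \<alpha>\<^sub>j\<^sup>2 = 1 / \<alpha>\<^bsub>j-1\<^esub>\<^sup>2\<close>, so the recursion telescopes
  (\<open>alpha_weighted_recursion\<close>). The step sizes of all deeper levels contain the factor \<open>\<alpha>\<^sub>j\<close>, and the iterates
  of a deeper level start each pass where the previous one ended; therefore their distances telescope, too.

  A Hoelder continuous subgradient is treated as a Lipschitz continuous one up to an additive error \<open>\<delta>\<close>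
  (\<open>holder_remainder_le_quadratic\<close>). At the root the result is, with \<open>N\<^sub>i = T\<^sub>1 \<dots> T\<^sub>i\<close>, a bound by

  \[\sum_i \frac{\Omega}{2}\Big(\frac{4^i L_i}{N_i^2} + \frac{2^i M_i}{N_i}\Big) + \delta_i N_i\]

  (\<open>z_out_gap\<close>), and each summand is at most \<open>\<epsilon>\<close> once \<open>N\<^sub>i\<close> is a sufficiently large constant multiple of
  \<open>R\<^sub>i\<close> (\<open>component_error_le\<close>). Since the \<open>R\<^sub>i\<close> increase, the \<open>T\<^sub>i\<close> can be chosen such that \<open>N\<^sub>i\<close> is also at most
  a constant multiple of \<open>R\<^sub>i\<close> (\<open>iteration_numbers_exist\<close>). Finally \<open>p\<^sub>i'\<close> is evaluated once and \<open>Q\<^sub>i\<close> twice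
  for each of the \<open>N\<^sub>i\<close> multi-indices of length \<open>i\<close>.

  The analysis refers to one memory state although the algorithm keeps overwriting its state. This is
  justified by \<open>rec_changes\<close>: a call for \<open>t\<close> affects only what belongs to extensions of \<open>t\<close>, apart from
  storing the oracle answers for prefixes of \<open>t\<close> that are still missing.
\<close>


section \<open>Linear algebra on the coordinate subspaces\<close>

abbreviation lk :: "vect \<Rightarrow> nat \<Rightarrow> real" where
  "lk \<equiv> Poly_Mapping.lookup"

lemma lookup_scaleR: "lk (r *\<^sub>R x) i = r * lk x i"
proof -
  have "finite {i. r *\<^sub>R lk x i \<noteq> 0}"
    by (rule finite_subset[OF _ finite_keys[of x]]) (auto simp: in_keys_iff)
  then show ?thesis
    by (simp add: scaleR_poly_mapping_def Abs_poly_mapping_inverse)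
qed

lemma ip_finite:
  assumes "finite A" "Poly_Mapping.keys x \<subseteq> A"
  shows "ip x y = (\<Sum>i\<in>A. lk x i * lk y i)"
  unfolding ip_def using assms by (intro sum.mono_neutral_left) (auto simp: in_keys_iff)

lemma ip_commute: "ip x y = ip y x"
  using ip_finite[of "Poly_Mapping.keys x \<union> Poly_Mapping.keys y" x y]
    ip_finite[of "Poly_Mapping.keys x \<union> Poly_Mapping.keys y" y x]
  by (simp add: mult.commute)

lemma ip_add_left: "ip (x + y) z = ip x z + ip y z"
proof -
  let ?A = "Poly_Mapping.keys x \<union> Poly_Mapping.keys y"
  have "Poly_Mapping.keys (x + y) \<subseteq> ?A"
    by (rule Poly_Mapping.keys_add)
  then show ?thesis
    by (simp add: ip_finite[of ?A] lookup_add sum.distrib distrib_right)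
qed

lemma ip_scaleR_left: "ip (r *\<^sub>R x) z = r * ip x z"
proof -
  have "Poly_Mapping.keys (r *\<^sub>R x) \<subseteq> Poly_Mapping.keys x"
    by (auto simp: in_keys_iff lookup_scaleR)
  then show ?thesis
    by (simp add: ip_finite[of "Poly_Mapping.keys x"] lookup_scaleR sum_distrib_left mult.assoc)
qed

lemma ip_zero_left [simp]: "ip 0 z = 0"
  by (simp add: ip_def)

lemma ip_diff_left: "ip (x - y) z = ip x z - ip y z"
  using ip_add_left[of x "- y" z] ip_scaleR_left[of "-1" y z] by simp

lemma ip_sum_left: "ip (\<Sum>i\<in>I. f i) z = (\<Sum>i\<in>I. ip (f i) z)"
  by (induction I rule: infinite_finite_induct) (auto simp: ip_add_left)

lemma ip_zero_right [simp]: "ip z 0 = 0"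
  using ip_commute[of z 0] by simp

lemma ip_add_right: "ip z (x + y) = ip z x + ip z y"
  using ip_add_left[of x y z] by (simp add: ip_commute)

lemma ip_scaleR_right: "ip z (r *\<^sub>R x) = r * ip z x"
  using ip_scaleR_left[of r x z] by (simp add: ip_commute)

lemma ip_diff_right: "ip z (x - y) = ip z x - ip z y"
  using ip_diff_left[of x y z] by (simp add: ip_commute)

lemmas ip_linear = ip_add_left ip_add_right ip_diff_left ip_diff_right ip_scaleR_left ip_scaleR_right

lemma Rspace_iff: "x \<in> Rspace d \<longleftrightarrow> (\<forall>i\<ge>d. lk x i = 0)"
proof -
  have "(\<exists>i\<ge>d. lk x i \<noteq> 0) \<longleftrightarrow> \<not> Poly_Mapping.keys x \<subseteq> {..<d}"
    by (force simp: in_keys_iff subset_iff not_less)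
  then show ?thesis
    by (auto simp: Rspace_def)
qed

lemma Rspace_add: "x \<in> Rspace d \<Longrightarrow> y \<in> Rspace d \<Longrightarrow> x + y \<in> Rspace d"
  and Rspace_diff: "x \<in> Rspace d \<Longrightarrow> y \<in> Rspace d \<Longrightarrow> x - y \<in> Rspace d"
  and Rspace_scaleR: "x \<in> Rspace d \<Longrightarrow> r *\<^sub>R x \<in> Rspace d"
  by (simp_all add: Rspace_iff lookup_add lookup_minus lookup_scaleR)

lemma subspace_Rspace: "subspace (Rspace d)"
  by (auto simp: subspace_def Rspace_add Rspace_scaleR) (simp add: Rspace_iff)

lemma ip_Rspace: "x \<in> Rspace d \<Longrightarrow> ip x y = (\<Sum>i<d. lk x i * lk y i)"
  by (rule ip_finite) (auto simp: Rspace_def)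

lemma lookup_mat_app: "lk (mat_app d A x) i = (if i < d then \<Sum>j<d. A i j * lk x j else 0)"
proof -
  have "lk (mat_app d A x) i
      = (\<Sum>k<d. lk (Poly_Mapping.single k (\<Sum>j<d. A k j * lk x j)) i)"
    by (simp add: mat_app_def lookup_sum)
  also have "\<dots> = (\<Sum>k<d. if k = i then (\<Sum>j<d. A k j * lk x j) else 0)"
    by (intro sum.cong) (auto simp: lookup_single)
  finally show ?thesis
    by simp
qed

lemma mat_app_in_Rspace [simp]: "mat_app d A x \<in> Rspace d"
  by (simp add: Rspace_iff lookup_mat_app)

lemma mat_app_add: "mat_app d A (x + y) = mat_app d A x + mat_app d A y"
  by (rule poly_mapping_eqI) (simp add: lookup_mat_app lookup_add distrib_left sum.distrib)

lemma mat_app_scaleR: "mat_app d A (r *\<^sub>R x) = r *\<^sub>R mat_app d A x"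
  by (rule poly_mapping_eqI)
    (simp add: lookup_mat_app lookup_scaleR sum_distrib_left mult.left_commute)

lemma linear_mat_app: "linear (mat_app d A)"
  by (intro linearI mat_app_add mat_app_scaleR)

lemma mat_app_diff: "mat_app d A (x - y) = mat_app d A x - mat_app d A y"
  by (rule linear_diff[OF linear_mat_app])

lemma mat_app_compose:
  "mat_app d A (mat_app d B x) = mat_app d (\<lambda>i j. \<Sum>k<d. A i k * B k j) x"
proof (rule poly_mapping_eqI)
  fix i
  have "(\<Sum>k<d. A i k * (\<Sum>j<d. B k j * lk x j)) = (\<Sum>j<d. (\<Sum>k<d. A i k * B k j) * lk x j)"
    unfolding sum_distrib_left sum_distrib_right by (subst sum.swap) (simp add: mult.assoc)
  then show "lk (mat_app d A (mat_app d B x)) i = lk (mat_app d (\<lambda>i j. \<Sum>k<d. A i k * B k j) x) i"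
    by (simp add: lookup_mat_app)
qed

lemma mat_app_identity:
  assumes "\<And>i j. i < d \<Longrightarrow> j < d \<Longrightarrow> A i j = (if i = j then 1 else 0)" "x \<in> Rspace d"
  shows "mat_app d A x = x"
proof (rule poly_mapping_eqI)
  fix i
  have "(\<Sum>j<d. A i j * lk x j) = (\<Sum>j<d. if j = i then lk x j else 0)" if "i < d"
    using that by (intro sum.cong) (auto simp: assms(1))
  then show "lk (mat_app d A x) i = lk x i"
    using assms(2) by (auto simp: lookup_mat_app Rspace_iff)
qed

lemma single_in_Rspace [simp]: "i < d \<Longrightarrow> Poly_Mapping.single i r \<in> Rspace d"
  by (auto simp: Rspace_iff lookup_single when_def)

lemma ip_single: "ip (Poly_Mapping.single i r) x = r * lk x i"
  by (cases "r = 0") (simp_all add: ip_def)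

lemma Rspace_eq_sum_single: "x \<in> Rspace d \<Longrightarrow> x = (\<Sum>i<d. lk x i *\<^sub>R Poly_Mapping.single i 1)"
proof (rule poly_mapping_eqI)
  fix i
  assume x: "x \<in> Rspace d"
  have "lk (\<Sum>i<d. lk x i *\<^sub>R Poly_Mapping.single i 1) i = (\<Sum>j<d. if j = i then lk x j else 0)"
    by (simp add: lookup_sum lookup_scaleR lookup_single when_def if_distrib cong: if_cong)
  then show "lk x i = lk (\<Sum>i<d. lk x i *\<^sub>R Poly_Mapping.single i 1) i"
    using x by (simp add: Rspace_iff)
qed

definition std_basis :: "nat \<Rightarrow> vect set" where
  "std_basis d = (\<lambda>i. Poly_Mapping.single i 1) ` {..<d}"

lemma card_std_basis: "card (std_basis d) = d"
proof -
  have "inj_on (\<lambda>i. Poly_Mapping.single i (1::real)) {..<d}"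
    by (rule inj_onI) (metis lookup_single_eq lookup_single_not_eq zero_neq_one)
  then show ?thesis
    by (simp add: std_basis_def card_image)
qed

lemma Rspace_subset_span: "Rspace d \<subseteq> span (std_basis d)"
proof
  fix x assume "x \<in> Rspace d"
  then have "x = (\<Sum>i<d. lk x i *\<^sub>R Poly_Mapping.single i 1)"
    by (rule Rspace_eq_sum_single)
  also have "\<dots> \<in> span (std_basis d)"
    by (intro span_sum span_scale span_base) (auto simp: std_basis_def)
  finally show "x \<in> span (std_basis d)" .
qed

lemma independent_std_basis: "independent (std_basis d)"
proof (rule independent_if_scalars_zero)
  show "finite (std_basis d)"
    by (simp add: std_basis_def)
next
  fix f x
  assume sum: "(\<Sum>x\<in>std_basis d. f x *\<^sub>R x) = 0" and "x \<in> std_basis d"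
  then obtain i where i: "i < d" "x = Poly_Mapping.single i 1"
    by (auto simp: std_basis_def)
  have inj: "inj_on (\<lambda>i. Poly_Mapping.single i (1::real)) {..<d}"
    by (rule inj_onI) (metis lookup_single_eq lookup_single_not_eq zero_neq_one)
  have "0 = lk (\<Sum>x\<in>std_basis d. f x *\<^sub>R x) i"
    by (simp add: sum)
  also have "\<dots> = (\<Sum>j<d. if j = i then f x else 0)"
    unfolding std_basis_def using inj i
    by (simp add: sum.reindex lookup_sum lookup_scaleR lookup_single when_def if_distrib cong: if_cong)
  finally show "f x = 0"
    using i by simp
qed

text \<open>
  An injective linear map of a space of dimension \<open>d\<close> into itself is onto: otherwise a vector outside
  the range could be added to the image of a basis, giving \<open>d + 1\<close> independent vectors.
\<close>

lemma mat_app_surj: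
  assumes inj: "\<And>x. x \<in> Rspace d \<Longrightarrow> mat_app d A x = 0 \<Longrightarrow> x = 0" and y: "y \<in> Rspace d"
  obtains x where "x \<in> Rspace d" "mat_app d A x = y"
proof -
  let ?S = "mat_app d A ` std_basis d"
  have span_R: "span (std_basis d) \<subseteq> Rspace d"
    by (intro span_minimal subspace_Rspace) (auto simp: std_basis_def)
  have inj_span: "inj_on (mat_app d A) (span (std_basis d))"
  proof (rule inj_onI)
    fix u v assume "u \<in> span (std_basis d)" "v \<in> span (std_basis d)" "mat_app d A u = mat_app d A v"
    then have "u - v = 0"
      using span_R by (rule_tac inj) (auto simp: mat_app_diff intro: Rspace_diff)
    then show "u = v" by simp
  qed
  have "independent ?S"
    by (rule linear_independent_injective_image[OF linear_mat_app independent_std_basis inj_span])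
  moreover have "card ?S = d"
    using inj_span by (subst card_image) (auto simp: card_std_basis inj_on_def intro: span_base)
  moreover have "y \<in> span ?S"
  proof (rule ccontr)
    assume n: "y \<notin> span ?S"
    then have ind: "independent (insert y ?S)"
      using \<open>independent ?S\<close> by (simp add: independent_insertI)
    have "insert y ?S \<subseteq> span (std_basis d)"
      using y Rspace_subset_span[of d] mat_app_in_Rspace[of d A] by blast
    then have "card (insert y ?S) \<le> card (std_basis d)"
      using independent_span_bound[OF _ ind] by (auto simp: std_basis_def)
    moreover have "finite ?S"
      by (simp add: std_basis_def)
    moreover have "y \<notin> ?S"
      by (rule contrapos_nn[OF n span_base])
    ultimately show False
      using \<open>card ?S = d\<close> \<open>finite ?S\<close> by (simp add: card_std_basis)
  qed
  ultimately have "y \<in> mat_app d A ` span (std_basis d)"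
    by (simp add: linear_span_image[OF linear_mat_app])
  then show ?thesis
    using that span_R by blast
qed

text \<open>
  Preimages of the unit vectors are the columns of a right inverse. Injectivity makes it a two-sided
  inverse, so that the choice in \<open>mat_inv\<close> has a witness.
\<close>

lemma mat_app_mat_inv:
  assumes inj: "\<And>x. x \<in> Rspace d \<Longrightarrow> mat_app d A x = 0 \<Longrightarrow> x = 0" and y: "y \<in> Rspace d"
  shows "mat_app d A (mat_app d (mat_inv d A) y) = y"
proof -
  define e :: "nat \<Rightarrow> vect" where "e j = Poly_Mapping.single j 1" for j
  have "\<exists>x\<in>Rspace d. mat_app d A x = e j" if "j < d" for j
    using mat_app_surj[of d A "e j", OF inj] that by (auto simp: e_def)
  then obtain c where c: "\<And>j. j < d \<Longrightarrow> c j \<in> Rspace d \<and> mat_app d A (c j) = e j"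
    by metis
  define B where "B k j = lk (c j) k" for k j
  have AB: "(\<Sum>k<d. A i k * B k j) = (if i = j then 1 else 0)" if "i < d" "j < d" for i j
  proof -
    have "(\<Sum>k<d. A i k * B k j) = lk (mat_app d A (c j)) i"
      using that by (simp add: lookup_mat_app B_def)
    then show ?thesis
      using c that by (simp add: e_def lookup_single when_def)
  qed
  have AB_id: "mat_app d A (mat_app d B x) = x" if "x \<in> Rspace d" for x
    unfolding mat_app_compose by (rule mat_app_identity) (use AB that in auto)
  have BA_id: "mat_app d B (mat_app d A x) = x" if "x \<in> Rspace d" for x
  proof -
    have "mat_app d B (mat_app d A x) - x = 0"
      using that by (rule_tac inj) (auto simp: mat_app_diff AB_id intro: Rspace_diff)
    then show ?thesis by simp
  qed
  have BA: "(\<Sum>k<d. B i k * A k j) = (if i = j then 1 else 0)" if "i < d" "j < d" for i j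
  proof -
    have "(\<Sum>k<d. B i k * A k j) = lk (mat_app d B (mat_app d A (e j))) i"
      using that by (simp add: mat_app_compose lookup_mat_app e_def lookup_single when_def if_distrib
          cong: if_cong)
    also have "\<dots> = lk (e j) i"
      using that by (simp add: BA_id e_def)
    finally show ?thesis
      by (simp add: e_def lookup_single when_def)
  qed
  have "\<forall>i<d. \<forall>j<d. (\<Sum>k<d. A i k * mat_inv d A k j) = (if i = j then 1 else 0) \<and>
     (\<Sum>k<d. mat_inv d A i k * A k j) = (if i = j then 1 else 0)"
    unfolding mat_inv_def by (rule someI[where x = B]) (use AB BA in auto)
  then show ?thesis
    unfolding mat_app_compose using y by (intro mat_app_identity) auto
qed

section \<open>The geometry of a positive definite matrix\<close>

locale weighted_space =
  fixes d :: nat and P :: matr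
  assumes spd: "sym_pos_def d P"
begin

definition pip :: "vect \<Rightarrow> vect \<Rightarrow> real" where
  "pip x y = ip (mat_app d P x) y"

definition nsq :: "vect \<Rightarrow> real" where
  "nsq x = pip x x"

lemma pip_commute: "pip x y = pip y x"
proof -
  have eq: "pip x y = (\<Sum>i<d. \<Sum>j<d. P i j * lk x j * lk y i)" for x y
    by (simp add: pip_def ip_Rspace[where d = d] lookup_mat_app sum_distrib_right)
  have "pip x y = (\<Sum>j<d. \<Sum>i<d. P i j * lk x j * lk y i)"
    unfolding eq by (rule sum.swap)
  also have "\<dots> = pip y x"
    unfolding eq using spd by (intro sum.cong) (auto simp: sym_pos_def_def)
  finally show ?thesis .
qed

lemma pip_linear:
  "pip (x + y) z = pip x z + pip y z" "pip z (x + y) = pip z x + pip z y"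
  "pip (x - y) z = pip x z - pip y z" "pip z (x - y) = pip z x - pip z y"
  "pip (r *\<^sub>R x) z = r * pip x z" "pip z (r *\<^sub>R x) = r * pip z x"
  by (simp_all add: pip_def mat_app_add mat_app_diff mat_app_scaleR ip_linear)

lemma pip_zero [simp]: "pip 0 x = 0" "pip x 0 = 0"
  using pip_linear(5)[of 0 0 x] pip_linear(6)[of x 0 0] by simp_all

lemma nsq_pos: "x \<in> Rspace d \<Longrightarrow> x \<noteq> 0 \<Longrightarrow> nsq x > 0"
  using spd by (auto simp: nsq_def pip_def sym_pos_def_def)

lemma nsq_nonneg: "x \<in> Rspace d \<Longrightarrow> nsq x \<ge> 0"
  using nsq_pos[of x] by (cases "x = 0") (auto simp: nsq_def)

lemma nsq_scaleR: "nsq (r *\<^sub>R x) = r\<^sup>2 * nsq x"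
  by (simp add: nsq_def pip_linear power2_eq_square)

lemma nsq_diff_commute: "nsq (x - y) = nsq (y - x)"
  using nsq_scaleR[of "-1" "x - y"] by simp

lemma wnorm_sq: "x \<in> Rspace d \<Longrightarrow> (wnorm d P x)\<^sup>2 = nsq x"
  using nsq_nonneg[of x] by (simp add: wnorm_def nsq_def pip_def)

lemma wnorm_eq: "wnorm d P x = sqrt (nsq x)"
  by (simp add: wnorm_def nsq_def pip_def)

lemma wnorm_nonneg: "x \<in> Rspace d \<Longrightarrow> wnorm d P x \<ge> 0"
  by (simp add: wnorm_eq nsq_nonneg)

lemma nsq_convex_comb:
  "nsq ((1 - \<theta>) *\<^sub>R x + \<theta> *\<^sub>R y) = (1 - \<theta>) * nsq x + \<theta> * nsq y - \<theta> * (1 - \<theta>) * nsq (x - y)"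
  unfolding nsq_def pip_linear by (simp add: pip_commute[of y x] algebra_simps)

lemma pip_Cauchy_Schwarz:
  assumes "x \<in> Rspace d" "y \<in> Rspace d"
  shows "pip x y \<le> wnorm d P x * wnorm d P y"
proof (cases "y = 0")
  case False
  then have y: "nsq y > 0"
    using assms nsq_pos by auto
  have "0 \<le> nsq (nsq y *\<^sub>R x - pip x y *\<^sub>R y)"
    using assms by (intro nsq_nonneg Rspace_diff Rspace_scaleR)
  also have "\<dots> = nsq y * (nsq x * nsq y - (pip x y)\<^sup>2)"
    unfolding nsq_def pip_linear
    by (simp add: pip_commute[of y x] algebra_simps power2_eq_square)
  finally have "(pip x y)\<^sup>2 \<le> nsq x * nsq y"
    using y by (simp add: zero_le_mult_iff)
  then have "pip x y \<le> sqrt (nsq x * nsq y)"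
    using real_le_rsqrt by blast
  then show ?thesis
    by (simp add: wnorm_eq real_sqrt_mult)
qed (simp add: wnorm_eq nsq_def)

lemma mat_app_inj: "x \<in> Rspace d \<Longrightarrow> mat_app d P x = 0 \<Longrightarrow> x = 0"
  using nsq_pos[of x] by (force simp: nsq_def pip_def)

text \<open>
  The norm of the inverse matrix is dual to the norm of the matrix: writing \<open>g\<close> as the image of a
  vector \<open>y\<close> under the matrix turns the pairing into the weighted inner product with \<open>y\<close>.
\<close>

lemma ip_le_dual:
  assumes g: "g \<in> Rspace d" and x: "x \<in> Rspace d"
  shows "ip g x \<le> wnorm d (mat_inv d P) g * wnorm d P x"
proof -
  define y where "y = mat_app d (mat_inv d P) g"
  have "y \<in> Rspace d"
    by (simp add: y_def)
  have gy: "g = mat_app d P y"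
    unfolding y_def using mat_app_mat_inv[OF mat_app_inj g] by simp
  have "wnorm d (mat_inv d P) g = wnorm d P y"
    unfolding wnorm_def by (fold y_def, fold gy) (simp add: ip_commute)
  then show ?thesis
    using pip_Cauchy_Schwarz[of y x] x \<open>y \<in> Rspace d\<close> by (simp add: pip_def flip: gy)
qed

text \<open>
  Coordinates are pairings with unit vectors, hence controlled by duality. This compares the weighted
  norm with the coordinates, and so with the topology of the type.
\<close>

lemma lookup_le_wnorm: "\<exists>B. \<forall>x\<in>Rspace d. \<bar>lk x i\<bar> \<le> B * wnorm d P x"
proof (cases "i < d")
  case True
  show ?thesis
  proof (intro exI ballI)
    fix x assume x: "x \<in> Rspace d"
    let ?e = "Poly_Mapping.single i 1" and ?f = "Poly_Mapping.single i (- 1)"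
    let ?w = "wnorm d (mat_inv d P)"
    have 1: "lk x i \<le> ?w ?e * wnorm d P x"
      using ip_le_dual[of ?e x] True x by (simp add: ip_single)
    have 2: "- lk x i \<le> ?w ?f * wnorm d P x"
      using ip_le_dual[of ?f x] True x by (simp add: ip_single)
    have "?w ?e * wnorm d P x \<le> max (?w ?e) (?w ?f) * wnorm d P x"
      "?w ?f * wnorm d P x \<le> max (?w ?e) (?w ?f) * wnorm d P x"
      using wnorm_nonneg[OF x] by (auto intro: mult_right_mono)
    with 1 2 show "\<bar>lk x i\<bar> \<le> max (?w ?e) (?w ?f) * wnorm d P x"
      by linarith
  qed
qed (auto simp: Rspace_iff intro!: exI[of _ 0])

end

text \<open>
  By induction on the dimension, the box is the sum of a lower-dimensional box and a segment.
\<close>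

lemma compact_Rspace_box: "compact {x \<in> Rspace d. \<forall>i<d. \<bar>lk x i\<bar> \<le> B}"
proof (induction d)
  case 0
  have "{x \<in> Rspace 0. \<forall>i<0. \<bar>lk x i\<bar> \<le> B} = {0}"
    by (auto simp: Rspace_iff intro: poly_mapping_eqI)
  then show ?case by simp
next
  case (Suc d)
  let ?K = "{x \<in> Rspace d. \<forall>i<d. \<bar>lk x i\<bar> \<le> B}"
  let ?L = "(\<lambda>r. r *\<^sub>R Poly_Mapping.single d (1::real)) ` {- B..B}"
  have "{x \<in> Rspace (Suc d). \<forall>i<Suc d. \<bar>lk x i\<bar> \<le> B} = {x + y |x y. x \<in> ?K \<and> y \<in> ?L}"
    (is "?X = ?Y")
  proof (intro equalityI subsetI)
    fix x assume x: "x \<in> ?X"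
    let ?y = "lk x d *\<^sub>R Poly_Mapping.single d (1::real)"
    have "\<bar>lk x d\<bar> \<le> B"
      using x by blast
    then have "x - ?y \<in> ?K" "?y \<in> ?L"
      using x by (auto simp: Rspace_iff lookup_minus lookup_scaleR lookup_single when_def abs_le_iff
          intro!: image_eqI[where x = "lk x d"])
    moreover have "x = (x - ?y) + ?y" by simp
    ultimately show "x \<in> ?Y" by blast
  next
    fix x assume "x \<in> ?Y"
    then show "x \<in> ?X"
      by (auto simp: Rspace_iff lookup_add lookup_scaleR lookup_single when_def less_Suc_eq)
  qed
  moreover have "compact ?L"
    by (intro compact_continuous_image continuous_intros) auto
  ultimately show ?case
    using compact_sums[OF Suc.IH \<open>compact ?L\<close>] by simp
qed

lemma continuous_lookup: "continuous_on A (\<lambda>x. lk x i)"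
proof (rule continuous_on_subset[OF _ subset_UNIV])
  have "\<bar>lk x i\<bar> \<le> norm x" for x
  proof (cases "i \<in> Poly_Mapping.keys x")
    case True
    then show ?thesis
      unfolding norm_poly_mapping_def dist_poly_mapping_def
      using member_le_sum[of i "Poly_Mapping.keys x" "\<lambda>n. \<bar>lk x n\<bar>"] by simp
  qed (simp add: in_keys_iff)
  then have "bounded_linear (\<lambda>x. lk x i)"
    by (intro bounded_linear_intro[of _ 1]) (auto simp: lookup_add lookup_scaleR)
  then show "continuous_on UNIV (\<lambda>x. lk x i)"
    by (rule linear_continuous_on)
qed

context weighted_space
begin

lemma compact_if_bounded:
  assumes "closed Z" "Z \<subseteq> Rspace d" "a \<in> Z" "bdd_above ((\<lambda>z. (wnorm d P (a - z))\<^sup>2) ` Z)"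
  shows "compact Z"
proof -
  obtain r where r: "\<And>z. z \<in> Z \<Longrightarrow> (wnorm d P (a - z))\<^sup>2 \<le> r"
    using assms(4) by (auto simp: bdd_above_def)
  obtain b where b: "\<And>i x. x \<in> Rspace d \<Longrightarrow> \<bar>lk x i\<bar> \<le> b i * wnorm d P x"
    using lookup_le_wnorm by metis
  define c where "c i = \<bar>lk a i\<bar> + \<bar>b i\<bar> * sqrt r" for i
  have bnd: "\<bar>lk z i\<bar> \<le> c i" if "z \<in> Z" for z i
  proof -
    have R: "a - z \<in> Rspace d"
      using assms that by (auto intro: Rspace_diff)
    have w: "wnorm d P (a - z) \<le> sqrt r"
      using r[OF that] by (rule real_le_rsqrt)
    have "\<bar>lk (a - z) i\<bar> \<le> b i * wnorm d P (a - z)"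
      by (rule b[OF R])
    also have "\<dots> \<le> \<bar>b i\<bar> * wnorm d P (a - z)"
      using wnorm_nonneg[OF R] by (intro mult_right_mono) auto
    also have "\<dots> \<le> \<bar>b i\<bar> * sqrt r"
      using w by (intro mult_left_mono) auto
    finally show ?thesis
      by (simp add: c_def lookup_minus)
  qed
  define B where "B = (\<Sum>i<d. c i)"
  have "c i \<ge> 0" for i
    using bnd[OF assms(3), of i] by linarith
  then have "c i \<le> B" if "i < d" for i
    unfolding B_def using that by (intro member_le_sum) auto
  then have "Z \<subseteq> {x \<in> Rspace d. \<forall>i<d. \<bar>lk x i\<bar> \<le> B}" (is "Z \<subseteq> ?K")
    using assms(2) order_trans[OF bnd] by blast
  then have "?K \<inter> Z = Z"
    by (rule Int_absorb1)
  then show ?thesis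
    using compact_Int_closed[OF compact_Rspace_box assms(1), of d B] by simp
qed

lemma continuous_nsq_diff: "continuous_on A (\<lambda>x. nsq (x - a))"
proof -
  have "nsq (x - a) = (\<Sum>i<d. (\<Sum>j<d. P i j * (lk x j - lk a j)) * (lk x i - lk a i))" for x
    by (simp add: nsq_def pip_def ip_Rspace[where d = d] lookup_mat_app lookup_minus)
  then show ?thesis
    by (auto intro!: continuous_intros continuous_lookup)
qed

lemma continuous_ip: "g \<in> Rspace d \<Longrightarrow> continuous_on A (ip g)"
  by (subst continuous_on_cong[OF refl ip_Rspace[of g d]])
    (auto intro!: continuous_intros continuous_lookup)

text \<open>
  The optimality condition of a proximal step with several centres. The objective \<open>f\<close> is strongly convex
  of modulus \<open>\<Sum>h\<^sub>i\<close>, so its value at \<open>z\<close> exceeds the minimum by at least \<open>\<Sum>h\<^sub>i / 2\<close> times the squared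
  distance of \<open>z\<close> from the minimiser \<open>x\<close>: compare the minimum with the value at \<open>(1 - \<theta>) x + \<theta> z\<close>, divide by \<open>\<theta>\<close> and let \<open>\<theta>\<close> tend to 0.
\<close>

lemma prox_step:
  fixes b c :: "'i \<Rightarrow> vect" and h :: "'i \<Rightarrow> real"
  assumes Z: "Z \<subseteq> Rspace d" "convex Z" "compact Z" "Z \<noteq> {}"
    and I: "finite I" "\<And>i. i \<in> I \<Longrightarrow> b i \<in> Rspace d" "\<And>i. i \<in> I \<Longrightarrow> c i \<in> Rspace d"
    and x: "x = arg_min_on (\<lambda>z. \<Sum>i\<in>I. ip (b i) z + 1/2 * h i * (wnorm d P (z - c i))\<^sup>2) Z"
  shows "x \<in> Z"
    and "\<And>z. z \<in> Z \<Longrightarrow> (\<Sum>i\<in>I. ip (b i) (x - z))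
      \<le> (\<Sum>i\<in>I. 1/2 * h i * (nsq (z - c i) - nsq (x - c i) - nsq (z - x)))"
proof -
  define f where "f z = (\<Sum>i\<in>I. ip (b i) z + 1/2 * h i * (wnorm d P (z - c i))\<^sup>2)" for z
  define s where "s = (\<Sum>i\<in>I. h i)"
  have f_eq: "f z = (\<Sum>i\<in>I. ip (b i) z + 1/2 * h i * nsq (z - c i))" if "z \<in> Rspace d" for z
    unfolding f_def using that I by (intro sum.cong) (auto simp: wnorm_sq Rspace_diff)
  have "continuous_on Z (\<lambda>z. \<Sum>i\<in>I. ip (b i) z + 1/2 * h i * nsq (z - c i))"
    using I by (intro continuous_intros continuous_ip continuous_nsq_diff) auto
  then have "continuous_on Z f"
    using Z f_eq by (subst continuous_on_cong[OF refl]) auto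
  then have "\<exists>y\<in>Z. \<forall>z\<in>Z. f y \<le> f z"
    using continuous_attains_inf[of Z f] Z by auto
  then have "\<exists>y. is_arg_min f (\<lambda>x. x \<in> Z) y"
    by (auto simp: is_arg_min_linorder)
  then have "is_arg_min f (\<lambda>x. x \<in> Z) x"
    unfolding x arg_min_on_def arg_min_def f_def by (rule someI_ex)
  then have xZ: "x \<in> Z" and min: "\<And>z. z \<in> Z \<Longrightarrow> f x \<le> f z"
    by (auto simp: is_arg_min_linorder)
  show "x \<in> Z" by (rule xZ)
  fix z assume z: "z \<in> Z"
  have fx: "f x = (\<Sum>i\<in>I. ip (b i) x + 1/2 * h i * nsq (x - c i))"
    and fz: "f z = (\<Sum>i\<in>I. ip (b i) z + 1/2 * h i * nsq (z - c i))"
    using f_eq[of x] f_eq[of z] xZ z Z by auto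
  have "s / 2 * nsq (z - x) * (1 - \<theta>) \<le> f z - f x" if \<theta>: "0 < \<theta>" "\<theta> < 1" for \<theta>
  proof -
    let ?y = "(1 - \<theta>) *\<^sub>R x + \<theta> *\<^sub>R z"
    have y: "?y \<in> Z"
      using Z(2) xZ z \<theta> by (simp add: convexD)
    have "f ?y = (\<Sum>i\<in>I. ip (b i) ?y + 1/2 * h i * nsq (?y - c i))"
      using y Z by (intro f_eq) auto
    also have "\<dots> = (\<Sum>i\<in>I. (1 - \<theta>) * (ip (b i) x + 1/2 * h i * nsq (x - c i))
        + \<theta> * (ip (b i) z + 1/2 * h i * nsq (z - c i)) - h i * (\<theta> * (1 - \<theta>) * nsq (z - x) / 2))"
    proof (intro sum.cong refl)
      fix i
      have "?y - c i = (1 - \<theta>) *\<^sub>R (x - c i) + \<theta> *\<^sub>R (z - c i)"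
        by (simp add: algebra_simps)
      then have eq: "nsq (?y - c i) = (1 - \<theta>) * nsq (x - c i) + \<theta> * nsq (z - c i)
          - \<theta> * (1 - \<theta>) * nsq (z - x)"
        using nsq_convex_comb[of \<theta> "x - c i" "z - c i"] by (simp add: nsq_diff_commute[of z x])
      show "ip (b i) ?y + 1/2 * h i * nsq (?y - c i)
        = (1 - \<theta>) * (ip (b i) x + 1/2 * h i * nsq (x - c i))
        + \<theta> * (ip (b i) z + 1/2 * h i * nsq (z - c i)) - h i * (\<theta> * (1 - \<theta>) * nsq (z - x) / 2)"
        unfolding eq ip_linear by (simp add: field_simps)
    qed
    also have "\<dots> = (1 - \<theta>) * f x + \<theta> * f z - s * (\<theta> * (1 - \<theta>) * nsq (z - x) / 2)"
      unfolding fx fz s_def sum_distrib_left sum_distrib_right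
      by (simp add: sum.distrib sum_subtractf)
    finally have "\<theta> * (s / 2 * nsq (z - x) * (1 - \<theta>)) \<le> \<theta> * (f z - f x)"
      using min[OF y] by (simp add: algebra_simps)
    then show ?thesis
      using \<theta>(1) mult_le_cancel_left_pos by blast
  qed
  then have "s / 2 * nsq (z - x) * (1 - \<theta>) \<le> f z - f x" if "\<theta> \<in> {0<..<1}" for \<theta>
    using that by auto
  moreover have "((\<lambda>\<theta>. s / 2 * nsq (z - x) * (1 - \<theta>)) \<longlongrightarrow> s / 2 * nsq (z - x) * (1 - 0)) (at_right 0)"
    by (intro tendsto_intros)
  moreover have "eventually (\<lambda>\<theta>::real. \<theta> \<in> {0<..<1}) (at_right 0)"
    by (rule eventually_at_right_real) simp
  ultimately have "s / 2 * nsq (z - x) * (1 - 0) \<le> f z - f x"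
    by (intro tendsto_upperbound[where F = "at_right (0::real)"]) (auto elim: eventually_mono)
  then have "s / 2 * nsq (z - x) + f x - f z \<le> 0"
    by simp
  moreover have "s / 2 * nsq (z - x) + f x - f z
      = (\<Sum>i\<in>I. h i * nsq (z - x) / 2 + (ip (b i) x + 1/2 * h i * nsq (x - c i))
          - (ip (b i) z + 1/2 * h i * nsq (z - c i)))"
    using xZ z Z
    by (simp add: f_eq subset_iff s_def sum_distrib_right sum_divide_distrib sum.distrib sum_subtractf)
  moreover have "\<dots> = (\<Sum>i\<in>I. ip (b i) (x - z)
      - 1/2 * h i * (nsq (z - c i) - nsq (x - c i) - nsq (z - x)))"
    by (intro sum.cong refl) (simp add: ip_linear algebra_simps)
  ultimately show "(\<Sum>i\<in>I. ip (b i) (x - z))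
      \<le> (\<Sum>i\<in>I. 1/2 * h i * (nsq (z - c i) - nsq (x - c i) - nsq (z - x)))"
    by (simp add: sum_subtractf)
qed

end

section \<open>The averaging weights\<close>

lemma alpha_pos: "alpha t > 0"
proof (induction t)
  case (Suc t)
  have "1 + sqrt (1 + 4 / (alpha t)\<^sup>2) > 0"
    by (smt (verit) divide_nonneg_nonneg real_sqrt_ge_zero zero_le_power2)
  then show ?case by simp
qed simp

text \<open>
  The recursion for \<open>\<alpha>\<close> says that \<open>x = 1 / \<alpha>\<^bsub>t+1\<^esub>\<close> is the positive root of \<open>x\<^sup>2 - x = 1 / \<alpha>\<^sub>t\<^sup>2\<close>.
\<close>

lemma alpha_inverse_step:
  shows "(1 / alpha (Suc t))\<^sup>2 - 1 / alpha (Suc t) = (1 / alpha t)\<^sup>2"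
    and "1 / alpha (Suc t) \<ge> 1 / alpha t + 1 / 2"
proof -
  define s where "s = sqrt (1 + 4 / (alpha t)\<^sup>2)"
  have s2: "s\<^sup>2 = 1 + 4 * (1 / alpha t)\<^sup>2"
    by (simp add: s_def power_divide)
  have inv: "1 / alpha (Suc t) = (1 + s) / 2"
    by (simp add: s_def)
  show "(1 / alpha (Suc t))\<^sup>2 - 1 / alpha (Suc t) = (1 / alpha t)\<^sup>2"
    unfolding inv using s2 by (simp add: power2_eq_square field_simps)
  have "2 / alpha t \<le> s"
    unfolding s_def by (rule real_le_rsqrt) (simp add: power_divide)
  then show "1 / alpha (Suc t) \<ge> 1 / alpha t + 1 / 2"
    unfolding inv by (simp add: field_simps)
qed

lemma alpha_recursion: "(1 - alpha (Suc t)) * (alpha t)\<^sup>2 = (alpha (Suc t))\<^sup>2"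
proof -
  have "(1 - alpha (Suc t)) / (alpha (Suc t))\<^sup>2 = (1 / alpha (Suc t))\<^sup>2 - 1 / alpha (Suc t)"
    using alpha_pos[of "Suc t"]
    by (simp add: diff_divide_distrib power_divide power2_eq_square del: alpha.simps)
  also have "\<dots> = (1 / alpha t)\<^sup>2"
    by (rule alpha_inverse_step(1))
  also have "\<dots> = 1 / (alpha t)\<^sup>2"
    by (simp add: power_divide)
  finally show ?thesis
    using alpha_pos[of t] alpha_pos[of "Suc t"] by (simp add: frac_eq_eq del: alpha.simps)
qed

lemma alpha_antimono: "s \<le> t \<Longrightarrow> alpha t \<le> alpha s"
proof (rule lift_Suc_antimono_le[of alpha])
  fix t
  have "1 / alpha t \<le> 1 / alpha (Suc t)"
    using alpha_inverse_step(2)[of t] by linarith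
  then show "alpha (Suc t) \<le> alpha t"
    using alpha_pos[of t] alpha_pos[of "Suc t"] by (simp add: field_simps del: alpha.simps)
qed

lemma alpha_le_1: "alpha t \<le> 1"
  using alpha_antimono[of 0 t] by simp

lemma alpha_le: "alpha t \<le> 2 / (real t + 2)"
proof -
  have "1 / alpha t \<ge> (real t + 2) / 2"
  proof (induction t)
    case (Suc t)
    then show ?case
      using alpha_inverse_step(2)[of t] by (simp add: field_simps del: alpha.simps)
  qed simp
  then show ?thesis
    using alpha_pos[of t] by (simp add: field_simps)
qed

lemma prod_alpha_le:
  assumes "\<And>l. l \<in> {1..i} \<Longrightarrow> T l > 0"
  shows "(\<Prod>l=1..i. alpha (T l - 1)) \<le> 2 ^ i / real (N_par T i)"
proof -
  have "(\<Prod>l=1..i. alpha (T l - 1)) \<le> (\<Prod>l=1..i. 2 / real (T l))"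
  proof (intro prod_mono conjI)
    fix l assume "l \<in> {1..i}"
    then have "T l > 0" by (rule assms)
    have "alpha (T l - 1) \<le> 2 / (real (T l - 1) + 2)"
      by (rule alpha_le)
    also have "\<dots> \<le> 2 / real (T l)"
      using \<open>T l > 0\<close> by (intro divide_left_mono) auto
    finally show "alpha (T l - 1) \<le> 2 / real (T l)" .
  qed (simp add: alpha_pos less_imp_le)
  also have "\<dots> = 2 ^ i / real (N_par T i)"
    by (simp add: prod_dividef N_par_def)
  finally show ?thesis .
qed

text \<open>
  Dividing the recursion by \<open>\<alpha>\<^sub>j\<^sup>2\<close> makes it telescope, since \<open>(1 - \<alpha>\<^sub>j) / \<alpha>\<^sub>j\<^sup>2 = 1 / \<alpha>\<^bsub>j-1\<^esub>\<^sup>2\<close>; the initial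
  value has weight \<open>1 - \<alpha>\<^sub>0 = 0\<close>.
\<close>

lemma alpha_weighted_recursion:
  assumes "\<And>j. j \<le> m \<Longrightarrow> V (Suc j) \<le> (1 - alpha j) * V j + alpha j * B j"
  shows "V (Suc m) \<le> (alpha m)\<^sup>2 * (\<Sum>j\<le>m. B j / alpha j)"
  using assms
proof (induction m)
  case 0
  then show ?case
    using "0.prems"[of 0] by simp
next
  case (Suc m)
  let ?a = "alpha (Suc m)"
  have "V (Suc (Suc m)) \<le> (1 - ?a) * V (Suc m) + ?a * B (Suc m)"
    by (rule Suc.prems) simp
  also have "(1 - ?a) * V (Suc m) \<le> (1 - ?a) * ((alpha m)\<^sup>2 * (\<Sum>j\<le>m. B j / alpha j))"
    using Suc.prems alpha_le_1[of "Suc m"] by (intro mult_left_mono Suc.IH) auto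
  also have "\<dots> = ?a\<^sup>2 * (\<Sum>j\<le>m. B j / alpha j)"
    by (simp only: mult.assoc[symmetric] alpha_recursion)
  also have "?a * B (Suc m) = ?a\<^sup>2 * (B (Suc m) / ?a)"
    using alpha_pos[of "Suc m"] by (simp add: power2_eq_square del: alpha.simps)
  finally show ?case
    by (simp add: distrib_left del: alpha.simps)
qed


section \<open>Smoothing under the Hoelder condition\<close>

text \<open>
  The right-hand side is the integral of \<open>(1 + \<nu>) y\<^sup>\<nu>\<close> over an interval of length 1 that starts at \<open>x\<close>. Summed over
  the points of an equidistant partition, this compares a Riemann sum of \<open>y\<^sup>\<nu>\<close> with the integral.
\<close>

lemma powr_le_increment:
  fixes \<nu> :: real
  assumes "x > 0" "\<nu> \<ge> 0"
  shows "(1 + \<nu>) * x powr \<nu> \<le> (x + 1) powr (1 + \<nu>) - x powr (1 + \<nu>)"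
proof -
  have "\<exists>z>x. z < x + 1 \<and> (x + 1) powr (1 + \<nu>) - x powr (1 + \<nu>) = (x + 1 - x) * ((1 + \<nu>) * z powr \<nu>)"
    using assms by (intro MVT2) (auto intro!: derivative_eq_intros)
  then obtain z where z: "z > x" "(x + 1) powr (1 + \<nu>) - x powr (1 + \<nu>) = (1 + \<nu>) * z powr \<nu>"
    by auto
  then show ?thesis
    using assms by (simp add: powr_mono2 mult_left_mono)
qed

lemma sum_powr_le:
  fixes \<nu> :: real
  assumes "\<nu> \<ge> 0"
  shows "(\<Sum>i<m. (real (Suc i)) powr \<nu>) \<le> (real (Suc m)) powr (1 + \<nu>) / (1 + \<nu>)"
proof -
  have "(1 + \<nu>) * (\<Sum>i<m. (real (Suc i)) powr \<nu>) \<le> (real (Suc m)) powr (1 + \<nu>) - 1"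
  proof (induction m)
    case (Suc m)
    have "(1 + \<nu>) * (real (Suc m)) powr \<nu>
        \<le> (real (Suc (Suc m))) powr (1 + \<nu>) - (real (Suc m)) powr (1 + \<nu>)"
      using powr_le_increment[of "real (Suc m)" \<nu>] assms by (simp add: add.commute)
    with Suc show ?case
      by (simp add: distrib_left)
  qed simp
  then show ?thesis
    using assms by (simp add: field_simps)
qed

context weighted_space
begin

text \<open>
  The increment of \<open>h\<close> along a segment is the integral of its directional derivative, of which the
  subgradients at the points of an equidistant partition give an upper Riemann sum.
\<close>

lemma holder_upper_bound:
  assumes Z: "Z \<subseteq> Rspace d" "convex Z" "Z \<subseteq> D"
    and sub: "\<And>u. u \<in> Z \<Longrightarrow> subdifferential d D h u \<noteq> {}"
    and holder: "holder_cond d P Z D \<nu> H h"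
    and \<nu>: "\<nu> \<ge> 0" and H: "H \<ge> 0"
    and u: "u \<in> Z" and v: "v \<in> Z" and g: "g \<in> subdifferential d D h u"
  shows "h v \<le> h u + ip g (v - u) + H / (1 + \<nu>) * wnorm d P (v - u) powr (1 + \<nu>)"
proof (cases "v = u")
  case True
  then show ?thesis
    using \<nu> H by simp
next
  case False
  define t where "t = wnorm d P (v - u)"
  have vu: "v - u \<in> Rspace d" "v - u \<noteq> 0"
    using Z u v False by (auto intro: Rspace_diff)
  then have t: "t > 0"
    using nsq_pos by (simp add: t_def wnorm_eq)
  have bound: "h v - h u - ip g (v - u)
      \<le> H * t powr (1 + \<nu>) / (1 + \<nu>) * (1 + 1 / real m) powr (1 + \<nu>)" if m: "m > 0" for m
  proof -
    define y where "y i = u + (real i / real m) *\<^sub>R (v - u)" for i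
    have y: "y i \<in> Z" if "i \<le> m" for i
    proof -
      have "y i = (1 - real i / real m) *\<^sub>R u + (real i / real m) *\<^sub>R v"
        by (simp add: y_def algebra_simps)
      then show ?thesis
        using that m u v Z(2) by (simp add: convexD)
    qed
    have step: "h (y (Suc i)) - h (y i)
        \<le> (ip g (v - u) + H * (real (Suc i) / real m) powr \<nu> * t powr (1 + \<nu>)) / real m"
      if i: "i < m" for i
    proof -
      have yS: "y (Suc i) \<in> Z"
        using y i by simp
      obtain g' where g': "g' \<in> subdifferential d D h (y (Suc i))"
        using sub[OF yS] by blast
      have yu: "y (Suc i) - u = (real (Suc i) / real m) *\<^sub>R (v - u)"
        by (simp add: y_def)
      have "wnorm d P (y (Suc i) - u) = real (Suc i) / real m * t"
        unfolding yu t_def wnorm_eq nsq_scaleR by (simp add: real_sqrt_mult)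
      moreover have "wnorm d (mat_inv d P) (g' - g)
          \<le> (if \<nu> = 0 then H else H * wnorm d P (y (Suc i) - u) powr \<nu>)"
        using holder g g' yS u unfolding holder_cond_def by blast
      ultimately have dual: "wnorm d (mat_inv d P) (g' - g) \<le> H * (real (Suc i) / real m * t) powr \<nu>"
        using t m by (auto split: if_splits)
      have "g' - g \<in> Rspace d"
        using g g' by (auto simp: subdifferential_def intro: Rspace_diff)
      then have "ip (g' - g) (v - u) \<le> wnorm d (mat_inv d P) (g' - g) * t"
        unfolding t_def using vu by (intro ip_le_dual)
      also have "\<dots> \<le> H * (real (Suc i) / real m * t) powr \<nu> * t"
        using dual t by (intro mult_right_mono) auto
      also have "\<dots> = H * (real (Suc i) / real m) powr \<nu> * t powr (1 + \<nu>)"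
        using t m powr_mult[of "real (Suc i) / real m" t \<nu>] by (simp add: powr_add)
      finally have gg: "ip g' (v - u) \<le> ip g (v - u) + H * (real (Suc i) / real m) powr \<nu> * t powr (1 + \<nu>)"
        by (simp add: ip_linear)
      have "h (y i) \<ge> h (y (Suc i)) + ip g' (y i - y (Suc i))"
        using g' y[of i] i Z(3) by (auto simp: subdifferential_def)
      moreover have "y i - y (Suc i) = (- 1 / real m) *\<^sub>R (v - u)"
        unfolding y_def by (simp add: add_divide_distrib scaleR_add_left algebra_simps)
      then have "ip g' (y i - y (Suc i)) = - 1 / real m * ip g' (v - u)"
        by (simp only: ip_scaleR_right)
      ultimately have "h (y (Suc i)) - h (y i) \<le> ip g' (v - u) / real m"
        by simp
      also have "\<dots> \<le> (ip g (v - u) + H * (real (Suc i) / real m) powr \<nu> * t powr (1 + \<nu>)) / real m"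
        using gg m by (intro divide_right_mono) auto
      finally show ?thesis .
    qed
    have "h v - h u = (\<Sum>i<m. h (y (Suc i)) - h (y i))"
      using m sum_lessThan_telescope[of "\<lambda>i. h (y i)" m] by (simp add: y_def)
    also have "\<dots> \<le> (\<Sum>i<m. (ip g (v - u) + H * (real (Suc i) / real m) powr \<nu> * t powr (1 + \<nu>)) / real m)"
      by (intro sum_mono step) auto
    also have "\<dots> = (\<Sum>i<m. ip g (v - u) / real m
        + (H * t powr (1 + \<nu>) / (real m powr \<nu> * real m)) * real (Suc i) powr \<nu>)"
      using m by (intro sum.cong refl) (simp add: powr_divide field_simps)
    also have "\<dots> = ip g (v - u)
        + H * t powr (1 + \<nu>) / (real m powr \<nu> * real m) * (\<Sum>i<m. real (Suc i) powr \<nu>)"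
      using m by (simp add: sum.distrib sum_distrib_left)
    also have "\<dots> \<le> ip g (v - u)
        + H * t powr (1 + \<nu>) / (real m powr \<nu> * real m) * (real (Suc m) powr (1 + \<nu>) / (1 + \<nu>))"
      using H by (intro add_left_mono mult_left_mono sum_powr_le \<nu>) auto
    also have "\<dots> = ip g (v - u)
        + H * t powr (1 + \<nu>) / (1 + \<nu>) * (real (Suc m) / real m) powr (1 + \<nu>)"
      using m by (simp add: powr_divide powr_add[of "real m"] mult.commute)
    also have "real (Suc m) / real m = 1 + 1 / real m"
      using m by (simp add: field_simps)
    finally show ?thesis by simp
  qed
  have "(\<lambda>m. H * t powr (1 + \<nu>) / (1 + \<nu>) * (1 + 1 / real m) powr (1 + \<nu>))
      \<longlonglongrightarrow> H * t powr (1 + \<nu>) / (1 + \<nu>) * (1 + 0) powr (1 + \<nu>)"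
    by (intro tendsto_intros lim_1_over_n) auto
  then have "h v - h u - ip g (v - u) \<le> H * t powr (1 + \<nu>) / (1 + \<nu>) * (1 + 0) powr (1 + \<nu>)"
    by (rule LIMSEQ_le_const) (use bound in \<open>auto intro!: exI[of _ 1]\<close>)
  then show ?thesis
    by (simp add: t_def)
qed

end

lemma K_par_nonneg: "K_par \<nu> H \<ge> 0"
  by (simp add: K_par_def)

lemma delta_par_nonneg: "delta_par T \<Omega> k \<nu> H \<ge> 0"
  by (simp add: delta_par_def)

lemma L_par_nonneg: "H \<ge> 0 \<Longrightarrow> L_par T \<Omega> k \<nu> H \<ge> 0"
  by (simp add: L_par_def K_par_nonneg)

text \<open>
  For positive accuracy this is Young's inequality with the conjugate weights \<open>(1 + \<nu>) / 2\<close> and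
  \<open>(1 - \<nu>) / 2\<close>; the constant \<open>K_par\<close> is the one for which it is tight. For \<open>\<nu> < 1\<close>, a vanishing accuracy means that
  either \<open>H\<close> or the diameter vanishes.
\<close>

lemma holder_remainder_le_quadratic:
  assumes \<nu>: "0 \<le> \<nu>" "\<nu> \<le> 1" and H: "H \<ge> 0" and \<Omega>: "\<Omega> \<ge> 0" and N: "N_par T k > 0"
    and t: "t \<ge> 0" "\<Omega> = 0 \<Longrightarrow> t = 0"
  shows "H / (1 + \<nu>) * t powr (1 + \<nu>) \<le> L_par T \<Omega> k \<nu> H / 2 * t\<^sup>2 + delta_par T \<Omega> k \<nu> H"
proof (cases "t = 0 \<or> H = 0")
  case True
  then show ?thesis
    using \<nu> H delta_par_nonneg[of T \<Omega> k \<nu> H] L_par_nonneg[OF H, of T \<Omega> k \<nu>] by auto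
next
  case False
  then have pos: "t > 0" "H > 0" "\<Omega> > 0"
    using t H \<Omega> by (auto simp: less_le)
  show ?thesis
  proof (cases "\<nu> = 1")
    case True
    then show ?thesis
      using pos delta_par_nonneg[of T \<Omega> k 1 H] by (simp add: L_par_def)
  next
    case False
    with \<nu> have \<nu>1: "\<nu> < 1" by simp
    define \<theta> where "\<theta> = (1 + \<nu>) / 2"
    define \<rho> where "\<rho> = (1 - \<nu>) / (1 + \<nu>)"
    define \<delta> where "\<delta> = delta_par T \<Omega> k \<nu> H"
    have \<rho>: "\<rho> > 0" and \<theta>: "\<theta> > 0" "\<theta> < 1"
      using \<nu> \<nu>1 by (auto simp: \<rho>_def \<theta>_def)
    have "2 * \<theta> = 1 + \<nu>"
      by (simp add: \<theta>_def)
    have \<rho>\<theta>: "\<rho> * \<theta> = 1 - \<theta>"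
      using \<nu> by (simp add: \<rho>_def \<theta>_def field_simps)
    have K: "K_par \<nu> H = (\<rho> / 2) powr \<rho> * H powr (1 / \<theta>)"
      by (simp add: K_par_def \<rho>_def \<theta>_def mult.commute)
    have "K_par \<nu> H > 0"
      using pos \<rho> by (simp add: K)
    then have \<delta>: "\<delta> > 0"
      using pos \<nu> \<nu>1 N by (simp add: \<delta>_def delta_par_def)
    have L: "L_par T \<Omega> k \<nu> H = K_par \<nu> H * \<delta> powr (- \<rho>)"
      using False \<delta> by (simp add: L_par_def \<delta>_def \<rho>_def)
    \<comment> \<open>With these numbers, \<open>\<theta> * a\<close> is the quadratic term and \<open>(1 - \<theta>) * b\<close> is the accuracy.\<close>
    define a where "a = L_par T \<Omega> k \<nu> H / 2 * t\<^sup>2 / \<theta>"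
    define b where "b = \<delta> / (1 - \<theta>)"
    have ab: "a > 0" "b > 0"
      using pos \<theta> \<delta> \<open>K_par \<nu> H > 0\<close> by (simp_all add: a_def b_def L)
    have "a powr \<theta> = (((\<rho> / 2) powr \<rho> * H powr (1 / \<theta>) * \<delta> powr (- \<rho>)) * (t\<^sup>2 / (2 * \<theta>))) powr \<theta>"
      by (simp add: a_def L K)
    also have "\<dots> = (\<rho> / 2) powr (\<rho> * \<theta>) * H * \<delta> powr (- (\<rho> * \<theta>)) * ((t\<^sup>2) powr \<theta> / (2 * \<theta>) powr \<theta>)"
      using \<rho> pos \<theta> by (simp add: powr_mult powr_divide powr_powr)
    also have "(t\<^sup>2) powr \<theta> = t powr (1 + \<nu>)"
      using pos \<open>2 * \<theta> = 1 + \<nu>\<close> by (simp add: powr_powr flip: powr_numeral)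
    also have "\<rho> / 2 = (1 - \<theta>) / (2 * \<theta>)"
      using \<nu> by (simp add: \<rho>_def \<theta>_def field_simps)
    finally have "a powr \<theta> * b powr (1 - \<theta>)
        = ((1 - \<theta>) / (2 * \<theta>)) powr (1 - \<theta>) * H * \<delta> powr (- (1 - \<theta>)) * (t powr (1 + \<nu>) / (2 * \<theta>) powr \<theta>)
          * (\<delta> / (1 - \<theta>)) powr (1 - \<theta>)"
      by (simp add: \<rho>\<theta> b_def)
    also have "\<dots> = (\<delta> powr (1 - \<theta>) * \<delta> powr (- (1 - \<theta>))) * (H * t powr (1 + \<nu>))
        / ((2 * \<theta>) powr \<theta> * (2 * \<theta>) powr (1 - \<theta>))"
      using \<theta> \<delta> by (simp add: powr_divide mult_ac)
    also have "\<delta> powr (1 - \<theta>) * \<delta> powr (- (1 - \<theta>)) = 1"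
      using \<delta> by (simp flip: powr_add)
    also have "1 * (H * t powr (1 + \<nu>)) / ((2 * \<theta>) powr \<theta> * (2 * \<theta>) powr (1 - \<theta>))
        = H / (1 + \<nu>) * t powr (1 + \<nu>)"
      using \<theta> by (simp add: powr_add[symmetric]) (simp add: \<theta>_def)
    finally have "H / (1 + \<nu>) * t powr (1 + \<nu>) \<le> \<theta> * a + (1 - \<theta>) * b"
      using Youngs_inequality_0[of \<theta> "1 - \<theta>" a b] \<theta> ab by simp
    also have "\<dots> = L_par T \<Omega> k \<nu> H / 2 * t\<^sup>2 + \<delta>"
      using \<theta> by (simp add: a_def b_def)
    finally show ?thesis
      by (simp add: \<delta>_def)
  qed
qed

text \<open>
  For \<open>\<nu> < 1\<close> the accuracy \<open>delta_par\<close> balances the two error terms: with \<open>\<rho> = (1 - \<nu>) / (1 + \<nu>)\<close> the first one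
  equals the second one divided by \<open>\<rho>\<close>. Their sum is of the order of \<open>H \<Omega>\<^bsup>(1+\<nu>)/2\<^esup> N\<^bsup>-(1+3\<nu>)/2\<^esup>\<close>.
\<close>

lemma smoothing_error_le:
  assumes \<nu>: "0 \<le> \<nu>" "\<nu> \<le> 1" and H: "H \<ge> 0" and \<Omega>: "\<Omega> \<ge> 0" and N: "N = N_par T k" "N > 0"
    and k: "k \<ge> 1"
  shows "1/2 * \<Omega> * L_par T \<Omega> k \<nu> H * 4 ^ k / (real N)\<^sup>2 + delta_par T \<Omega> k \<nu> H * real N
      \<le> 4 ^ k * (H * \<Omega> powr ((1 + \<nu>) / 2)) / real N powr ((1 + 3 * \<nu>) / 2)"
proof (cases "\<nu> = 1")
  case True
  have "1/2 * \<Omega> * H * 4 ^ k / (real N)\<^sup>2 \<le> 4 ^ k * (H * \<Omega>) / (real N)\<^sup>2"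
  proof -
    define y where "y = 4 ^ k * (H * \<Omega>) / (real N)\<^sup>2"
    have "0 \<le> y"
      using \<Omega> H by (simp add: y_def)
    moreover have "1/2 * \<Omega> * H * 4 ^ k / (real N)\<^sup>2 = y / 2"
      by (simp add: y_def mult_ac)
    moreover have "y / 2 \<le> y"
      using \<open>0 \<le> y\<close> by simp
    ultimately show ?thesis
      unfolding y_def[symmetric] by (simp only:)
  qed
  then show ?thesis
    using N \<Omega> by (simp add: True L_par_def delta_par_def powr_numeral)
next
  case False
  with \<nu> have \<nu>1: "\<nu> < 1" by simp
  show ?thesis
  proof (cases "H = 0 \<or> \<Omega> = 0")
    case True
    then have "delta_par T \<Omega> k \<nu> H = 0"
      by (auto simp: delta_par_def K_par_def)
    then show ?thesis
      using \<open>\<nu> \<noteq> 1\<close> H by (simp add: L_par_def)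
  next
    case False
    then have pos: "H > 0" "\<Omega> > 0"
      using H \<Omega> by auto
    define \<theta> where "\<theta> = (1 + \<nu>) / 2"
    define \<rho> where "\<rho> = (1 - \<nu>) / (1 + \<nu>)"
    define \<delta> where "\<delta> = delta_par T \<Omega> k \<nu> H"
    define K where "K = K_par \<nu> H"
    define c :: real where "c = 2 ^ (2 * k - 1)"
    define X where "X = \<rho> * c * K * \<Omega> / real N ^ 3"
    have c4: "4 ^ k = 2 * c"
    proof -
      have "(4::real) ^ k = 2 ^ (2 * k)"
        by (simp add: power_mult)
      also have "2 * k = Suc (2 * k - 1)"
        using k by simp
      finally show ?thesis
        by (simp add: c_def)
    qed
    have \<rho>: "\<rho> > 0" and \<theta>: "\<theta> > 0" "\<theta> < 1" "\<theta> \<ge> 1/2" and c1: "c \<ge> 1"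
      using \<nu> \<nu>1 by (auto simp: \<rho>_def \<theta>_def c_def)
    have \<theta>\<rho>: "\<theta> * (1 + \<rho>) = 1"
      using \<nu> by (simp add: \<rho>_def \<theta>_def field_simps)
    then have inv\<theta>: "1 / \<theta> = 1 + \<rho>"
      using \<theta> by (simp add: field_simps)
    have K_eq: "K = (\<rho> / 2) powr \<rho> * H powr (1 / \<theta>)"
      by (simp add: K_def K_par_def \<rho>_def \<theta>_def mult.commute)
    have K: "K > 0"
      using pos \<rho> by (simp add: K_eq)
    have X: "X > 0"
      using \<rho> c1 K pos N by (simp add: X_def)
    have \<delta>_eq: "\<delta> = X powr \<theta>"
      by (simp add: \<delta>_def delta_par_def X_def \<rho>_def \<theta>_def c_def K_def N(1))
    then have \<delta>: "\<delta> > 0"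
      using X by simp
    have "\<delta> * \<delta> powr \<rho> = X"
      using X \<theta>\<rho> by (simp add: \<delta>_eq powr_powr distrib_left flip: powr_add)
    then have "\<delta> powr (- \<rho>) = \<delta> / X"
      using X \<delta> by (simp add: powr_minus field_simps)
    then have L: "L_par T \<Omega> k \<nu> H = K * \<delta> / X"
      using \<open>\<nu> \<noteq> 1\<close> \<delta> by (simp add: L_par_def \<delta>_def \<rho>_def K_def)
    have XN: "X * real N ^ 3 = \<rho> * c * K * \<Omega>"
      using N by (simp add: X_def)
    have "1/2 * \<Omega> * L_par T \<Omega> k \<nu> H * 4 ^ k / (real N)\<^sup>2 = (\<rho> * c * K * \<Omega>) * (\<delta> / (\<rho> * X * (real N)\<^sup>2))"
      using \<rho> by (simp add: L c4)
    also have "\<dots> = \<delta> * real N / \<rho>"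
      unfolding XN[symmetric] using X N \<rho> by (simp add: field_simps power2_eq_square power3_eq_cube)
    finally have sum_eq: "1/2 * \<Omega> * L_par T \<Omega> k \<nu> H * 4 ^ k / (real N)\<^sup>2 + \<delta> * real N
        = \<delta> * (real N * (1 + \<rho>) / \<rho>)"
      using \<rho> by (simp add: field_simps)
    have \<delta>_le: "\<delta> \<le> \<rho> * c * (H * \<Omega> powr \<theta>) / real N powr (3 * \<theta>)"
    proof -
      have "\<rho> * (\<rho> / 2) powr \<rho> \<le> \<rho> * \<rho> powr \<rho>"
        using \<rho> by (intro mult_left_mono powr_mono2) auto
      also have "\<dots> = \<rho> powr (1 / \<theta>)"
        using \<rho> by (simp add: inv\<theta> powr_add)
      finally have "X \<le> \<rho> powr (1 / \<theta>) * (c * H powr (1 / \<theta>) * \<Omega> / real N ^ 3)"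
        using mult_right_mono[of "\<rho> * (\<rho> / 2) powr \<rho>" "\<rho> powr (1 / \<theta>)" "c * H powr (1 / \<theta>) * \<Omega> / real N ^ 3"]
          c1 pos N by (simp add: X_def K_eq mult_ac)
      then have "\<delta> \<le> (\<rho> powr (1 / \<theta>) * (c * H powr (1 / \<theta>) * \<Omega> / real N ^ 3)) powr \<theta>"
        unfolding \<delta>_eq using X \<theta> by (intro powr_mono2) auto
      also have "\<dots> = \<rho> * (c powr \<theta> * H * \<Omega> powr \<theta> / real N powr (3 * \<theta>))"
        using \<rho> \<theta> c1 pos N by (simp add: powr_mult powr_divide powr_powr flip: powr_numeral)
      also have "\<dots> \<le> \<rho> * (c * H * \<Omega> powr \<theta> / real N powr (3 * \<theta>))"
        using powr_mono[of \<theta> 1 c] c1 \<theta> \<rho> pos N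
        by (intro mult_left_mono divide_right_mono mult_right_mono) auto
      finally show ?thesis
        by (simp add: mult_ac)
    qed
    have "3 * \<theta> = 1 + (1 + 3 * \<nu>) / 2"
      by (simp add: \<theta>_def field_simps)
    then have N_powr: "real N powr (3 * \<theta>) = real N * real N powr ((1 + 3 * \<nu>) / 2)"
      using N by (simp add: powr_add)
    have "\<delta> * (real N * (1 + \<rho>) / \<rho>)
        \<le> \<rho> * c * (H * \<Omega> powr \<theta>) / (real N * real N powr ((1 + 3 * \<nu>) / 2)) * (real N * (1 + \<rho>) / \<rho>)"
      using \<rho> by (intro mult_right_mono \<delta>_le[unfolded N_powr]) auto
    also have "\<dots> = (1 + \<rho>) * (c * (H * \<Omega> powr \<theta>) / real N powr ((1 + 3 * \<nu>) / 2))"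
      using \<rho> N by simp
    also have "\<dots> \<le> 2 * (c * (H * \<Omega> powr \<theta>) / real N powr ((1 + 3 * \<nu>) / 2))"
    proof (rule mult_right_mono)
      show "1 + \<rho> \<le> 2"
        using \<theta> \<theta>\<rho> \<nu> by (simp add: \<rho>_def)
    qed (use c1 pos in auto)
    finally have "1/2 * \<Omega> * L_par T \<Omega> k \<nu> H * 4 ^ k / (real N)\<^sup>2 + \<delta> * real N
        \<le> 2 * (c * (H * \<Omega> powr \<theta>) / real N powr ((1 + 3 * \<nu>) / 2))"
      unfolding sum_eq .
    then show ?thesis
      by (simp add: c4 \<delta>_def \<theta>_def)
  qed
qed

text \<open>
  The smoothing error decreases like \<open>N\<^bsup>-(1+3\<nu>)/2\<^esup>\<close>, so a factor \<open>A\<close> in \<open>N\<close> may gain only \<open>\<surd>A\<close> (for \<open>\<nu> = 0\<close>).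
  Hence \<open>A\<close> has to be of the order of the square of \<open>4\<^sup>k\<close>; each of the two errors is then at most \<open>\<epsilon> / 2\<close>.
\<close>

lemma component_error_le:
  assumes \<nu>: "0 \<le> \<nu>" "\<nu> \<le> 1" and H: "H \<ge> 0" and M: "M \<ge> 0" and \<Omega>: "\<Omega> \<ge> 0" and \<epsilon>: "\<epsilon> > 0"
    and k: "k \<ge> 1" and A: "A \<ge> 4 * 16 ^ k"
    and N: "N = N_par T k" "real N \<ge> A * R_par \<Omega> \<epsilon> M \<nu> H"
  shows "1/2 * \<Omega> * (L_par T \<Omega> k \<nu> H * 4 ^ k / (real N)\<^sup>2 + M * 2 ^ k / real N)
      + delta_par T \<Omega> k \<nu> H * real N \<le> \<epsilon>"
proof -
  define R where "R = R_par \<Omega> \<epsilon> M \<nu> H"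
  define a where "a = H * \<Omega> powr ((1 + \<nu>) / 2) / \<epsilon>"
  have R: "a powr (2 / (1 + 3 * \<nu>)) \<le> R" "M * \<Omega> / \<epsilon> \<le> R" "1 \<le> R"
    by (simp_all add: R_def R_par_def a_def)
  have a: "a \<ge> 0"
    using H \<epsilon> by (simp add: a_def)
  have A1: "A \<ge> 1" "A > 0"
    using A one_le_power[of "16::real" k] by linarith+
  have AR: "A * R \<le> real N" "A * R \<ge> 1"
    using N(2) mult_mono[of 1 A 1 R] A1 R by (auto simp: R_def)
  then have N0: "N > 0"
    by (cases N) auto
  have "a = (a powr (2 / (1 + 3 * \<nu>))) powr ((1 + 3 * \<nu>) / 2)"
    using \<nu> a by (simp add: powr_powr)
  also have "\<dots> \<le> R powr ((1 + 3 * \<nu>) / 2)"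
    using R \<nu> by (intro powr_mono2) auto
  finally have aR: "a \<le> R powr ((1 + 3 * \<nu>) / 2)" .
  have "2 * 4 ^ k = sqrt (4 * 16 ^ k)"
  proof -
    have eq: "(4 * 16 ^ k :: real) = (2 * 4 ^ k)\<^sup>2"
      by (simp add: power_mult_distrib power2_eq_square flip: power_mult_distrib)
    show ?thesis
      unfolding eq real_sqrt_abs by simp
  qed
  also have "\<dots> \<le> sqrt A"
    using A by simp
  also have "\<dots> = A powr (1/2)"
    using A1 by (simp add: powr_half_sqrt)
  also have "\<dots> \<le> A powr ((1 + 3 * \<nu>) / 2)"
    using A1 \<nu> by (intro powr_mono) auto
  finally have "2 * 4 ^ k * a \<le> A powr ((1 + 3 * \<nu>) / 2) * R powr ((1 + 3 * \<nu>) / 2)"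
    using aR a by (intro mult_mono) auto
  also have "\<dots> = (A * R) powr ((1 + 3 * \<nu>) / 2)"
    using A1 R by (simp add: powr_mult)
  also have "\<dots> \<le> real N powr ((1 + 3 * \<nu>) / 2)"
    using AR \<nu> by (intro powr_mono2) auto
  finally have "2 * 4 ^ k * (H * \<Omega> powr ((1 + \<nu>) / 2)) \<le> real N powr ((1 + 3 * \<nu>) / 2) * \<epsilon>"
    using \<epsilon> by (simp add: a_def field_simps)
  then have half: "4 ^ k * (H * \<Omega> powr ((1 + \<nu>) / 2)) / real N powr ((1 + 3 * \<nu>) / 2) \<le> \<epsilon> / 2"
    using N0 by (simp add: field_simps)
  have M_term: "1/2 * \<Omega> * (M * 2 ^ k / real N) \<le> \<epsilon> / 2"
  proof -
    have "(2::real) ^ k \<le> 16 ^ k"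
      by (intro power_mono) auto
    then have "2 ^ k \<le> A"
      using A zero_le_power[of "16::real" k] by linarith
    then have "2 ^ k * (M * \<Omega> / \<epsilon>) \<le> A * R"
      using R M \<Omega> \<epsilon> A1 by (intro mult_mono) auto
    also have "\<dots> \<le> real N" by (rule AR)
    finally show ?thesis
      using \<epsilon> N0 by (simp add: field_simps)
  qed
  have split: "1/2 * \<Omega> * (L_par T \<Omega> k \<nu> H * 4 ^ k / (real N)\<^sup>2 + M * 2 ^ k / real N)
        + delta_par T \<Omega> k \<nu> H * real N
      = (1/2 * \<Omega> * L_par T \<Omega> k \<nu> H * 4 ^ k / (real N)\<^sup>2 + delta_par T \<Omega> k \<nu> H * real N)
        + 1/2 * \<Omega> * (M * 2 ^ k / real N)"
    by (simp add: distrib_left mult.assoc)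
  show ?thesis
    unfolding split
    using add_mono[OF order_trans[OF smoothing_error_le[OF \<nu> H \<Omega> N(1) N0 k] half] M_term] by simp
qed

section \<open>One step of the accelerated extragradient scheme\<close>

context weighted_space
begin

text \<open>
  The quadratic terms combine to half of \<open>h\<close> times \<open>nsq (x - c) + nsq (z - x)\<close> up to a constant, which
  is convex in \<open>x\<close>.
\<close>

lemma prox_term_convex:
  fixes b c z :: vect and h :: real
  assumes "0 \<le> a" "a \<le> 1" "h \<ge> 0" "x \<in> Rspace d" "y \<in> Rspace d"
  defines "\<phi> \<equiv> \<lambda>x. ip b (x - z) - 1/2 * h * (nsq (z - c) - nsq (x - c) - nsq (z - x))"
  shows "\<phi> (a *\<^sub>R x + (1 - a) *\<^sub>R y) \<le> (1 - a) * \<phi> y + a * \<phi> x"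
proof -
  let ?w = "a *\<^sub>R x + (1 - a) *\<^sub>R y"
  have "?w - c = (1 - a) *\<^sub>R (y - c) + a *\<^sub>R (x - c)" "z - ?w = (1 - a) *\<^sub>R (z - y) + a *\<^sub>R (z - x)"
    by (simp_all add: algebra_simps)
  then have eq: "nsq (?w - c) = (1 - a) * nsq (y - c) + a * nsq (x - c) - a * (1 - a) * nsq (y - x)"
    "nsq (z - ?w) = (1 - a) * nsq (z - y) + a * nsq (z - x) - a * (1 - a) * nsq (y - x)"
    using nsq_convex_comb[of a "y - c" "x - c"] nsq_convex_comb[of a "z - y" "z - x"]
    by (simp_all add: nsq_diff_commute[of x y])
  have "(1 - a) * \<phi> y + a * \<phi> x - \<phi> ?w = h * (a * (1 - a) * nsq (y - x))"
    unfolding \<phi>_def eq ip_linear by (simp add: field_simps)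
  moreover have "h * (a * (1 - a) * nsq (y - x)) \<ge> 0"
    using assms by (intro mult_nonneg_nonneg nsq_nonneg Rspace_diff) auto
  ultimately show ?thesis by linarith
qed

text \<open>
  The point \<open>x\<close> is the predictor computed with the operator value at \<open>y\<close>, and \<open>y'\<close> is the corrector.
  The error \<open>M \<parallel>x - y\<parallel> \<parallel>x - y'\<parallel>\<close> of using the outdated value is split between the squared lengths of the
  two half steps.
\<close>

lemma extragradient_step:
  assumes Z: "Z \<subseteq> Rspace d" and F: "F ` Z \<subseteq> Rspace d" and mono: "monotone_op Z F"
    and lip: "lipschitz_op d P Z M F"
    and pts: "x \<in> Z" "y \<in> Z" "y' \<in> Z" "z \<in> Z" and M: "M \<ge> 0"
    and prox: "ip (F x - F y) (y' - z) \<le> 1/2 * h * (nsq (z - x) - nsq (y' - x) - nsq (z - y'))"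
  shows "ip (F z) (x - z) \<le> ip (F y) (x - z) + 1/2 * M * nsq (x - y)
    + 1/2 * (M - h) * nsq (y' - x) + 1/2 * h * (nsq (z - x) - nsq (z - y'))"
proof -
  have R: "x \<in> Rspace d" "y \<in> Rspace d" "y' \<in> Rspace d" "F x \<in> Rspace d" "F y \<in> Rspace d"
    using Z F pts by auto
  have "ip (F z) (x - z) \<le> ip (F x) (x - z)"
    using mono pts by (auto simp: monotone_op_def ip_linear) (smt (verit))
  moreover have "ip (F x) (x - z) = ip (F y) (x - z) + ip (F x - F y) (y' - z) + ip (F x - F y) (x - y')"
    by (simp add: ip_linear)
  moreover have "ip (F x - F y) (x - y') \<le> M * (1/2 * nsq (x - y) + 1/2 * nsq (x - y'))"
  proof -
    have "ip (F x - F y) (x - y') \<le> wnorm d (mat_inv d P) (F x - F y) * wnorm d P (x - y')"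
      using R by (intro ip_le_dual Rspace_diff)
    also have "\<dots> \<le> M * wnorm d P (x - y) * wnorm d P (x - y')"
      using lip pts R by (intro mult_right_mono wnorm_nonneg Rspace_diff) (auto simp: lipschitz_op_def)
    also have "\<dots> \<le> M * (1/2 * (wnorm d P (x - y))\<^sup>2 + 1/2 * (wnorm d P (x - y'))\<^sup>2)"
      using M sum_squares_bound[of "wnorm d P (x - y)" "wnorm d P (x - y')"]
      by (auto simp: mult.assoc intro!: mult_left_mono)
    finally show ?thesis
      using R by (simp add: wnorm_sq Rspace_diff)
  qed
  ultimately have "ip (F z) (x - z) \<le> ip (F y) (x - z)
      + 1/2 * h * (nsq (z - x) - nsq (y' - x) - nsq (z - y')) + M * (1/2 * nsq (x - y) + 1/2 * nsq (x - y'))"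
    using prox by linarith
  then show ?thesis
    by (simp add: nsq_diff_commute[of x y'] field_simps)
qed

end

text \<open>
  For a component of a deeper level, the step only needs convexity along the segment
  between the averaged points.
\<close>

lemma averaged_gap_le:
  fixes h :: "vect \<Rightarrow> real"
  assumes a: "0 < a" and c: "c > 0"
    and conv: "h y \<le> a * h u + (1 - a) * h v"
  shows "(h x - h u) / c + ip q ((a *\<^sub>R s + (1 - a) *\<^sub>R s') - z)
    \<le> (1 - a) * ((h v - h u) / c + ip q (s' - z)) + a * ((h x - h y) / (c * a) + ip q (s - z))"
proof -
  have "(h x - h u) / c \<le> (1 - a) * (h v - h u) / c + (h x - h y) / c"
    unfolding add_divide_distrib[symmetric] using conv c
    by (intro divide_right_mono) (auto simp: algebra_simps)
  also have "(h x - h y) / c = a * ((h x - h y) / (c * a))"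
    using a by simp
  finally show ?thesis
    by (simp add: ip_linear algebra_simps)
qed

section \<open>What a recursive call can change\<close>

context sliding
begin

lemma w_point_cong:
  assumes "it_z s' t = it_z s t" "\<And>i. i \<in> {1..length t} \<Longrightarrow> it_zbar s' (take i t) = it_zbar s (take i t)"
  shows "w_point s' t = w_point s t"
  unfolding w_point_def assms(1) by (rule foldr_cong) (auto simp: assms(2))

definition pending :: "(nat list \<Rightarrow> vect option) \<Rightarrow> nat list \<Rightarrow> nat" where
  "pending m u = (if m u = None then 1 else 0)"

lemma require_g_simps [simp]:
  "it_z (require_g u s) = it_z s" "it_zbar (require_g u s) = it_zbar s"
  "memo_q (require_g u s) = memo_q s" "cnt_q (require_g u s) = cnt_q s"
  by (auto simp: require_g_def split: option.split)

lemma require_q_simps [simp]: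
  "it_z (require_q u s) = it_z s" "it_zbar (require_q u s) = it_zbar s"
  "memo_g (require_q u s) = memo_g s" "cnt_g (require_q u s) = cnt_g s"
  by (auto simp: require_q_def split: option.split)

lemma memo_g_require_g:
  "memo_g (require_g u s) v =
     (if v = u \<and> memo_g s u = None then Some (G (length u) u (w_point s u)) else memo_g s v)"
  by (auto simp: require_g_def split: option.split)

lemma memo_q_require_q:
  "memo_q (require_q u s) v =
     (if v = u \<and> memo_q s u = None then Some (Q (length u) (it_z s u)) else memo_q s v)"
  by (auto simp: require_q_def split: option.split)

lemma cnt_g_require_g:
  "cnt_g (require_g u s) i = cnt_g s i + (if i = length u then pending (memo_g s) u else 0)"
  by (auto simp: require_g_def pending_def split: option.split)

lemma cnt_q_require_q:
  "cnt_q (require_q u s) i = cnt_q s i + (if i = length u then pending (memo_q s) u else 0)"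
  by (auto simp: require_q_def pending_def split: option.split)

text \<open>
  The part of a leaf call that changes the state, for the prefixes of length at most \<open>m\<close>.
\<close>

definition require_prefixes :: "nat list \<Rightarrow> nat \<Rightarrow> alg_state \<Rightarrow> alg_state" where
  "require_prefixes t m s = fold (\<lambda>i s. require_q (take i t) (require_g (take i t) s)) [1..<Suc m] s"

lemma require_prefixes_simps [simp]:
  "require_prefixes t 0 s = s"
  "require_prefixes t (Suc m) s
     = require_q (take (Suc m) t) (require_g (take (Suc m) t) (require_prefixes t m s))"
  by (simp_all add: require_prefixes_def)

lemma require_prefixes_iterates [simp]:
  "it_z (require_prefixes t m s) = it_z s" "it_zbar (require_prefixes t m s) = it_zbar s"
  by (induction m) simp_all

lemma w_point_require_prefixes [simp]: "w_point (require_prefixes t m s) u = w_point s u"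
  by (rule w_point_cong) simp_all

lemma memo_require_prefixes:
  "memo_g (require_prefixes t m s) u =
     (if memo_g s u = None \<and> u \<in> (\<lambda>i. take i t) ` {1..m} then Some (G (length u) u (w_point s u)) else memo_g s u)"
  "memo_q (require_prefixes t m s) u =
     (if memo_q s u = None \<and> u \<in> (\<lambda>i. take i t) ` {1..m} then Some (Q (length u) (it_z s u)) else memo_q s u)"
  by (induction m) (auto simp: memo_g_require_g memo_q_require_q atLeastAtMostSuc_conv)

text \<open>
  An evaluation at a multi-index is pending until its result is stored, so an oracle call moves one unit
  from \<open>pending\<close> to the counter.
\<close>

definition counts_bounded :: "nat list \<Rightarrow> (nat \<Rightarrow> nat) \<Rightarrow> alg_state \<Rightarrow> alg_state \<Rightarrow> bool" where
  "counts_bounded t B s s' \<longleftrightarrow>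
     (\<forall>i\<le>length t. cnt_g s' i + pending (memo_g s') (take i t) \<le> cnt_g s i + pending (memo_g s) (take i t)
        \<and> cnt_q s' i + pending (memo_q s') (take i t) \<le> cnt_q s i + pending (memo_q s) (take i t))
     \<and> (\<forall>i>length t. cnt_g s' i \<le> cnt_g s i + B i \<and> cnt_q s' i \<le> cnt_q s i + 2 * B i)"

lemma counts_bounded_trans:
  assumes "counts_bounded t B s s'" "counts_bounded t B' s' s''"
  shows "counts_bounded t (\<lambda>i. B i + B' i) s s''"
  using assms unfolding counts_bounded_def by (fastforce intro: order_trans)

lemma counts_require_prefixes:
  assumes "m \<le> length t"
  shows "counts_bounded t B s (require_prefixes t m s)"
  using assms
proof (induction m)
  case 0
  then show ?case by (auto simp: counts_bounded_def)
next
  case (Suc m)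
  have ne: "take i t \<noteq> take (Suc m) t" if "i \<le> length t" "i \<noteq> Suc m" for i
    using that Suc.prems by (metis length_take min.absorb2)
  let ?s = "require_prefixes t m s" and ?s' = "require_prefixes t (Suc m) s"
  have len: "length (take (Suc m) t) = Suc m"
    using Suc.prems by simp
  have "cnt_g ?s' i + pending (memo_g ?s') (take i t) = cnt_g ?s i + pending (memo_g ?s) (take i t)"
    "cnt_q ?s' i + pending (memo_q ?s') (take i t) = cnt_q ?s i + pending (memo_q ?s) (take i t)"
    if "i \<le> length t" for i
    using ne[OF that] len
    by (cases "i = Suc m"; simp add: cnt_g_require_g cnt_q_require_q pending_def memo_g_require_g
        memo_q_require_q)+
  moreover have "cnt_g ?s' i = cnt_g ?s i" "cnt_q ?s' i = cnt_q ?s i" if "i > length t" for i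
    using that len Suc.prems by (simp_all add: cnt_g_require_g cnt_q_require_q)
  ultimately show ?case
    using Suc by (simp add: counts_bounded_def del: require_prefixes_simps)
qed

text \<open>
  A call for \<open>t\<close> writes iterates only at proper extensions of \<open>t\<close>, and leaves the starting points of the
  deeper levels in place. It stores new oracle answers only at extensions and prefixes of \<open>t\<close>. Thus the
  calls of different passes of a loop work on disjoint parts of the memory, apart from the shared prefixes.
\<close>

definition changes_below :: "nat list \<Rightarrow> alg_state \<Rightarrow> alg_state \<Rightarrow> bool" where
  "changes_below t s s' \<longleftrightarrow>
     (\<forall>u. (\<forall>v. v \<noteq> [] \<longrightarrow> u \<noteq> t @ v) \<longrightarrow> it_z s' u = it_z s u \<and> it_zbar s' u = it_zbar s u)
     \<and> (\<forall>m. it_z s' (t @ replicate m 0) = it_z s (t @ replicate m 0))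
     \<and> (\<forall>u v. memo_g s u = Some v \<longrightarrow> memo_g s' u = Some v)
     \<and> (\<forall>u v. memo_q s u = Some v \<longrightarrow> memo_q s' u = Some v)
     \<and> (\<forall>u. (\<forall>v. u \<noteq> t @ v) \<longrightarrow> (\<forall>i. u \<noteq> take i t) \<longrightarrow>
          memo_g s' u = memo_g s u \<and> memo_q s' u = memo_q s u)"

lemma changes_below_refl: "changes_below t s s"
  by (simp add: changes_below_def)

lemma changes_below_trans:
  assumes "changes_below t s s'" "changes_below t s' s''"
  shows "changes_below t s s''"
  using assms unfolding changes_below_def by (intro conjI allI impI) simp_all

lemma changes_below_snoc:
  assumes "changes_below (t @ [j]) s s'"
  shows "changes_below t s s'"
proof -
  have "it_z s' (t @ replicate m 0) = it_z s (t @ replicate m 0)" for m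
  proof (cases "m > 0 \<and> j = 0")
    case True
    then obtain m' where "m = Suc m'" by (cases m) auto
    with True assms show ?thesis
      by (auto simp: changes_below_def dest: spec[where x = m'])
  next
    case False
    then have "t @ replicate m 0 \<noteq> (t @ [j]) @ v" for v
      by (cases m) auto
    then show ?thesis
      using assms by (simp add: changes_below_def)
  qed
  moreover have "u \<noteq> take i (t @ [j])" if "\<forall>v. u \<noteq> t @ v" "\<forall>i. u \<noteq> take i t" for u i
    using that by (cases "i \<le> length t") auto
  ultimately show ?thesis
    using assms unfolding changes_below_def by auto
qed

text \<open>
  The copied entries belong to extensions of \<open>t'\<close> and the overwritten ones to extensions of \<open>t''\<close>, so the
  successive assignments act like a simultaneous one.
\<close>

lemma it_z_copy:
  fixes a b :: nat
  assumes "t' \<noteq> t''" "length t' = length t''"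
  shows "fold (\<lambda>l s. s\<lparr>it_z := (it_z s)(t'' @ replicate (l - a) 0 := it_z s (t' @ [c] @ replicate (l - Suc a) 0))\<rparr>)
      [Suc a..<Suc b] s
    = s\<lparr>it_z := (\<lambda>u. if \<exists>m\<in>{1..b - a}. u = t'' @ replicate m 0
          then it_z s (t' @ [c] @ replicate (length u - length t'' - 1) 0) else it_z s u)\<rparr>"
proof (induction b)
  case 0
  have "(\<lambda>u. if \<exists>m\<in>{1..0 - a}. u = t'' @ replicate m 0
          then it_z s (t' @ [c] @ replicate (length u - length t'' - 1) 0) else it_z s u) = it_z s"
    by auto
  then show ?case by simp
next
  case (Suc b)
  show ?case
  proof (cases "a \<le> b")
    case True
    have ne: "t' @ v \<noteq> t'' @ v'" for v v'
      using assms by auto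
    have "{1..Suc b - a} = insert (Suc b - a) {1..b - a}"
      using True by auto
    then show ?thesis
      using True Suc.IH by (auto simp: ne fun_eq_iff)
  next
    case False
    then show ?thesis
      using Suc.IH by auto
  qed
qed

definition pass_point :: "nat list \<Rightarrow> nat \<Rightarrow> vect \<Rightarrow> alg_state \<Rightarrow> vect" where
  "pass_point t j x s = arg_min_on (\<lambda>z. ip (Q (Suc (length t)) x - the (memo_q s (t @ [j]))) z
     + 1/2 * \<eta> (t @ [j]) * (wnorm d P (z - x))\<^sup>2) Z"

lemma loop_pass_fields:
  fixes t j s
  defines "t' \<equiv> t @ [j]" and "t'' \<equiv> t @ [Suc j]"
  assumes r: "r t' s = (x, s1)"
  defines "s3 \<equiv> require_q t' s1" and "s' \<equiv> loop_pass r t j s"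
  shows "it_zbar s' = (it_zbar s1)(t'' := \<alpha> j *\<^sub>R x + (1 - \<alpha> j) *\<^sub>R it_zbar s1 t')"
    and "memo_g s' = memo_g s1" "memo_q s' = memo_q s3"
    and "cnt_g s' = cnt_g s1" "cnt_q s' = (cnt_q s3)(Suc (length t) := Suc (cnt_q s3 (Suc (length t))))"
    and "it_z s' = (\<lambda>u. if \<exists>m\<in>{1..n - Suc (length t)}. u = t'' @ replicate m 0
          then it_z s1 (t' @ [T (length t + 2)] @ replicate (length u - length t'' - 1) 0)
          else if u = t'' then pass_point t j x s3 else it_z s1 u)"
proof -
  have ne: "t' \<noteq> t''" "length t' = length t''"
    by (auto simp: t'_def t''_def)
  have ne': "t' @ v \<noteq> t''" for v
    by (auto simp: t'_def t''_def)
  let ?s2 = "s1\<lparr>it_zbar := (it_zbar s1)(t'' := \<alpha> j *\<^sub>R x + (1 - \<alpha> j) *\<^sub>R it_zbar s1 t')\<rparr>"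
  have q: "require_q t' ?s2 = s3\<lparr>it_zbar := (it_zbar s1)(t'' := \<alpha> j *\<^sub>R x + (1 - \<alpha> j) *\<^sub>R it_zbar s1 t')\<rparr>"
    by (auto simp: require_q_def s3_def split: option.split)
  define s5 where "s5 = s3\<lparr>it_zbar := (it_zbar s1)(t'' := \<alpha> j *\<^sub>R x + (1 - \<alpha> j) *\<^sub>R it_zbar s1 t'),
      cnt_q := (cnt_q s3)(Suc (length t) := Suc (cnt_q s3 (Suc (length t)))),
      it_z := (it_z s1)(t'' := pass_point t j x s3)\<rparr>"
  have "s' = fold (\<lambda>l s. s\<lparr>it_z := (it_z s)(t'' @ replicate (l - Suc (length t)) 0
      := it_z s (t' @ [T (length t + 2)] @ replicate (l - Suc (Suc (length t))) 0))\<rparr>)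
      [Suc (Suc (length t))..<Suc n] s5"
    unfolding s'_def loop_pass_def Let_def s5_def pass_point_def
    by (simp add: r q s3_def del: upt_Suc flip: t'_def t''_def)
  then have s': "s' = s5\<lparr>it_z := (\<lambda>u. if \<exists>m\<in>{1..n - Suc (length t)}. u = t'' @ replicate m 0
          then it_z s5 (t' @ [T (length t + 2)] @ replicate (length u - length t'' - 1) 0) else it_z s5 u)\<rparr>"
    by (simp only: it_z_copy[OF ne])
  show "it_zbar s' = (it_zbar s1)(t'' := \<alpha> j *\<^sub>R x + (1 - \<alpha> j) *\<^sub>R it_zbar s1 t')"
    "memo_g s' = memo_g s1" "memo_q s' = memo_q s3" "cnt_g s' = cnt_g s1"
    "cnt_q s' = (cnt_q s3)(Suc (length t) := Suc (cnt_q s3 (Suc (length t))))"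
    unfolding s' s5_def s3_def by simp_all
  show "it_z s' = (\<lambda>u. if \<exists>m\<in>{1..n - Suc (length t)}. u = t'' @ replicate m 0
          then it_z s1 (t' @ [T (length t + 2)] @ replicate (length u - length t'' - 1) 0)
          else if u = t'' then pass_point t j x s3 else it_z s1 u)"
    unfolding s' s5_def s3_def using ne' by (auto simp: fun_eq_iff)
qed

lemma loop_pass_changes:
  assumes "changes_below (t @ [j]) s (snd (r (t @ [j]) s))"
  shows "changes_below t s (loop_pass r t j s)"
proof -
  obtain x s1 where r: "r (t @ [j]) s = (x, s1)"
    by (cases "r (t @ [j]) s")
  with assms have ch: "changes_below (t @ [j]) s s1"
    by simp
  let ?s' = "loop_pass r t j s"
  note fields = loop_pass_fields[of r t j s x s1, OF r]
  have ne: "t @ replicate m 0 \<noteq> t @ [Suc j] @ replicate m' 0" for m m'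
    by (cases m) auto
  have z: "it_z ?s' u = it_z s1 u" if "\<And>m. u \<noteq> t @ [Suc j] @ replicate m 0" for u
    using that that[of 0] by (simp add: fields)
  have "changes_below t s1 ?s'"
    unfolding changes_below_def
  proof (intro conjI allI impI)
    fix u assume u: "\<forall>v. v \<noteq> [] \<longrightarrow> u \<noteq> t @ v"
    show "it_z ?s' u = it_z s1 u"
      using u[rule_format, of "[Suc j] @ replicate m 0" for m] by (intro z) simp
    have "u \<noteq> t @ [Suc j]"
      using u[rule_format, of "[Suc j]"] by simp
    then show "it_zbar ?s' u = it_zbar s1 u"
      by (simp add: fields)
  next
    fix m show "it_z ?s' (t @ replicate m 0) = it_z s1 (t @ replicate m 0)"
      by (intro z ne)
  next
    fix u assume u: "\<forall>v. u \<noteq> t @ v"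
    have "u \<noteq> t @ [j]"
      by (rule u[rule_format])
    then show "memo_g ?s' u = memo_g s1 u" "memo_q ?s' u = memo_q s1 u"
      by (simp_all add: fields memo_q_require_q)
  qed (auto simp: fields memo_q_require_q)
  then show ?thesis
    using changes_below_trans[OF changes_below_snoc[OF ch]] by blast
qed

lemma loop_pass_counts:
  assumes "counts_bounded (t @ [j]) B s (snd (r (t @ [j]) s))" and B: "B (Suc (length t)) = 1"
  shows "counts_bounded t B s (loop_pass r t j s)"
proof -
  obtain x s1 where r: "r (t @ [j]) s = (x, s1)"
    by (cases "r (t @ [j]) s")
  with assms have c: "counts_bounded (t @ [j]) B s s1"
    by simp
  note fields = loop_pass_fields[of r t j s x s1, OF r]
  have pend: "pending m u \<le> 1" for m u
    by (simp add: pending_def)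
  have take: "take i (t @ [j]) = take i t" if "i \<le> length t" for i
    using that by simp
  have c1: "cnt_g s1 i + pending (memo_g s1) (take i t) \<le> cnt_g s i + pending (memo_g s) (take i t)"
    "cnt_q s1 i + pending (memo_q s1) (take i t) \<le> cnt_q s i + pending (memo_q s) (take i t)"
    if "i \<le> length t" for i
    using c that by (auto simp: counts_bounded_def dest!: spec[where x = i])
  have c2: "cnt_g s1 (Suc (length t)) + pending (memo_g s1) (t @ [j]) \<le> cnt_g s (Suc (length t)) + 1"
    "cnt_q s1 (Suc (length t)) + pending (memo_q s1) (t @ [j]) \<le> cnt_q s (Suc (length t)) + 1"
    using c pend[of "memo_g s" "t @ [j]"] pend[of "memo_q s" "t @ [j]"]
    by (auto simp: counts_bounded_def dest!: spec[where x = "Suc (length t)"])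
  have c3: "cnt_g s1 i \<le> cnt_g s i + B i" "cnt_q s1 i \<le> cnt_q s i + 2 * B i" if "i > Suc (length t)" for i
    using c that by (auto simp: counts_bounded_def)
  have ne: "take i t \<noteq> t @ [j]" for i
    by (rule notI, drule arg_cong[where f = length]) (simp add: min_def split: if_splits)
  show ?thesis
    unfolding counts_bounded_def
  proof (intro conjI allI impI)
    fix i assume "i \<le> length t"
    then show "cnt_g (loop_pass r t j s) i + pending (memo_g (loop_pass r t j s)) (take i t)
        \<le> cnt_g s i + pending (memo_g s) (take i t)"
      "cnt_q (loop_pass r t j s) i + pending (memo_q (loop_pass r t j s)) (take i t)
        \<le> cnt_q s i + pending (memo_q s) (take i t)"
      using c1[of i] ne[of i] by (simp_all add: fields cnt_q_require_q pending_def memo_q_require_q)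
  next
    fix i assume i: "i > length t"
    show "cnt_g (loop_pass r t j s) i \<le> cnt_g s i + B i"
      using i c2 c3[of i] B by (cases "i = Suc (length t)") (auto simp: fields)
    show "cnt_q (loop_pass r t j s) i \<le> cnt_q s i + 2 * B i"
      using i c2 c3[of i] B by (cases "i = Suc (length t)") (auto simp: fields cnt_q_require_q)
  qed
qed

text \<open>
  The state before pass \<open>j\<close> of the loop of a call for \<open>t\<close>; the parameter \<open>m\<close> is the recursion depth
  of the calls inside the loop.
\<close>

definition loop_state :: "nat \<Rightarrow> nat list \<Rightarrow> alg_state \<Rightarrow> nat \<Rightarrow> alg_state" where
  "loop_state m t s j = fold (loop_pass (rec m) t) [0..<j]
     (s\<lparr>it_zbar := (it_zbar s)(t @ [0] := it_z s (t @ [0]))\<rparr>)"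

lemma loop_state_simps:
  "loop_state m t s 0 = s\<lparr>it_zbar := (it_zbar s)(t @ [0] := it_z s (t @ [0]))\<rparr>"
  "loop_state m t s (Suc j) = loop_pass (rec m) t j (loop_state m t s j)"
  by (simp_all add: loop_state_def)

lemma rec_Suc_loop_state:
  "rec (Suc m) t s = (it_zbar (loop_state m t s (T (Suc (length t)))) (t @ [T (Suc (length t))]),
     loop_state m t s (T (Suc (length t))))"
  by (simp add: loop_state_def Let_def)

lemma changes_below_loop_start: "changes_below t s (loop_state m t s 0)"
  by (auto simp: changes_below_def loop_state_simps)

lemma rec_changes: "changes_below t s (snd (rec m t s))"
proof (induction m arbitrary: t s)
  case 0
  have "snd (rec 0 t s) = require_prefixes t n s"
    by (simp add: rec_leaf_def require_prefixes_def Let_def)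
  then show ?case
    by (auto simp: changes_below_def memo_require_prefixes)
next
  case (Suc m)
  note outer_IH = Suc.IH
  have "changes_below t s (loop_state m t s j)" for j
  proof (induction j)
    case (Suc j)
    have "changes_below t (loop_state m t s j) (loop_state m t s (Suc j))"
      unfolding loop_state_simps(2) by (intro loop_pass_changes outer_IH)
    then show ?case
      using Suc changes_below_trans by blast
  qed (rule changes_below_loop_start)
  then show ?case
    by (simp only: rec_Suc_loop_state snd_conv)
qed

lemma loop_pass_rec_changes: "changes_below t s (loop_pass (rec m) t j s)"
  by (intro loop_pass_changes rec_changes)

lemma loop_state_changes:
  assumes "i \<le> j"
  shows "changes_below t (loop_state m t s i) (loop_state m t s j)"
  using assms
proof (induction j)
  case (Suc j)
  then show ?case
    using loop_pass_rec_changes[of t "loop_state m t s j" m j]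
    by (cases "i = Suc j") (auto simp: changes_below_refl loop_state_simps(2) intro: changes_below_trans)
qed (simp add: changes_below_refl)

text \<open>
  Each pass makes at most one new evaluation of \<open>G\<close> and of \<open>Q\<close> at its own multi-index, which is pending before
  it, and one more evaluation of \<open>Q\<close> for the correction. This is the factor 2 in \<open>counts_bounded\<close>.
\<close>

lemma rec_counts:
  assumes "length t + m = n"
  shows "counts_bounded t (\<lambda>i. \<Prod>l=Suc (length t)..i. T l) s (snd (rec m t s))"
  using assms
proof (induction m arbitrary: t s)
  case 0
  have "snd (rec 0 t s) = require_prefixes t (length t) s"
    using 0 by (simp add: rec_leaf_def require_prefixes_def Let_def)
  then show ?case
    by (simp add: counts_require_prefixes)
next
  case (Suc m)
  note outer = Suc.IH Suc.prems
  let ?B = "\<lambda>i. \<Prod>l=Suc (Suc (length t))..i. T l"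
  have "counts_bounded t (\<lambda>i. j * ?B i) s (loop_state m t s j)" for j
  proof (induction j)
    case 0
    show ?case
      by (simp add: counts_bounded_def loop_state_simps)
  next
    case (Suc j)
    have "counts_bounded (t @ [j]) ?B (loop_state m t s j) (snd (rec m (t @ [j]) (loop_state m t s j)))"
      using outer(1)[of "t @ [j]" "loop_state m t s j"] outer(2) by simp
    then have "counts_bounded t ?B (loop_state m t s j) (loop_state m t s (Suc j))"
      unfolding loop_state_simps(2) by (intro loop_pass_counts) auto
    from counts_bounded_trans[OF Suc this] show ?case
      by (simp add: add.commute)
  qed
  from this[of "T (Suc (length t))"] show ?case
    unfolding rec_Suc_loop_state snd_conv counts_bounded_def
    by (simp add: prod.atLeast_Suc_atMost)
qed

end

section \<open>The gap function of a recursive call\<close>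

locale sliding_problem =
  weighted_space d P + sliding d n Z P Q G T alpha "eta T \<Omega> M \<nu> H" z_in
  for d P n Z Q G T z_in and \<Omega> :: real and M \<nu> H :: "nat \<Rightarrow> real" +
  fixes D :: "nat \<Rightarrow> vect set" and p :: "nat \<Rightarrow> vect \<Rightarrow> real"
  assumes Z_Rspace: "Z \<subseteq> Rspace d" and convex_Z: "convex Z" and compact_Z: "compact Z"
    and z_in: "z_in \<in> Z" and \<Omega>: "\<And>z. z \<in> Z \<Longrightarrow> nsq (z - z_in) \<le> \<Omega>"
    and T_pos: "\<And>i. i \<in> {1..n} \<Longrightarrow> T i > 0"
    and M_nonneg: "\<And>i. i \<in> {1..n} \<Longrightarrow> M i \<ge> 0" and H_nonneg: "\<And>i. i \<in> {1..n} \<Longrightarrow> H i \<ge> 0"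
    and \<nu>: "\<And>i. i \<in> {1..n} \<Longrightarrow> 0 \<le> \<nu> i \<and> \<nu> i \<le> 1"
    and Q_Rspace: "\<And>i. i \<in> {1..n} \<Longrightarrow> Q i ` Z \<subseteq> Rspace d"
    and Q_mono: "\<And>i. i \<in> {1..n} \<Longrightarrow> monotone_op Z (Q i)"
    and Q_lipschitz: "\<And>i. i \<in> {1..n} \<Longrightarrow> lipschitz_op d P Z (M i) (Q i)"
    and Z_D: "\<And>i. i \<in> {1..n} \<Longrightarrow> Z \<subseteq> D i"
    and p_convex: "\<And>i. i \<in> {1..n} \<Longrightarrow> convex_on (D i) (p i)"
    and subgradients: "\<And>i u. i \<in> {1..n} \<Longrightarrow> u \<in> Z \<Longrightarrow> subdifferential d (D i) (p i) u \<noteq> {}"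
    and holder: "\<And>i. i \<in> {1..n} \<Longrightarrow> holder_cond d P Z (D i) (\<nu> i) (H i) (p i)"
    and oracle_answers: "\<And>i t u. i \<in> {1..n} \<Longrightarrow> u \<in> Z \<Longrightarrow> G i t u \<in> subdifferential d (D i) (p i) u"
begin

abbreviation lip :: "nat \<Rightarrow> real" where
  "lip i \<equiv> L_par T \<Omega> i (\<nu> i) (H i)"

abbreviation acc :: "nat \<Rightarrow> real" where
  "acc i \<equiv> delta_par T \<Omega> i (\<nu> i) (H i)"

abbreviation step :: "nat list \<Rightarrow> real" where
  "step \<equiv> eta T \<Omega> M \<nu> H"

lemma in_Rspace: "z \<in> Z \<Longrightarrow> z \<in> Rspace d"
  using Z_Rspace by blast

lemma diff_in_Rspace: "x \<in> Z \<Longrightarrow> y \<in> Z \<Longrightarrow> x - y \<in> Rspace d"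
  by (simp add: in_Rspace Rspace_diff)

lemma \<Omega>_nonneg: "\<Omega> \<ge> 0"
  using \<Omega>[OF z_in] by (simp add: nsq_def)

lemma convex_comb_in_Z: "x \<in> Z \<Longrightarrow> y \<in> Z \<Longrightarrow> alpha j *\<^sub>R x + (1 - alpha j) *\<^sub>R y \<in> Z"
  using convex_Z alpha_pos[of j] alpha_le_1[of j] by (simp add: convexD)

lemma lip_nonneg: "i \<in> {1..n} \<Longrightarrow> lip i \<ge> 0"
  by (simp add: L_par_nonneg H_nonneg)

definition coef :: "nat list \<Rightarrow> real" where
  "coef t = (\<Prod>l<length t. alpha (t ! l))"

lemma coef_pos: "coef t > 0"
  by (simp add: coef_def prod_pos alpha_pos)

lemma prod_nth_snoc: "(\<Prod>l<length (t @ [j]). f l ((t @ [j]) ! l)) = (\<Prod>l<length t. f l (t ! l)) * f (length t) j"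
  for f :: "nat \<Rightarrow> nat \<Rightarrow> real"
  by (simp add: nth_append)

lemma coef_snoc: "coef (t @ [j]) = coef t * alpha j"
  using prod_nth_snoc[of "\<lambda>_. alpha"] by (simp only: coef_def)

text \<open>
  The composition \<open>a\<^sub>1 \<circ> \<dots> \<circ> a\<^sub>k\<close> of the averaging maps; it is affine with factor \<open>coef t\<close>.
\<close>

definition avg :: "alg_state \<Rightarrow> nat list \<Rightarrow> vect \<Rightarrow> vect" where
  "avg s t = foldr (\<lambda>l x. alpha (t ! l) *\<^sub>R x + (1 - alpha (t ! l)) *\<^sub>R it_zbar s (take (Suc l) t))
     [0..<length t]"

lemma w_point_eq_avg: "w_point s t = avg s t (it_z s t)"
  by (simp add: w_point_def avg_def)

lemma avg_Nil [simp]: "avg s [] x = x"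
  by (simp add: avg_def)

lemma avg_snoc: "avg s (t @ [j]) x = avg s t (alpha j *\<^sub>R x + (1 - alpha j) *\<^sub>R it_zbar s (t @ [j]))"
proof -
  have "avg s (t @ [j]) x
      = foldr (\<lambda>l x. alpha ((t @ [j]) ! l) *\<^sub>R x + (1 - alpha ((t @ [j]) ! l)) *\<^sub>R it_zbar s (take (Suc l) (t @ [j])))
          [0..<length t] (alpha j *\<^sub>R x + (1 - alpha j) *\<^sub>R it_zbar s (t @ [j]))"
    by (simp add: avg_def)
  also have "\<dots> = avg s t (alpha j *\<^sub>R x + (1 - alpha j) *\<^sub>R it_zbar s (t @ [j]))"
    unfolding avg_def by (rule foldr_cong) (auto simp: nth_append)
  finally show ?thesis .
qed

lemma avg_cong:
  assumes "\<And>i. i \<in> {1..length t} \<Longrightarrow> it_zbar s' (take i t) = it_zbar s (take i t)"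
  shows "avg s' t = avg s t"
  unfolding avg_def fun_eq_iff by (intro allI foldr_cong) (auto simp: assms)

lemma avg_diff: "avg s t x - avg s t y = coef t *\<^sub>R (x - y)"
proof (induction t arbitrary: x y rule: rev_induct)
  case (snoc j t)
  then show ?case
    by (simp add: avg_snoc coef_snoc scaleR_diff_right[symmetric])
qed (simp add: coef_def)

lemma avg_convex_comb: "avg s t (a *\<^sub>R x + (1 - a) *\<^sub>R y) = a *\<^sub>R avg s t x + (1 - a) *\<^sub>R avg s t y"
proof -
  have x: "avg s t x = avg s t y + coef t *\<^sub>R (x - y)"
    using avg_diff[of s t x y] by (simp add: algebra_simps)
  have "avg s t (a *\<^sub>R x + (1 - a) *\<^sub>R y) = avg s t y + coef t *\<^sub>R (a *\<^sub>R x + (1 - a) *\<^sub>R y - y)"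
    using avg_diff[of s t "a *\<^sub>R x + (1 - a) *\<^sub>R y" y] by (simp add: algebra_simps)
  then show ?thesis
    unfolding x by (simp add: algebra_simps)
qed

text \<open>
  The bound on the entries makes the factors \<open>\<alpha>\<^bsub>t\<^esub> / \<alpha>\<^bsub>T-1\<^esub>\<close> of the step size at least 1.
\<close>

definition prefix_feasible :: "nat list \<Rightarrow> alg_state \<Rightarrow> bool" where
  "prefix_feasible t s \<longleftrightarrow> (\<forall>l<length t. t ! l < T (Suc l))
     \<and> (\<forall>i\<in>{1..length t}. it_z s (take i t) \<in> Z \<and> it_zbar s (take i t) \<in> Z)"

lemma prefix_feasible_snoc:
  "prefix_feasible (t @ [j]) s \<longleftrightarrow> prefix_feasible t s \<and> j < T (Suc (length t))
     \<and> it_z s (t @ [j]) \<in> Z \<and> it_zbar s (t @ [j]) \<in> Z"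
proof -
  have "{1..length (t @ [j])} = insert (Suc (length t)) {1..length t}"
    by auto
  then show ?thesis
    unfolding prefix_feasible_def by (auto simp: nth_append less_Suc_eq)
qed

lemma avg_in_Z: "prefix_feasible t s \<Longrightarrow> x \<in> Z \<Longrightarrow> avg s t x \<in> Z"
proof (induction t arbitrary: x rule: rev_induct)
  case (snoc j t)
  then show ?case
    by (simp add: avg_snoc prefix_feasible_snoc convex_comb_in_Z)
qed simp

lemma prefix_feasible_take: "prefix_feasible t s \<Longrightarrow> prefix_feasible (take i t) s"
  by (auto simp: prefix_feasible_def min_def split: if_splits)

text \<open>
  When a call for \<open>t\<close> starts, the oracle answers for some of the prefixes of \<open>t\<close> may be missing, and the
  first leaf below \<open>t\<close> computes them. Hence the property that the existing answers are correct is separated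
  from the property that all of them exist.
\<close>

definition consistent :: "nat list \<Rightarrow> alg_state \<Rightarrow> bool" where
  "consistent t s \<longleftrightarrow> (\<forall>i\<in>{1..length t}.
     (\<forall>v. memo_g s (take i t) = Some v \<longrightarrow> v \<in> subdifferential d (D i) (p i) (w_point s (take i t)))
     \<and> (\<forall>v. memo_q s (take i t) = Some v \<longrightarrow> v = Q i (it_z s (take i t))))"

definition stored :: "nat list \<Rightarrow> alg_state \<Rightarrow> bool" where
  "stored t s \<longleftrightarrow> (\<forall>i\<in>{1..length t}. memo_g s (take i t) \<noteq> None \<and> memo_q s (take i t) \<noteq> None)"

lemma consistent_snoc:
  "consistent (t @ [j]) s \<longleftrightarrow> consistent t s
     \<and> (\<forall>v. memo_g s (t @ [j]) = Some v \<longrightarrow>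
          v \<in> subdifferential d (D (Suc (length t))) (p (Suc (length t))) (w_point s (t @ [j])))
     \<and> (\<forall>v. memo_q s (t @ [j]) = Some v \<longrightarrow> v = Q (Suc (length t)) (it_z s (t @ [j])))"
proof -
  have "{1..length (t @ [j])} = insert (Suc (length t)) {1..length t}"
    by auto
  then show ?thesis
    unfolding consistent_def by auto
qed

lemma stored_snoc:
  "stored (t @ [j]) s \<longleftrightarrow> stored t s \<and> memo_g s (t @ [j]) \<noteq> None \<and> memo_q s (t @ [j]) \<noteq> None"
proof -
  have "{1..length (t @ [j])} = insert (Suc (length t)) {1..length t}"
    by auto
  then show ?thesis
    unfolding stored_def by auto
qed

text \<open>
  The gap of a point \<open>x\<close> with respect to a comparison point \<open>z\<close> for the subproblem of a call for \<open>t\<close>. Up to the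
  level of \<open>t\<close> the components enter by their fixed linear terms and proximal terms. For a deeper component the
  function is evaluated at averaged points; dividing by \<open>coef t\<close> undoes the contraction, so that its linearisation
  has slope \<open>p\<^sub>i'\<close> in \<open>x\<close>, as for the fixed components.
\<close>

definition pre_term :: "alg_state \<Rightarrow> nat list \<Rightarrow> vect \<Rightarrow> vect \<Rightarrow> nat \<Rightarrow> real" where
  "pre_term s t z x i =
     ip (the (memo_g s (take i t)) + the (memo_q s (take i t))) (x - z)
     - 1/2 * step (take i t)
         * (nsq (z - it_z s (take i t)) - nsq (x - it_z s (take i t)) - nsq (z - x))"

definition deep_term :: "alg_state \<Rightarrow> nat list \<Rightarrow> vect \<Rightarrow> vect \<Rightarrow> nat \<Rightarrow> real" where
  "deep_term s t z x i = (p i (avg s t x) - p i (avg s t z)) / coef t + ip (Q i z) (x - z)"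

definition gap :: "alg_state \<Rightarrow> nat list \<Rightarrow> vect \<Rightarrow> vect \<Rightarrow> real" where
  "gap s t z x = (\<Sum>i=1..length t. pre_term s t z x i) + (\<Sum>i=Suc (length t)..n. deep_term s t z x i)"

lemma step_ge:
  assumes "prefix_feasible t s" "length t \<in> {1..n}"
  shows "step t \<ge> lip (length t) * coef t + M (length t)"
proof -
  have "1 \<le> (\<Prod>l<length t. alpha (t ! l) / alpha (T (Suc l) - 1))"
  proof (rule prod_ge_1)
    fix l assume "l \<in> {..<length t}"
    then have "t ! l \<le> T (Suc l) - 1"
      using assms(1) by (fastforce simp: prefix_feasible_def)
    then show "1 \<le> alpha (t ! l) / alpha (T (Suc l) - 1)"
      using alpha_antimono alpha_pos by simp
  qed
  then have "M (length t) * 1 \<le> M (length t) * (\<Prod>l<length t. alpha (t ! l) / alpha (T (Suc l) - 1))"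
    using M_nonneg assms(2) by (intro mult_left_mono) auto
  then show ?thesis
    by (simp add: eta_def coef_def Let_def)
qed

lemma step_nonneg:
  assumes "prefix_feasible t s" "length t \<in> {1..n}"
  shows "step t \<ge> 0"
proof -
  have "0 \<le> lip (length t) * coef t + M (length t)"
    using assms lip_nonneg coef_pos[of t] M_nonneg by (intro add_nonneg_nonneg mult_nonneg_nonneg) auto
  then show ?thesis
    using step_ge[OF assms] by linarith
qed

lemma smooth_upper_bound:
  assumes i: "i \<in> {1..n}" and uv: "u \<in> Z" "v \<in> Z" and g: "g \<in> subdifferential d (D i) (p i) u"
  shows "p i v \<le> p i u + ip g (v - u) + lip i / 2 * nsq (v - u) + acc i"
proof -
  have R: "v - u \<in> Rspace d"
    using uv by (simp add: diff_in_Rspace)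
  have "wnorm d P (v - u) = 0" if "\<Omega> = 0"
  proof -
    have "w = z_in" if "w \<in> Z" for w
    proof (rule ccontr)
      assume "w \<noteq> z_in"
      then show False
        using nsq_pos[of "w - z_in"] \<Omega>[OF \<open>w \<in> Z\<close>] \<open>\<Omega> = 0\<close> \<open>w \<in> Z\<close> z_in by (simp add: diff_in_Rspace)
    qed
    from this[OF uv(1)] this[OF uv(2)] have "v - u = 0"
      by simp
    then show ?thesis
      by (simp add: wnorm_eq nsq_def)
  qed
  moreover have "N_par T i > 0"
    unfolding N_par_def using i by (intro prod_pos T_pos) auto
  ultimately have "H i / (1 + \<nu> i) * wnorm d P (v - u) powr (1 + \<nu> i)
      \<le> lip i / 2 * (wnorm d P (v - u))\<^sup>2 + acc i"
    using i \<nu> H_nonneg \<Omega>_nonneg R by (intro holder_remainder_le_quadratic wnorm_nonneg) auto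
  moreover have "p i v \<le> p i u + ip g (v - u) + H i / (1 + \<nu> i) * wnorm d P (v - u) powr (1 + \<nu> i)"
    using i uv g \<nu> H_nonneg
    by (intro holder_upper_bound[OF Z_Rspace convex_Z Z_D subgradients holder]) auto
  ultimately show ?thesis
    using R by (simp add: wnorm_sq)
qed

lemma p_convex_comb:
  assumes "i \<in> {1..n}" "x \<in> Z" "y \<in> Z"
  shows "p i (alpha j *\<^sub>R x + (1 - alpha j) *\<^sub>R y) \<le> alpha j * p i x + (1 - alpha j) * p i y"
proof -
  have "x \<in> D i" "y \<in> D i"
    using assms Z_D by blast+
  then show ?thesis
    using p_convex[OF assms(1)] alpha_pos[of j] alpha_le_1[of j] by (auto simp: convex_on_def)
qed

text \<open>
  The map for \<open>t @ [j]\<close> first moves a point towards the running average of its level and then applies the affine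
  map for \<open>t\<close>, so convexity bounds the value by those at the images of the two points.
\<close>

lemma avg_snoc_le:
  assumes "i \<in> {1..n}" "prefix_feasible (t @ [j]) s" "z \<in> Z"
  shows "p i (avg s (t @ [j]) z)
    \<le> alpha j * p i (avg s t z) + (1 - alpha j) * p i (avg s t (it_zbar s (t @ [j])))"
  unfolding avg_snoc avg_convex_comb
  using assms by (intro p_convex_comb avg_in_Z) (auto simp: prefix_feasible_snoc)

text \<open>
  For the component whose oracles are called at this level, the gradient step is charged to the part
  \<open>lip * coef\<close> of the step size, and the extragradient error to the part \<open>M\<close>.
\<close>

lemma component_step:
  fixes t j s x z y' and g q :: vect
  defines "t' \<equiv> t @ [j]" and "i \<equiv> Suc (length t)"
  defines "y \<equiv> it_z s t'" and "zb \<equiv> it_zbar s t'"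
  assumes i: "i \<le> n" and feas: "prefix_feasible t' s" and pts: "x \<in> Z" "z \<in> Z" "y' \<in> Z"
    and g: "g \<in> subdifferential d (D i) (p i) (w_point s t')" and q: "q = Q i y"
    and prox: "ip (Q i x - q) (y' - z) \<le> 1/2 * step t' * (nsq (z - x) - nsq (y' - x) - nsq (z - y'))"
  shows "deep_term s t z (alpha j *\<^sub>R x + (1 - alpha j) *\<^sub>R zb) i
    \<le> (1 - alpha j) * deep_term s t z zb i
      + alpha j * ((ip (g + q) (x - z) - 1/2 * step t' * (nsq (z - y) - nsq (x - y) - nsq (z - x)))
          + (1/2 * step t' * (nsq (z - y) - nsq (z - y')) + acc i / coef t'))"
proof -
  define c where "c = coef t'"
  have i_in: "i \<in> {1..n}"
    using i by (simp add: i_def)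
  have feas_t: "prefix_feasible t s" and y: "y \<in> Z" and zb: "zb \<in> Z"
    using feas by (auto simp: prefix_feasible_snoc t'_def y_def zb_def)
  have c: "c > 0" "c = coef t * alpha j"
    by (simp_all add: c_def coef_pos) (simp add: t'_def coef_snoc)
  have w: "w_point s t' = avg s t' y" "avg s t' y \<in> Z"
    using avg_in_Z[OF feas y] by (simp_all add: w_point_eq_avg y_def)
  have upper: "p i (avg s t' x) \<le> p i (avg s t' y) + ip g (avg s t' x - avg s t' y)
      + lip i / 2 * nsq (avg s t' x - avg s t' y) + acc i"
    using g w avg_in_Z[OF feas pts(1)] by (intro smooth_upper_bound[OF i_in]) auto
  have lower: "p i (avg s t' z) \<ge> p i (avg s t' y) + ip g (avg s t' z - avg s t' y)"
    using g w avg_in_Z[OF feas pts(2)] Z_D[OF i_in] by (auto simp: subdifferential_def)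
  have ip_eq: "ip g (avg s t' x - avg s t' y) = ip g (avg s t' z - avg s t' y) + c * ip g (x - z)"
  proof -
    have "avg s t' x - avg s t' y = (avg s t' z - avg s t' y) + c *\<^sub>R (x - z)"
      using avg_diff[of s t' x z] by (simp add: c_def algebra_simps)
    then show ?thesis
      by (simp only: ip_add_right ip_scaleR_right)
  qed
  have nsq_eq: "nsq (avg s t' x - avg s t' y) = c\<^sup>2 * nsq (x - y)"
    by (simp add: avg_diff nsq_scaleR c_def)
  note conv = avg_snoc_le[OF i_in feas[unfolded t'_def] pts(2), folded t'_def zb_def]
  have "p i (avg s t' x) \<le> alpha j * p i (avg s t z) + (1 - alpha j) * p i (avg s t zb)
      + c * ip g (x - z) + lip i / 2 * (c\<^sup>2 * nsq (x - y)) + acc i"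
    using upper[unfolded ip_eq nsq_eq] lower conv by linarith
  then have "p i (avg s t' x) - p i (avg s t z) \<le> (1 - alpha j) * (p i (avg s t zb) - p i (avg s t z))
      + (c * ip g (x - z) + lip i / 2 * (c\<^sup>2 * nsq (x - y)) + acc i)"
    by (simp add: algebra_simps)
  then have "(p i (avg s t' x) - p i (avg s t z)) / coef t
      \<le> ((1 - alpha j) * (p i (avg s t zb) - p i (avg s t z))
      + (c * ip g (x - z) + lip i / 2 * (c\<^sup>2 * nsq (x - y)) + acc i)) / coef t"
    using coef_pos[of t] by (intro divide_right_mono) auto
  also have "\<dots> = (1 - alpha j) * ((p i (avg s t zb) - p i (avg s t z)) / coef t)
      + alpha j * (ip g (x - z) + 1/2 * (lip i * c) * nsq (x - y) + acc i / c)"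
    using coef_pos[of t] alpha_pos[of j] by (simp add: c(2) field_simps power2_eq_square)
  finally have P: "(p i (avg s t' x) - p i (avg s t z)) / coef t \<le> \<dots>" .
  have "ip (Q i z) (x - z) \<le> ip q (x - z) + 1/2 * M i * nsq (x - y) + 1/2 * (M i - step t') * nsq (y' - x)
      + 1/2 * step t' * (nsq (z - x) - nsq (z - y'))"
    using extragradient_step[OF Z_Rspace Q_Rspace[OF i_in] Q_mono[OF i_in] Q_lipschitz[OF i_in] pts(1) y pts(3,2)
        M_nonneg[OF i_in], of "step t'"] prox by (simp add: q)
  moreover have step: "lip i * c + M i \<le> step t'"
    using step_ge[OF feas] i_in by (simp add: c_def) (simp add: t'_def i_def)
  \<comment> \<open>The length of the corrector half step is dominated since \<open>M i \<le> step t'\<close>.\<close>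
  moreover have "1/2 * (M i - step t') * nsq (y' - x) \<le> 0"
  proof -
    have "0 \<le> lip i * c"
      using lip_nonneg[OF i_in] c by simp
    then have "M i \<le> lip i * c + M i"
      by simp
    then have "1/2 * (M i - step t') \<le> 0"
      using order_trans[OF _ step] by simp
    then show ?thesis
      by (rule mult_nonpos_nonneg) (use pts in \<open>auto intro!: nsq_nonneg diff_in_Rspace\<close>)
  qed
  moreover have "1/2 * (lip i * c) * nsq (x - y) + 1/2 * M i * nsq (x - y) \<le> 1/2 * step t' * nsq (x - y)"
    unfolding distrib_right[symmetric] distrib_left[symmetric]
    using step pts y by (intro mult_right_mono nsq_nonneg diff_in_Rspace) auto
  ultimately have "ip g (x - z) + 1/2 * (lip i * c) * nsq (x - y) + ip (Q i z) (x - z)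
      \<le> ip g (x - z) + ip q (x - z) + 1/2 * step t' * nsq (x - y)
        + 1/2 * step t' * (nsq (z - x) - nsq (z - y'))"
    by linarith
  also have "\<dots> = (ip (g + q) (x - z) - 1/2 * step t' * (nsq (z - y) - nsq (x - y) - nsq (z - x)))
          + 1/2 * step t' * (nsq (z - y) - nsq (z - y'))"
    by (simp add: ip_linear algebra_simps)
  finally have PQ: "(ip g (x - z) + 1/2 * (lip i * c) * nsq (x - y) + acc i / c) + ip (Q i z) (x - z)
      \<le> (ip (g + q) (x - z) - 1/2 * step t' * (nsq (z - y) - nsq (x - y) - nsq (z - x)))
          + (1/2 * step t' * (nsq (z - y) - nsq (z - y')) + acc i / c)"
    by linarith
  have "deep_term s t z (alpha j *\<^sub>R x + (1 - alpha j) *\<^sub>R zb) i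
      = (p i (avg s t' x) - p i (avg s t z)) / coef t
        + ((1 - alpha j) * ip (Q i z) (zb - z) + alpha j * ip (Q i z) (x - z))"
    by (simp add: deep_term_def t'_def zb_def avg_snoc ip_linear algebra_simps)
  also have "\<dots> \<le> (1 - alpha j) * ((p i (avg s t zb) - p i (avg s t z)) / coef t)
      + alpha j * (ip g (x - z) + 1/2 * (lip i * c) * nsq (x - y) + acc i / c)
      + ((1 - alpha j) * ip (Q i z) (zb - z) + alpha j * ip (Q i z) (x - z))"
    using P by (intro add_right_mono)
  also have "\<dots> = (1 - alpha j) * deep_term s t z zb i
      + alpha j * ((ip g (x - z) + 1/2 * (lip i * c) * nsq (x - y) + acc i / c) + ip (Q i z) (x - z))"
    by (simp add: deep_term_def algebra_simps)
  also have "\<dots> \<le> (1 - alpha j) * deep_term s t z zb i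
      + alpha j * ((ip (g + q) (x - z) - 1/2 * step t' * (nsq (z - y) - nsq (x - y) - nsq (z - x)))
          + (1/2 * step t' * (nsq (z - y) - nsq (z - y')) + acc i / c))"
    using PQ alpha_pos[of j] by (intro add_left_mono mult_left_mono) auto
  finally show ?thesis
    by (simp add: c_def)
qed

text \<open>
  Passing from the running average to the next one decreases the gap of the call for \<open>t\<close> by the factor \<open>1 - \<alpha>\<^sub>j\<close>,
  up to \<open>\<alpha>\<^sub>j\<close> times the gap of the inner call. The fixed components contribute by convexity of their proximal
  terms, the deeper ones by convexity of \<open>p\<^sub>i\<close>, and component \<open>length t + 1\<close> by \<open>component_step\<close>.
\<close>

lemma gap_step:
  fixes t j s x z y'
  defines "t' \<equiv> t @ [j]" and "i \<equiv> Suc (length t)"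
  defines "y \<equiv> it_z s t'" and "zb \<equiv> it_zbar s t'"
  assumes i: "i \<le> n" and feas: "prefix_feasible t' s" and cons: "consistent t' s" and stored: "stored t' s"
    and pts: "x \<in> Z" "z \<in> Z" "y' \<in> Z"
    and prox: "ip (Q i x - the (memo_q s t')) (y' - z)
      \<le> 1/2 * step t' * (nsq (z - x) - nsq (y' - x) - nsq (z - y'))"
  shows "gap s t z (alpha j *\<^sub>R x + (1 - alpha j) *\<^sub>R zb)
    \<le> (1 - alpha j) * gap s t z zb
      + alpha j * (gap s t' z x + (1/2 * step t' * (nsq (z - y) - nsq (z - y')) + acc i / coef t'))"
proof -
  let ?x = "alpha j *\<^sub>R x + (1 - alpha j) *\<^sub>R zb"
  let ?e = "1/2 * step t' * (nsq (z - y) - nsq (z - y')) + acc i / coef t'"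
  have feas_t: "prefix_feasible t s" and y: "y \<in> Z" and zb: "zb \<in> Z"
    using feas by (auto simp: prefix_feasible_snoc t'_def y_def zb_def)
  have len: "length t' = i" "take i t' = t'"
    by (simp_all add: t'_def i_def)
  have pre: "pre_term s t z ?x l \<le> (1 - alpha j) * pre_term s t z zb l + alpha j * pre_term s t' z x l"
    if "l \<in> {1..length t}" for l
  proof -
    have "take l t' = take l t"
      using that by (simp add: t'_def)
    moreover have "step (take l t) \<ge> 0"
      using that i by (intro step_nonneg[OF prefix_feasible_take[OF feas_t]]) (auto simp: i_def)
    ultimately show ?thesis
      unfolding pre_term_def
      using alpha_pos[of j] alpha_le_1[of j] in_Rspace[OF pts(1)] in_Rspace[OF zb] prox_term_convex by simp
  qed
  have deep: "deep_term s t z ?x l \<le> (1 - alpha j) * deep_term s t z zb l + alpha j * deep_term s t' z x l"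
    if "l \<in> {Suc i..n}" for l
  proof -
    have "p l (avg s t' z) \<le> alpha j * p l (avg s t z) + (1 - alpha j) * p l (avg s t zb)"
      using avg_snoc_le[of l t j s z] that feas pts by (simp add: t'_def zb_def i_def)
    from averaged_gap_le[where h = "p l", OF alpha_pos coef_pos[of t] this, of "avg s t' x" "Q l z" x zb z]
    show ?thesis
      by (simp add: deep_term_def coef_snoc t'_def zb_def avg_snoc)
  qed
  have comp: "deep_term s t z ?x i \<le> (1 - alpha j) * deep_term s t z zb i + alpha j * (pre_term s t' z x i + ?e)"
  proof -
    obtain g q where gq: "memo_g s t' = Some g" "memo_q s t' = Some q"
      using stored by (auto simp: stored_snoc t'_def)
    then have "g \<in> subdifferential d (D i) (p i) (w_point s t')" "q = Q i y"
      using cons by (auto simp: consistent_snoc t'_def i_def y_def)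
    then show ?thesis
      using component_step[of t j s x z y' g q] i feas pts prox gq
      by (simp add: pre_term_def len y_def zb_def flip: t'_def i_def)
  qed
  have "gap s t z ?x = (\<Sum>l=1..length t. pre_term s t z ?x l) + deep_term s t z ?x i
      + (\<Sum>l=Suc i..n. deep_term s t z ?x l)"
    using i by (simp add: gap_def i_def sum.atLeast_Suc_atMost)
  also have "\<dots> \<le> (\<Sum>l=1..length t. (1 - alpha j) * pre_term s t z zb l + alpha j * pre_term s t' z x l)
      + ((1 - alpha j) * deep_term s t z zb i + alpha j * (pre_term s t' z x i + ?e))
      + (\<Sum>l=Suc i..n. (1 - alpha j) * deep_term s t z zb l + alpha j * deep_term s t' z x l)"
    by (intro add_mono sum_mono pre deep comp) auto
  also have "\<dots> = (1 - alpha j) * ((\<Sum>l=1..length t. pre_term s t z zb l) + deep_term s t z zb i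
        + (\<Sum>l=Suc i..n. deep_term s t z zb l))
      + alpha j * ((\<Sum>l=1..length t. pre_term s t' z x l) + pre_term s t' z x i
        + (\<Sum>l=Suc i..n. deep_term s t' z x l) + ?e)"
    by (simp add: sum.distrib sum_distrib_left distrib_left)
  also have "(\<Sum>l=1..length t. pre_term s t z zb l) + deep_term s t z zb i
        + (\<Sum>l=Suc i..n. deep_term s t z zb l) = gap s t z zb"
    using i by (simp add: gap_def i_def sum.atLeast_Suc_atMost)
  also have "(\<Sum>l=1..length t. pre_term s t' z x l) + pre_term s t' z x i
        + (\<Sum>l=Suc i..n. deep_term s t' z x l) = gap s t' z x"
    by (simp add: gap_def len) (simp add: i_def)
  finally show ?thesis .
qed

section \<open>The bound for a recursive call\<close>

lemma changes_below_prefix: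
  assumes "changes_below t s s'"
  shows "it_z s' (take i t) = it_z s (take i t)" "it_zbar s' (take i t) = it_zbar s (take i t)"
proof -
  have "v \<noteq> [] \<Longrightarrow> take i t \<noteq> t @ v" for v
    by (rule notI, drule arg_cong[where f = length]) (auto simp: min_def split: if_splits)
  then show "it_z s' (take i t) = it_z s (take i t)" "it_zbar s' (take i t) = it_zbar s (take i t)"
    using assms by (auto simp: changes_below_def)
qed

lemma changes_below_prefix_feasible:
  "changes_below t s s' \<Longrightarrow> prefix_feasible t s' \<longleftrightarrow> prefix_feasible t s"
  by (simp add: prefix_feasible_def changes_below_prefix)

lemma changes_below_memo:
  assumes "changes_below t s s'"
  shows "memo_g s u = Some v \<Longrightarrow> memo_g s' u = Some v" "memo_q s u = Some w \<Longrightarrow> memo_q s' u = Some w"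
  using assms by (auto simp: changes_below_def)

text \<open>
  The gap for \<open>t\<close> depends on the state only through the entries at the prefixes of \<open>t\<close>. Agreement of these
  entries allows all passes of a loop to be compared in the final state of the loop.
\<close>

definition agree_on_prefixes :: "nat list \<Rightarrow> alg_state \<Rightarrow> alg_state \<Rightarrow> bool" where
  "agree_on_prefixes t s s' \<longleftrightarrow> (\<forall>i\<in>{1..length t}.
     it_z s' (take i t) = it_z s (take i t) \<and> it_zbar s' (take i t) = it_zbar s (take i t)
     \<and> memo_g s' (take i t) = memo_g s (take i t) \<and> memo_q s' (take i t) = memo_q s (take i t))"

lemma changes_below_agree:
  assumes "changes_below t s s'" "stored t s"
  shows "agree_on_prefixes t s s'"
proof -
  have "\<exists>v w. memo_g s (take i t) = Some v \<and> memo_q s (take i t) = Some w"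
    if "i \<in> {1..length t}" for i
    using assms(2) that by (auto simp: stored_def)
  then have "memo_g s' (take i t) = memo_g s (take i t) \<and> memo_q s' (take i t) = memo_q s (take i t)"
    if "i \<in> {1..length t}" for i
    using changes_below_memo[OF assms(1)] that by metis
  then show ?thesis
    by (simp add: agree_on_prefixes_def changes_below_prefix[OF assms(1)])
qed

lemma agree_avg:
  assumes "agree_on_prefixes t s s'"
  shows "avg s' (take i t) = avg s (take i t)"
  by (rule avg_cong) (use assms in \<open>auto simp: agree_on_prefixes_def min_def split: if_splits\<close>)

lemma agree_consistent: "agree_on_prefixes t s s' \<Longrightarrow> consistent t s' \<longleftrightarrow> consistent t s"
  using agree_avg[of t s s'] by (simp add: agree_on_prefixes_def consistent_def w_point_eq_avg)

lemma agree_stored: "agree_on_prefixes t s s' \<Longrightarrow> stored t s' \<longleftrightarrow> stored t s"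
  by (simp add: agree_on_prefixes_def stored_def)

lemma agree_gap:
  assumes "agree_on_prefixes t s s'"
  shows "gap s' t = gap s t"
proof -
  have "pre_term s' t z x i = pre_term s t z x i" if "i \<in> {1..length t}" for z x i
    using assms that by (simp add: pre_term_def agree_on_prefixes_def)
  moreover have "deep_term s' t z x i = deep_term s t z x i" for z x i
    using agree_avg[OF assms, of "length t"] by (simp add: deep_term_def)
  ultimately show ?thesis
    by (auto simp: gap_def fun_eq_iff)
qed

text \<open>
  The factor of the distances to the iterates of level \<open>i\<close> after the levels from \<open>length t + 1\<close> to \<open>i\<close>
  have been averaged out. Each averaging multiplies by \<open>\<alpha>\<^bsub>T-1\<^esub>\<^sup>2 / \<alpha>\<^sub>j\<close>; the result is independent of the
  pass \<open>j\<close> because the step size contains the factor \<open>\<alpha>\<^sub>j\<close>, and this is what lets the distances telescope.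
\<close>

definition weight :: "nat \<Rightarrow> nat list \<Rightarrow> real" where
  "weight i t = lip i * (coef t * (\<Prod>l=Suc (length t)..i. (alpha (T l - 1))\<^sup>2))
     + M i * ((\<Prod>l<length t. alpha (t ! l) / alpha (T (Suc l) - 1))
         * (\<Prod>l=Suc (length t)..i. alpha (T l - 1)))"

lemma weight_length: "weight (length t) t = step t"
  by (simp add: weight_def eta_def coef_def Let_def)

lemma weight_snoc:
  assumes "i > length t"
  shows "(alpha (T (Suc (length t)) - 1))\<^sup>2 * weight i (t @ [j]) = alpha j * weight i t"
proof -
  let ?a = "alpha (T (Suc (length t)) - 1)"
  have split: "(\<Prod>l=Suc (length t)..i. f l) = f (Suc (length t)) * (\<Prod>l=Suc (Suc (length t))..i. f l)"
    for f :: "nat \<Rightarrow> real"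
    using assms by (subst prod.atLeast_Suc_atMost) auto
  have M: "(\<Prod>l<length (t @ [j]). alpha ((t @ [j]) ! l) / alpha (T (Suc l) - 1))
      = (\<Prod>l<length t. alpha (t ! l) / alpha (T (Suc l) - 1)) * (alpha j / ?a)"
    using prod_nth_snoc[of "\<lambda>l x. alpha x / alpha (T (Suc l) - 1)" t j] by simp
  show ?thesis
    unfolding weight_def M coef_snoc split
    using alpha_pos[of "T (Suc (length t)) - 1"] by (simp add: field_simps power2_eq_square)
qed

text \<open>
  A pass at level \<open>i\<close> has the smoothing error \<open>acc i / coef\<close>. Averaging over the passes of a level multiplies an
  error of this form by at most the number of passes, while \<open>coef\<close> loses the factor of the level. Here
  \<open>pass_err\<close> is the contribution of a single pass to the bound after the averaging.
\<close>

definition err :: "nat list \<Rightarrow> real" where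
  "err t = (\<Sum>i=Suc (length t)..n. acc i * real (\<Prod>l=Suc (length t)..i. T l)) / coef t"

definition pass_err :: "nat list \<Rightarrow> real" where
  "pass_err t = (\<Sum>i=Suc (length t)..n. acc i * real (\<Prod>l=Suc (Suc (length t))..i. T l)) / coef t"

lemma pass_err_nonneg: "pass_err t \<ge> 0"
  unfolding pass_err_def using coef_pos[of t]
  by (auto intro!: divide_nonneg_pos sum_nonneg mult_nonneg_nonneg delta_par_nonneg prod_nonneg)

lemma err_eq: "err t = real (T (Suc (length t))) * pass_err t"
proof -
  have "(\<Prod>l=Suc (length t)..i. T l) = T (Suc (length t)) * (\<Prod>l=Suc (Suc (length t))..i. T l)"
    if "i \<in> {Suc (length t)..n}" for i
    using that by (subst prod.atLeast_Suc_atMost) auto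
  then show ?thesis
    by (simp add: err_def pass_err_def sum_distrib_left mult_ac)
qed

lemma err_snoc:
  assumes "length t < n"
  shows "err (t @ [j]) + acc (Suc (length t)) / coef (t @ [j]) = pass_err t / alpha j"
proof -
  have "(\<Sum>i=Suc (length t)..n. acc i * real (\<Prod>l=Suc (Suc (length t))..i. T l))
      = acc (Suc (length t)) + (\<Sum>i=Suc (Suc (length t))..n. acc i * real (\<Prod>l=Suc (Suc (length t))..i. T l))"
    using assms by (subst sum.atLeast_Suc_atMost) auto
  then show ?thesis
    by (simp add: err_def pass_err_def coef_snoc add_divide_distrib)
qed

text \<open>
  The precondition of a call. An oracle answer stored at a proper extension of \<open>t\<close> would be reused by the call,
  although it belongs to iterates that the call overwrites; hence there must be none.
\<close>

definition ready :: "nat list \<Rightarrow> alg_state \<Rightarrow> bool" where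
  "ready t s \<longleftrightarrow> prefix_feasible t s \<and> consistent t s
     \<and> (\<forall>m<n - length t. it_z s (t @ replicate (Suc m) 0) \<in> Z)
     \<and> (\<forall>v. v \<noteq> [] \<longrightarrow> memo_g s (t @ v) = None \<and> memo_q s (t @ v) = None)"

text \<open>
  Level \<open>i\<close> starts the call at the index \<open>t\<close> padded by zeros, and ends it at the index of the last iterate of
  level \<open>length t + 1\<close>, padded by zeros, from which the next call on the level of \<open>t\<close> takes its starting points.
\<close>

definition gap_bound :: "nat list \<Rightarrow> alg_state \<Rightarrow> alg_state \<Rightarrow> vect \<Rightarrow> real" where
  "gap_bound t s s' z =
     (\<Sum>i=Suc (length t)..n. 1/2 * weight i t
        * (nsq (z - it_z s (t @ replicate (i - length t) 0))
           - nsq (z - it_z s' (t @ [T (Suc (length t))] @ replicate (i - Suc (length t)) 0))))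
     + err t"

definition completes :: "nat list \<Rightarrow> alg_state \<Rightarrow> vect \<Rightarrow> alg_state \<Rightarrow> bool" where
  "completes t s x s' \<longleftrightarrow> consistent t s' \<and> stored t s' \<and> x \<in> Z
     \<and> (\<forall>m<n - length t. it_z s' (t @ [T (Suc (length t))] @ replicate m 0) \<in> Z)
     \<and> (\<forall>z\<in>Z. gap s' t z x \<le> gap_bound t s s' z)"

text \<open>
  At a leaf no component is left to be resolved, and the optimality condition of the proximal step says that the gap
  is not positive.
\<close>

lemma leaf_completes:
  assumes ready: "ready t s" and len: "length t = n"
  shows "completes t s (fst (rec 0 t s)) (snd (rec 0 t s))"
proof -
  let ?s = "require_prefixes t n s"
  let ?b = "\<lambda>i. the (memo_g ?s (take i t)) + the (memo_q ?s (take i t))"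
  have s': "snd (rec 0 t s) = ?s"
    by (simp add: rec_leaf_def require_prefixes_def Let_def)
  have x: "fst (rec 0 t s) = arg_min_on (\<lambda>z. \<Sum>i\<in>{1..n}. ip (?b i) z
      + 1/2 * step (take i t) * (wnorm d P (z - it_z s (take i t)))\<^sup>2) Z"
    unfolding rec.simps rec_leaf_def Let_def fst_conv
    by (fold require_prefixes_def) simp
  have feas: "prefix_feasible t s" and cons: "consistent t s"
    using ready by (auto simp: ready_def)
  have G: "G i (take i t) (w_point s (take i t)) \<in> subdifferential d (D i) (p i) (w_point s (take i t))"
    if "i \<in> {1..n}" for i
  proof -
    have "it_z s (take i t) \<in> Z"
      using feas that len by (auto simp: prefix_feasible_def)
    then have "w_point s (take i t) \<in> Z"
      unfolding w_point_eq_avg by (intro avg_in_Z prefix_feasible_take feas)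
    then show ?thesis
      using that by (intro oracle_answers)
  qed
  have cons': "consistent t ?s"
    unfolding consistent_def
  proof (intro ballI conjI allI impI)
    fix i v assume i: "i \<in> {1..length t}"
    then have mem: "take i t \<in> (\<lambda>i. take i t) ` {1..n}" and len_i: "length (take i t) = i"
      using len by auto
    show "v \<in> subdifferential d (D i) (p i) (w_point ?s (take i t))" if "memo_g ?s (take i t) = Some v"
      using that cons G[of i] i mem len_i len
      by (cases "memo_g s (take i t)") (simp_all add: memo_require_prefixes consistent_def)
    show "v = Q i (it_z ?s (take i t))" if "memo_q ?s (take i t) = Some v"
      using that cons i mem len_i
      by (cases "memo_q s (take i t)") (simp_all add: memo_require_prefixes consistent_def)
  qed
  have stored: "stored t ?s"
    using len by (auto simp: stored_def memo_require_prefixes)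
  have b: "?b i \<in> Rspace d" and c: "it_z s (take i t) \<in> Rspace d" if "i \<in> {1..n}" for i
  proof -
    have "memo_g ?s (take i t) \<noteq> None" "memo_q ?s (take i t) \<noteq> None"
      using stored that len by (auto simp: stored_def simp del: not_None_eq)
    then obtain g q where gq: "memo_g ?s (take i t) = Some g" "memo_q ?s (take i t) = Some q"
      by auto
    have zi: "it_z s (take i t) \<in> Z"
      using feas that len by (auto simp: prefix_feasible_def)
    then show "it_z s (take i t) \<in> Rspace d"
      by (rule in_Rspace)
    have "g \<in> Rspace d" "q = Q i (it_z s (take i t))"
      using cons' gq that len by (auto simp: consistent_def subdifferential_def)
    then show "?b i \<in> Rspace d"
      using gq zi Q_Rspace[OF that] by (auto intro!: Rspace_add)
  qed
  note prox = prox_step[OF Z_Rspace convex_Z compact_Z _ _ b c x]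
  have "fst (rec 0 t s) \<in> Z"
    using z_in by (intro prox) auto
  moreover have "gap ?s t z (fst (rec 0 t s)) \<le> gap_bound t s ?s z" if "z \<in> Z" for z
  proof -
    have "gap ?s t z (fst (rec 0 t s)) \<le> 0"
      using prox(2)[OF _ _ _ _ that] z_in by (auto simp: gap_def pre_term_def len sum_subtractf)
    then show ?thesis
      by (simp add: gap_bound_def len err_def)
  qed
  ultimately show ?thesis
    unfolding s' completes_def using cons' stored len by simp
qed

text \<open>
  The postcondition of the inner call, read in the state after the pass, provides all hypotheses of \<open>gap_step\<close>.
  The iterate of level \<open>length t + 1\<close> moves from \<open>z\<^bsub>t'\<^esub>\<close> to the corrector, and the iterates of the deeper levels move
  from the starting points to the end points of the inner call, which the pass copies to the starting points for \<open>t''\<close>;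
  so the distances have the same form for all levels.
\<close>

lemma pass_completes:
  fixes t j s m
  defines "t' \<equiv> t @ [j]" and "t'' \<equiv> t @ [Suc j]" and "s' \<equiv> loop_pass (rec m) t j s"
  assumes len: "length t < n" and ready: "ready t' s"
    and compl: "completes t' s (fst (rec m t' s)) (snd (rec m t' s))"
  shows "consistent t s'" "stored t s'" "it_zbar s' t'' \<in> Z"
    and "i < n - length t \<Longrightarrow> it_z s' (t'' @ replicate i 0) \<in> Z"
    and "(\<And>v. memo_g s (t @ [j'] @ v) = None \<and> memo_q s (t @ [j'] @ v) = None) \<Longrightarrow> j' \<noteq> j
      \<Longrightarrow> memo_g s' (t @ [j'] @ v) = None \<and> memo_q s' (t @ [j'] @ v) = None"
    and "z \<in> Z \<Longrightarrow> gap s' t z (it_zbar s' t'') \<le> (1 - alpha j) * gap s' t z (it_zbar s t')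
      + alpha j * ((\<Sum>i=Suc (length t)..n. 1/2 * weight i t'
          * (nsq (z - it_z s (t' @ replicate (i - Suc (length t)) 0))
             - nsq (z - it_z s' (t'' @ replicate (i - Suc (length t)) 0))))
        + pass_err t / alpha j)"
proof -
  obtain x s1 where r: "rec m t' s = (x, s1)"
    by (cases "rec m t' s")
  define k where "k = Suc (length t)"
  note fields = loop_pass_fields[of "rec m" t j s x s1, folded t'_def t''_def s'_def, OF r]
  have ch: "changes_below t' s s1"
    using rec_changes[of t' s m] by (simp add: r)
  have lt': "length t' = k" "length t'' = k" and k: "k \<in> {1..n}" and tk: "take k t' = t'"
    using len by (simp_all add: t'_def t''_def k_def)
  have cons1: "consistent t' s1" and stored1: "stored t' s1" and x: "x \<in> Z"
    and ends: "\<And>i. i < n - k \<Longrightarrow> it_z s1 (t' @ [T (Suc k)] @ replicate i 0) \<in> Z"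
    and gap1: "\<And>z. z \<in> Z \<Longrightarrow> gap s1 t' z x \<le> gap_bound t' s s1 z"
    using compl by (auto simp: completes_def r lt')
  have feas: "prefix_feasible t' s"
    using ready by (simp add: ready_def)
  then have feas1: "prefix_feasible t' s1"
    by (simp add: changes_below_prefix_feasible[OF ch])
  obtain g q where gq: "memo_g s1 t' = Some g" "memo_q s1 t' = Some q"
    using stored1 by (auto simp: stored_snoc t'_def)
  have req: "require_q t' s1 = s1"
    by (simp add: require_q_def gq)
  define y' where "y' = pass_point t j x s1"
  have it_z': "it_z s' u = (if \<exists>i\<in>{1..n - k}. u = t'' @ replicate i 0
          then it_z s1 (t' @ [T (Suc k)] @ replicate (length u - k - 1) 0)
          else if u = t'' then y' else it_z s1 u)" for u
    by (simp add: fields(6) req y'_def lt' k_def)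
  have it_z_t': "it_z s' (t' @ v) = it_z s1 (t' @ v)" for v
    by (auto simp: it_z' t'_def t''_def)
  have it_z_t'': "it_z s' t'' = y'"
    by (simp add: it_z')
  have it_z_deep: "it_z s' (t'' @ replicate i 0) = it_z s1 (t' @ [T (Suc k)] @ replicate (i - 1) 0)"
    if "i \<in> {1..n - k}" for i
    using that by (auto simp: it_z' lt')
  have memo': "memo_g s' = memo_g s1" "memo_q s' = memo_q s1"
    by (simp_all add: fields req)
  have zbar': "it_zbar s' u = it_zbar s1 u" if "u \<noteq> t''" for u
    using that by (simp add: fields)
  have ne: "take i t' \<noteq> t'' @ w" for i w
  proof
    assume eq: "take i t' = t'' @ w"
    have "length (take i t') = length (t'' @ w)"
      by (simp only: eq)
    then have "min k i = k + length w"
      by (simp add: lt')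
    then have "t' = t''"
      using eq lt' by (cases "k \<le> i") auto
    then show False
      by (simp add: t'_def t''_def)
  qed
  have "it_z s' (take i t') = it_z s1 (take i t')" for i
    using ne[of i] ne[of i "[]"] by (simp add: it_z')
  then have agree: "agree_on_prefixes t' s1 s'"
    unfolding agree_on_prefixes_def by (simp add: memo' zbar' ne[of _ "[]", simplified])
  have cons': "consistent t' s'" and stored': "stored t' s'"
    using agree_consistent[OF agree] agree_stored[OF agree] cons1 stored1 by simp_all
  then show "consistent t s'" "stored t s'"
    by (simp_all add: t'_def consistent_snoc stored_snoc)
  have s1_t': "it_z s1 t' = it_z s t'" "it_zbar s1 t' = it_zbar s t'"
    using changes_below_prefix[OF ch, of k] by (simp_all add: tk)
  have zb: "it_zbar s t' \<in> Z" and zt: "it_z s t' \<in> Z"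
    using feas by (simp_all add: t'_def prefix_feasible_snoc)
  have zbar_t'': "it_zbar s' t'' = alpha j *\<^sub>R x + (1 - alpha j) *\<^sub>R it_zbar s t'"
    by (simp add: fields s1_t')
  then show "it_zbar s' t'' \<in> Z"
    using x zb by (simp add: convex_comb_in_Z)
  have "q = Q k (it_z s1 t')"
    using cons1 gq by (simp add: t'_def consistent_snoc k_def)
  then have "Q k x - q \<in> Rspace d"
    using Q_Rspace[OF k] x zt by (auto simp: s1_t' intro!: Rspace_diff)
  then have prox: "y' \<in> Z"
      "\<And>z. z \<in> Z \<Longrightarrow> ip (Q k x - q) (y' - z) \<le> 1/2 * step t' * (nsq (z - x) - nsq (y' - x) - nsq (z - y'))"
    using prox_step[OF Z_Rspace convex_Z compact_Z, of "{0::nat}" "\<lambda>_. Q k x - q" "\<lambda>_. x" y' "\<lambda>_. step t'"]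
      z_in in_Rspace[OF x]
    by (auto simp: y'_def pass_point_def gq k_def simp flip: t'_def)
  show "it_z s' (t'' @ replicate i 0) \<in> Z" if "i < n - length t"
  proof (cases i)
    case 0
    then show ?thesis
      by (simp add: it_z_t'' prox)
  next
    case (Suc i')
    then show ?thesis
      using it_z_deep[of i] ends[of i'] that by (simp add: k_def)
  qed
  show "memo_g s' (t @ [j'] @ v) = None \<and> memo_q s' (t @ [j'] @ v) = None"
    if "\<And>v. memo_g s (t @ [j'] @ v) = None \<and> memo_q s (t @ [j'] @ v) = None" "j' \<noteq> j"
  proof -
    have "t @ [j'] @ v \<noteq> t' @ w" for w
      using that(2) by (simp add: t'_def)
    moreover have "t @ [j'] @ v \<noteq> take i t'" for i
      using that(2) by (cases "i \<le> length t") (auto simp: t'_def dest: arg_cong[where f = length])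
    ultimately show ?thesis
      using ch that(1) unfolding changes_below_def memo' by metis
  qed
  show "gap s' t z (it_zbar s' t'') \<le> (1 - alpha j) * gap s' t z (it_zbar s t')
      + alpha j * ((\<Sum>i=Suc (length t)..n. 1/2 * weight i t'
          * (nsq (z - it_z s (t' @ replicate (i - Suc (length t)) 0))
             - nsq (z - it_z s' (t'' @ replicate (i - Suc (length t)) 0))))
        + pass_err t / alpha j)" if z: "z \<in> Z"
  proof -
    let ?f = "\<lambda>i. 1/2 * weight i t' * (nsq (z - it_z s (t' @ replicate (i - k) 0))
             - nsq (z - it_z s' (t'' @ replicate (i - k) 0)))"
    have s'_t': "it_z s' t' = it_z s t'" "it_zbar s' t' = it_zbar s t'"
      using it_z_t'[of "[]"] zbar'[of t'] s1_t' by (simp_all add: t'_def t''_def)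
    have feas': "prefix_feasible t' s'"
      using feas1 agree by (simp add: prefix_feasible_def agree_on_prefixes_def)
    have "gap s' t z (alpha j *\<^sub>R x + (1 - alpha j) *\<^sub>R it_zbar s' t')
        \<le> (1 - alpha j) * gap s' t z (it_zbar s' t')
          + alpha j * (gap s' t' z x
            + (1/2 * step t' * (nsq (z - it_z s' t') - nsq (z - y')) + acc k / coef t'))"
      unfolding t'_def k_def
      using gap_step[of t j s' x z y'] k feas' cons' stored' x z prox gq
      by (simp add: memo' flip: t'_def k_def)
    also have "gap s' t' z x \<le> gap_bound t' s s1 z"
      using gap1[OF z] agree_gap[OF agree] by simp
    also have "gap_bound t' s s1 z = (\<Sum>i=Suc k..n. ?f i) + err t'"
    proof -
      have "it_z s' (t'' @ replicate (i - k) 0) = it_z s1 (t' @ [T (Suc k)] @ replicate (i - Suc k) 0)"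
        if "i \<in> {Suc k..n}" for i
      proof -
        have "i - k \<in> {1..n - k}"
          using that unfolding atLeastAtMost_iff by arith
        then show ?thesis
          using it_z_deep[of "i - k"] by simp
      qed
      then show ?thesis
        by (simp add: gap_bound_def lt')
    qed
    also have "1/2 * step t' * (nsq (z - it_z s' t') - nsq (z - y')) = ?f k"
      using weight_length[of t'] by (simp add: lt' s'_t' it_z_t'')
    also have "(\<Sum>i=Suc k..n. ?f i) + err t' + (?f k + acc k / coef t') = (\<Sum>i=k..n. ?f i) + pass_err t / alpha j"
      using err_snoc[OF len, of j] k by (simp add: sum.atLeast_Suc_atMost flip: t'_def k_def)
    finally show ?thesis
      using alpha_pos[of j] unfolding zbar_t'' s'_t' k_def by simp
  qed
qed

text \<open>
  The predicate \<open>I j\<close> collects what holds before pass \<open>j\<close>. For the gap, the recursion of \<open>pass_completes\<close> is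
  unrolled by \<open>alpha_weighted_recursion\<close>; by \<open>weight_snoc\<close> the distances then have factors independent of the pass.
\<close>

lemma rec_completes:
  assumes "length t + m = n" "ready t s"
  shows "completes t s (fst (rec m t s)) (snd (rec m t s))"
  using assms
proof (induction m arbitrary: t s)
  case 0
  then show ?case
    using leaf_completes by simp
next
  case (Suc m)
  note ready = \<open>ready t s\<close> and outer_IH = Suc.IH
  define k where "k = Suc (length t)"
  define K where "K = T k"
  define st where "st = loop_state m t s"
  have len: "length t < n" and k: "k \<in> {1..n}"
    using Suc.prems by (auto simp: k_def)
  have K: "K > 0"
    using T_pos[OF k] by (simp add: K_def)
  have st_Suc: "st (Suc j) = loop_pass (rec m) t j (st j)" for j
    by (simp add: st_def loop_state_simps)
  have st_changes: "changes_below t (st i) (st j)" if "i \<le> j" for i j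
    unfolding st_def using that by (rule loop_state_changes)
  have feas: "prefix_feasible t (st j)" for j
    using changes_below_trans[OF changes_below_loop_start st_changes[of 0 j, unfolded st_def]] ready
    by (simp add: changes_below_prefix_feasible ready_def st_def)
  define I where "I j \<longleftrightarrow> consistent t (st j) \<and> it_zbar (st j) (t @ [j]) \<in> Z
      \<and> (\<forall>i<n - length t. it_z (st j) ((t @ [j]) @ replicate i 0) \<in> Z)
      \<and> (\<forall>j'\<ge>j. \<forall>v. memo_g (st j) (t @ [j'] @ v) = None \<and> memo_q (st j) (t @ [j'] @ v) = None)" for j
  have start: "it_z (st 0) ((t @ [0]) @ replicate i 0) = it_z s (t @ replicate (Suc i) 0)" for i
    by (simp add: st_def loop_state_simps)
  have I0: "I 0"
    unfolding I_def
  proof (intro conjI allI impI)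
    have "take i t \<noteq> t @ [0]" for i
      by (rule notI, drule arg_cong[where f = length]) (simp add: min_def split: if_splits)
    then have "agree_on_prefixes t s (st 0)"
      by (simp add: agree_on_prefixes_def st_def loop_state_simps)
    then show "consistent t (st 0)"
      using ready by (simp add: agree_consistent ready_def)
    show "it_z (st 0) ((t @ [0]) @ replicate i 0) \<in> Z" if "i < n - length t" for i
      unfolding start using ready that by (simp add: ready_def del: replicate_Suc)
    from this[of 0] show "it_zbar (st 0) (t @ [0]) \<in> Z"
      using len by (simp add: st_def loop_state_simps)
    show "memo_g (st 0) (t @ [j'] @ v) = None" "memo_q (st 0) (t @ [j'] @ v) = None" for j' v
      using ready by (simp_all add: ready_def st_def loop_state_simps)
  qed
  have compl: "ready (t @ [j]) (st j)
      \<and> completes (t @ [j]) (st j) (fst (rec m (t @ [j]) (st j))) (snd (rec m (t @ [j]) (st j)))"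
    if "I j" "j < K" for j
  proof -
    have none: "memo_g (st j) (t @ [j] @ v) = None" "memo_q (st j) (t @ [j] @ v) = None" for v
      using \<open>I j\<close> by (simp_all add: I_def)
    have z: "it_z (st j) ((t @ [j]) @ replicate i 0) \<in> Z" if "i < n - length t" for i
      using \<open>I j\<close> that unfolding I_def by blast
    have "prefix_feasible (t @ [j]) (st j)"
      using \<open>I j\<close> \<open>j < K\<close> feas z[of 0] len by (simp add: prefix_feasible_snoc I_def K_def k_def)
    moreover have "consistent (t @ [j]) (st j)"
      using \<open>I j\<close> none[of "[]"] by (simp add: consistent_snoc I_def)
    moreover have "it_z (st j) ((t @ [j]) @ replicate (Suc i) 0) \<in> Z" if "i < n - length (t @ [j])" for i
      using that by (intro z) simp
    ultimately have "ready (t @ [j]) (st j)"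
      using none unfolding ready_def by simp
    then show ?thesis
      using outer_IH[of "t @ [j]" "st j"] Suc.prems by simp
  qed
  have I: "I j" if "j \<le> K" for j
    using that
  proof (induction j)
    case (Suc j)
    then have "I j" "j < K" by auto
    note pass = pass_completes[OF len conjunct1[OF compl[OF this]] conjunct2[OF compl[OF this]], folded st_Suc]
    show ?case
      unfolding I_def
    proof (intro conjI allI impI)
      show "consistent t (st (Suc j))" "it_zbar (st (Suc j)) (t @ [Suc j]) \<in> Z"
        by (rule pass)+
      show "it_z (st (Suc j)) ((t @ [Suc j]) @ replicate i 0) \<in> Z" if "i < n - length t" for i
        by (rule pass(4)[OF that])
      fix j' v assume "j' \<ge> Suc j"
      then have "memo_g (st (Suc j)) (t @ [j'] @ v) = None \<and> memo_q (st (Suc j)) (t @ [j'] @ v) = None"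
        using \<open>I j\<close> by (intro pass(5)) (auto simp: I_def)
      then show "memo_g (st (Suc j)) (t @ [j'] @ v) = None" "memo_q (st (Suc j)) (t @ [j'] @ v) = None"
        by auto
    qed
  qed (rule I0)
  have stored: "stored t (st (Suc j))" if "j < K" for j
    using pass_completes(2)[OF len conjunct1[OF compl] conjunct2[OF compl]] I[of j] that
    by (simp add: st_Suc)
  have gap_K: "gap (st (Suc j)) t = gap (st K) t" if "j < K" for j
    using agree_gap[OF changes_below_agree[OF st_changes[of "Suc j" K] stored[OF that]]] that by simp
  obtain K' where K': "K = Suc K'"
    using K by (cases K) auto
  have bound: "gap (st K) t z (it_zbar (st K) (t @ [K])) \<le> gap_bound t s (st K) z" if z: "z \<in> Z" for z
  proof -
    define e where "e i j = nsq (z - it_z (st j) ((t @ [j]) @ replicate (i - k) 0))" for i j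
    define B where "B j = (\<Sum>i=k..n. 1/2 * weight i (t @ [j]) * (e i j - e i (Suc j))) + pass_err t / alpha j" for j
    define V where "V j = gap (st K) t z (it_zbar (st j) (t @ [j]))" for j
    have "V (Suc j) \<le> (1 - alpha j) * V j + alpha j * B j" if "j \<le> K'" for j
    proof -
      have j: "I j" "j < K"
        using that K' I by auto
      show ?thesis
        using pass_completes(6)[OF len conjunct1[OF compl[OF j]] conjunct2[OF compl[OF j]] z, folded st_Suc]
        unfolding V_def B_def e_def k_def gap_K[OF j(2)] .
    qed
    then have "V K \<le> (alpha K')\<^sup>2 * (\<Sum>j\<le>K'. B j / alpha j)"
      unfolding K' by (rule alpha_weighted_recursion)
    also have "\<dots> = (\<Sum>j\<le>K'. (alpha K')\<^sup>2 * (B j / alpha j))"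
      by (simp add: sum_distrib_left)
    also have "\<dots> \<le> (\<Sum>j\<le>K'. (\<Sum>i=k..n. 1/2 * weight i t * (e i j - e i (Suc j))) + pass_err t)"
    proof (rule sum_mono)
      fix j assume "j \<in> {..K'}"
      then have a: "alpha K' \<le> alpha j"
        by (intro alpha_antimono) auto
      have w: "(alpha K')\<^sup>2 * weight i (t @ [j]) = alpha j * weight i t" if "i \<in> {k..n}" for i
        using weight_snoc[of t i j] that K' by (simp add: K_def k_def)
      have "(alpha K')\<^sup>2 * (\<Sum>i=k..n. 1/2 * weight i (t @ [j]) * (e i j - e i (Suc j)))
          = (\<Sum>i=k..n. 1/2 * ((alpha K')\<^sup>2 * weight i (t @ [j])) * (e i j - e i (Suc j)))"
        by (simp add: sum_distrib_left mult_ac)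
      also have "\<dots> = (\<Sum>i=k..n. 1/2 * (alpha j * weight i t) * (e i j - e i (Suc j)))"
        by (intro sum.cong refl) (simp only: w)
      also have "\<dots> = alpha j * (\<Sum>i=k..n. 1/2 * weight i t * (e i j - e i (Suc j)))"
        by (simp add: sum_distrib_left mult_ac)
      finally have sum: "(alpha K')\<^sup>2 * (\<Sum>i=k..n. 1/2 * weight i (t @ [j]) * (e i j - e i (Suc j)))
          = alpha j * (\<Sum>i=k..n. 1/2 * weight i t * (e i j - e i (Suc j)))" .
      have "(alpha K')\<^sup>2 * (B j / alpha j) = ((alpha K')\<^sup>2 * (\<Sum>i=k..n. 1/2 * weight i (t @ [j]) * (e i j - e i (Suc j)))
          + (alpha K')\<^sup>2 * (pass_err t / alpha j)) / alpha j"
        by (simp add: B_def distrib_left)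
      also have "\<dots> = (\<Sum>i=k..n. 1/2 * weight i t * (e i j - e i (Suc j))) + (alpha K' / alpha j)\<^sup>2 * pass_err t"
        unfolding sum using alpha_pos[of j] by (simp add: field_simps power2_eq_square)
      \<comment> \<open>The weights decrease, so each pass error enters with a factor of at most 1.\<close>
      also have "(alpha K' / alpha j)\<^sup>2 * pass_err t \<le> 1 * pass_err t"
        using a alpha_pos[of K'] alpha_pos[of j] pass_err_nonneg
        by (intro mult_right_mono power_le_one) auto
      finally show "(alpha K')\<^sup>2 * (B j / alpha j)
          \<le> (\<Sum>i=k..n. 1/2 * weight i t * (e i j - e i (Suc j))) + pass_err t"
        by simp
    qed
    also have "\<dots> = (\<Sum>i=k..n. 1/2 * weight i t * (\<Sum>j<K. e i j - e i (Suc j))) + err t"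
    proof -
      have "(\<Sum>j\<le>K'. \<Sum>i=k..n. 1/2 * weight i t * (e i j - e i (Suc j)))
          = (\<Sum>i=k..n. \<Sum>j\<le>K'. 1/2 * weight i t * (e i j - e i (Suc j)))"
        by (rule sum.swap)
      also have "\<dots> = (\<Sum>i=k..n. 1/2 * weight i t * (\<Sum>j<K. e i j - e i (Suc j)))"
        unfolding K' lessThan_Suc_atMost by (simp only: sum_distrib_left)
      finally show ?thesis
        using err_eq[of t] by (simp add: sum.distrib K' flip: k_def K_def)
    qed
    also have "\<dots> = gap_bound t s (st K) z"
    proof -
      have "(\<Sum>j<K. e i j - e i (Suc j)) = nsq (z - it_z s (t @ replicate (i - length t) 0))
          - nsq (z - it_z (st K) (t @ [K] @ replicate (i - k) 0))" if "i \<in> {k..n}" for i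
      proof -
        have "Suc (i - k) = i - length t"
          using that by (simp add: k_def Suc_diff_Suc)
        then have "e i 0 = nsq (z - it_z s (t @ replicate (i - length t) 0))"
          unfolding e_def start by simp
        then show ?thesis
          by (simp only: sum_lessThan_telescope') (simp add: e_def)
      qed
      then show ?thesis
        by (simp add: gap_bound_def flip: k_def K_def)
    qed
    finally show ?thesis
      by (simp add: V_def)
  qed
  have IK: "I K"
    by (rule I) simp
  have "completes t s (it_zbar (st K) (t @ [K])) (st K)"
    unfolding completes_def k_def[symmetric] K_def[symmetric]
    using IK bound stored[of K'] K' unfolding I_def by simp
  then show ?case
    by (simp only: rec_Suc_loop_state fst_conv snd_conv st_def K_def k_def)
qed

text \<open>
  For the call at the root there are no fixed components and no contraction, so \<open>gap\<close> is the quantity to be bounded.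
  The weights are products of the numbers \<open>\<alpha>\<^bsub>T-1\<^esub> \<le> 2 / T\<close> and of their squares.
\<close>

lemma z_out_gap:
  shows "z_out \<in> Z"
    and "z \<in> Z \<Longrightarrow> (\<Sum>i=1..n. p i z_out) - (\<Sum>i=1..n. p i z) + ip (\<Sum>i=1..n. Q i z) (z_out - z)
      \<le> (\<Sum>i=1..n. 1/2 * \<Omega> * (lip i * 4 ^ i / (real (N_par T i))\<^sup>2 + M i * 2 ^ i / real (N_par T i))
            + acc i * real (N_par T i))"
proof -
  let ?s = "snd (rec n [] init)"
  have start: "it_z init (replicate m 0) = z_in" for m
    by (auto simp: init_def set_replicate_conv_if)
  have "ready [] init"
    using start[of "Suc _"] z_in by (simp add: ready_def prefix_feasible_def consistent_def init_def)
  from rec_completes[OF _ this, of n]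
  have c: "completes [] init z_out ?s"
    by (simp add: z_out_def)
  then show out: "z_out \<in> Z"
    by (simp add: completes_def)
  assume z: "z \<in> Z"
  have "(\<Sum>i=1..n. p i z_out) - (\<Sum>i=1..n. p i z) + ip (\<Sum>i=1..n. Q i z) (z_out - z) = gap ?s [] z z_out"
    by (simp add: gap_def deep_term_def coef_def ip_sum_left sum.distrib sum_subtractf)
  also have "\<dots> \<le> gap_bound [] init ?s z"
    using c z by (simp add: completes_def)
  also have "\<dots> = (\<Sum>i=1..n. 1/2 * weight i [] * (nsq (z - z_in)
           - nsq (z - it_z ?s ([T 1] @ replicate (i - 1) 0))) + acc i * real (N_par T i))"
    by (simp add: gap_bound_def start err_def coef_def N_par_def sum.distrib)
  also have "\<dots> \<le> (\<Sum>i=1..n. 1/2 * \<Omega> * (lip i * 4 ^ i / (real (N_par T i))\<^sup>2 + M i * 2 ^ i / real (N_par T i))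
            + acc i * real (N_par T i))"
  proof (intro sum_mono add_right_mono)
    fix i assume i: "i \<in> {1..n}"
    let ?a = "\<Prod>l=1..i. alpha (T l - 1)"
    have a: "0 \<le> ?a" "?a \<le> 2 ^ i / real (N_par T i)"
      using i by (intro prod_nonneg prod_alpha_le T_pos; simp add: alpha_pos less_imp_le)+
    have w: "weight i [] = lip i * ?a\<^sup>2 + M i * ?a"
      by (simp add: weight_def coef_def prod_power_distrib)
    have w_nonneg: "0 \<le> weight i []"
      unfolding w using lip_nonneg[OF i] M_nonneg[OF i] a by (intro add_nonneg_nonneg mult_nonneg_nonneg) auto
    have "?a\<^sup>2 \<le> (2 ^ i / real (N_par T i))\<^sup>2"
      using a by (intro power_mono)
    also have "\<dots> = 4 ^ i / (real (N_par T i))\<^sup>2"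
      by (simp add: power_divide power2_eq_square flip: power_mult_distrib)
    finally have "weight i [] \<le> lip i * (4 ^ i / (real (N_par T i))\<^sup>2) + M i * (2 ^ i / real (N_par T i))"
      unfolding w using lip_nonneg[OF i] M_nonneg[OF i] a by (intro add_mono mult_left_mono)
    then have w_le: "1/2 * \<Omega> * weight i []
        \<le> 1/2 * \<Omega> * (lip i * 4 ^ i / (real (N_par T i))\<^sup>2 + M i * 2 ^ i / real (N_par T i))"
      using \<Omega>_nonneg by (intro mult_left_mono) auto
    have "it_z ?s ([T 1] @ replicate (i - 1) 0) \<in> Z"
      using c i by (auto simp: completes_def)
    then have "nsq (z - it_z ?s ([T 1] @ replicate (i - 1) 0)) \<ge> 0"
      using z by (intro nsq_nonneg diff_in_Rspace)
    then have "nsq (z - z_in) - nsq (z - it_z ?s ([T 1] @ replicate (i - 1) 0)) \<le> \<Omega>"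
      using \<Omega>[OF z] by linarith
    then have "1/2 * weight i [] * (nsq (z - z_in) - nsq (z - it_z ?s ([T 1] @ replicate (i - 1) 0)))
        \<le> 1/2 * weight i [] * \<Omega>"
      using w_nonneg by (intro mult_left_mono) auto
    with w_le show "1/2 * weight i [] * (nsq (z - z_in) - nsq (z - it_z ?s ([T 1] @ replicate (i - 1) 0)))
        \<le> 1/2 * \<Omega> * (lip i * 4 ^ i / (real (N_par T i))\<^sup>2 + M i * 2 ^ i / real (N_par T i))"
      by (simp add: mult_ac)
  qed
  finally show "(\<Sum>i=1..n. p i z_out) - (\<Sum>i=1..n. p i z) + ip (\<Sum>i=1..n. Q i z) (z_out - z)
      \<le> (\<Sum>i=1..n. 1/2 * \<Omega> * (lip i * 4 ^ i / (real (N_par T i))\<^sup>2 + M i * 2 ^ i / real (N_par T i))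
            + acc i * real (N_par T i))" .
qed

end

lemma (in sliding) evals_le:
  assumes "i \<ge> 1"
  shows "p_evals i \<le> N_par T i" "Q_evals i \<le> 2 * N_par T i"
  using rec_counts[of "[]" n init] assms
  by (auto simp: counts_bounded_def p_evals_def Q_evals_def N_par_def init_def)

section \<open>The iteration numbers and the complexity bound\<close>

text \<open>
  Rounding up at every level multiplies the product by at most a constant, because each target \<open>A * R i\<close>
  is at least as large as the previous ones.
\<close>

lemma iteration_numbers_exist:
  fixes R :: "nat \<Rightarrow> real"
  assumes A: "A \<ge> 1" and R: "\<And>i. i \<in> {1..n} \<Longrightarrow> R i \<ge> 1"
    and mono: "\<And>i j. i \<in> {1..n} \<Longrightarrow> j \<in> {1..n} \<Longrightarrow> i \<le> j \<Longrightarrow> R i \<le> R j"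
  shows "\<exists>T. \<forall>i\<in>{1..n}. T i > 0 \<and> A * R i \<le> real (N_par T i) \<and> real (N_par T i) \<le> real (Suc i) * (A * R i)"
  using R mono
proof (induction n)
  case (Suc n)
  obtain T where T: "\<And>i. i \<in> {1..n} \<Longrightarrow>
      T i > 0 \<and> A * R i \<le> real (N_par T i) \<and> real (N_par T i) \<le> real (Suc i) * (A * R i)"
    using Suc.IH Suc.prems by (metis atLeastAtMost_iff le_Suc_eq)
  define N where "N = real (N_par T n)"
  define r where "r = nat \<lceil>A * R (Suc n) / N\<rceil>"
  define T' where "T' = T(Suc n := r)"
  have AR: "A * R (Suc n) \<ge> 1"
    using mult_mono[of 1 A 1 "R (Suc n)"] A Suc.prems(1)[of "Suc n"] by simp
  have "N_par T n > 0"
    unfolding N_par_def using T by (intro prod_pos) auto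
  then have N: "N > 0"
    by (simp add: N_def)
  have N_le: "N \<le> real (Suc n) * (A * R (Suc n))"
  proof (cases "n = 0")
    case True
    then show ?thesis
      using AR by (simp add: N_def N_par_def)
  next
    case False
    have "N \<le> real (Suc n) * (A * R n)"
      using T[of n] False by (simp add: N_def)
    also have "\<dots> \<le> real (Suc n) * (A * R (Suc n))"
      using Suc.prems(2)[of n "Suc n"] False A by (intro mult_left_mono) auto
    finally show ?thesis .
  qed
  have "0 < A * R (Suc n) / N"
    using AR N by simp
  then have r: "r > 0" "A * R (Suc n) / N \<le> real r" "real r \<le> A * R (Suc n) / N + 1"
    unfolding r_def by linarith+
  have N_same: "N_par T' i = N_par T i" if "i \<le> n" for i
    unfolding N_par_def T'_def using that by (intro prod.cong) auto
  have N_Suc: "real (N_par T' (Suc n)) = N * real r"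
    using N_same[of n] by (simp add: N_par_def N_def T'_def)
  have lower: "A * R (Suc n) \<le> N * real r"
    using r(2) N by (simp add: field_simps)
  have "N * real r \<le> A * R (Suc n) + N"
    using mult_left_mono[OF r(3), of N] N by (simp add: distrib_left)
  also have "\<dots> \<le> real (Suc (Suc n)) * (A * R (Suc n))"
    using N_le by (simp add: distrib_right)
  finally have upper: "N * real r \<le> real (Suc (Suc n)) * (A * R (Suc n))" .
  have "T' i > 0 \<and> A * R i \<le> real (N_par T' i) \<and> real (N_par T' i) \<le> real (Suc i) * (A * R i)"
    if "i \<in> {1..Suc n}" for i
  proof (cases "i = Suc n")
    case True
    then show ?thesis
      using r(1) lower upper unfolding True N_Suc by (simp add: T'_def)
  next
    case False
    then have "i \<in> {1..n}"
      using that by auto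
    then show ?thesis
      using T[of i] N_same[of i] by (simp add: T'_def)
  qed
  then show ?case by blast
qed simp

theorem corollary3p6:
  "\<forall>n\<ge>1. \<exists>C>0. \<forall>(d::nat) (Z::vect set) (z_in::vect) (P::matr)
      (D::nat \<Rightarrow> vect set) (p::nat \<Rightarrow> vect \<Rightarrow> real) (Q::nat \<Rightarrow> vect \<Rightarrow> vect)
      (M::nat \<Rightarrow> real) (H::nat \<Rightarrow> real) (\<nu>::nat \<Rightarrow> real) (\<Omega>::real) (\<epsilon>::real) (R::nat \<Rightarrow> real).
     Z \<subseteq> Rspace d \<and> closed Z \<and> convex Z \<and> z_in \<in> Z \<and> sym_pos_def d P \<and>
     (\<forall>i\<in>{1..n}.
        M i \<ge> 0 \<and> H i \<ge> 0 \<and> M i + H i > 0 \<and> 0 \<le> \<nu> i \<and> \<nu> i \<le> 1 \<and>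
        Q i ` Z \<subseteq> Rspace d \<and> continuous_on Z (Q i) \<and> monotone_op Z (Q i) \<and>
        lipschitz_op d P Z (M i) (Q i) \<and>
        Z \<subseteq> D i \<and> D i \<subseteq> Rspace d \<and> convex_on (D i) (p i) \<and>
        (\<forall>u\<in>Z. subdifferential d (D i) (p i) u \<noteq> {}) \<and>
        holder_cond d P Z (D i) (\<nu> i) (H i) (p i)) \<and>
     bdd_above ((\<lambda>z. (wnorm d P (z_in - z))\<^sup>2) ` Z) \<and>
     \<Omega> = (SUP z\<in>Z. (wnorm d P (z_in - z))\<^sup>2) \<and>
     \<epsilon> > 0 \<and>
     (\<forall>i\<in>{1..n}. R i = R_par \<Omega> \<epsilon> (M i) (\<nu> i) (H i)) \<and>
     (\<forall>i\<in>{1..n}. \<forall>j\<in>{1..n}. i \<le> j \<longrightarrow> R i \<le> R j)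
     \<longrightarrow>
     (\<exists>T::nat \<Rightarrow> nat. (\<forall>i\<in>{1..n}. T i > 0) \<and>
        (\<forall>G. (\<forall>i\<in>{1..n}. \<forall>t. \<forall>u\<in>Z. G i t u \<in> subdifferential d (D i) (p i) u) \<longrightarrow>
           (\<forall>i\<in>{1..n}.
              real (sliding.p_evals d n Z P Q G T alpha (eta T \<Omega> M \<nu> H) z_in i) \<le> C * R i \<and>
              real (sliding.Q_evals d n Z P Q G T alpha (eta T \<Omega> M \<nu> H) z_in i) \<le> C * R i) \<and>
           (let z_out = sliding.z_out d n Z P Q G T alpha (eta T \<Omega> M \<nu> H) z_in
            in z_out \<in> Z \<and>
               (SUP z\<in>Z. ereal ((\<Sum>i=1..n. p i z_out) - (\<Sum>i=1..n. p i z)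
                                + ip (\<Sum>i=1..n. Q i z) (z_out - z))) \<le> ereal (real n * \<epsilon>))))"
  (is "\<forall>n\<ge>1. \<exists>C>0. \<forall>d Z z_in P D p Q M H \<nu> \<Omega> \<epsilon> R.
      ?hyps n d Z z_in P D p Q M H \<nu> \<Omega> \<epsilon> R \<longrightarrow> ?concl n C d Z z_in P D p Q M H \<nu> \<Omega> \<epsilon> R")
proof (intro allI impI)
  fix n :: nat
  assume "n \<ge> 1"
  define A :: real where "A = 4 * 16 ^ n"
  define C where "C = 2 * real (Suc n) * A"
  have "(1::real) \<le> 16 ^ n"
    by simp
  then have A1: "A \<ge> 1"
    unfolding A_def by linarith
  have A16: "A \<ge> 4 * 16 ^ i" if "i \<le> n" for i
    using that by (simp add: A_def)
  have "?concl n C d Z z_in P D p Q M H \<nu> \<Omega> \<epsilon> R" if hyps: "?hyps n d Z z_in P D p Q M H \<nu> \<Omega> \<epsilon> R"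
    for d Z z_in P D p Q M H \<nu> \<Omega> \<epsilon> R
  proof -
    have Z: "Z \<subseteq> Rspace d" "closed Z" "convex Z" "z_in \<in> Z" and P: "sym_pos_def d P"
      and comp: "\<forall>i\<in>{1..n}.
        M i \<ge> 0 \<and> H i \<ge> 0 \<and> M i + H i > 0 \<and> 0 \<le> \<nu> i \<and> \<nu> i \<le> 1 \<and>
        Q i ` Z \<subseteq> Rspace d \<and> continuous_on Z (Q i) \<and> monotone_op Z (Q i) \<and>
        lipschitz_op d P Z (M i) (Q i) \<and>
        Z \<subseteq> D i \<and> D i \<subseteq> Rspace d \<and> convex_on (D i) (p i) \<and>
        (\<forall>u\<in>Z. subdifferential d (D i) (p i) u \<noteq> {}) \<and>
        holder_cond d P Z (D i) (\<nu> i) (H i) (p i)"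
      and bdd: "bdd_above ((\<lambda>z. (wnorm d P (z_in - z))\<^sup>2) ` Z)"
      and \<Omega>: "\<Omega> = (SUP z\<in>Z. (wnorm d P (z_in - z))\<^sup>2)" and \<epsilon>: "\<epsilon> > 0"
      and R: "\<forall>i\<in>{1..n}. R i = R_par \<Omega> \<epsilon> (M i) (\<nu> i) (H i)"
      and R_mono: "\<forall>i\<in>{1..n}. \<forall>j\<in>{1..n}. i \<le> j \<longrightarrow> R i \<le> R j"
      using hyps by - (elim conjE, assumption)+
    interpret weighted_space d P
      by unfold_locales (rule P)
    have R1: "R i \<ge> 1" if "i \<in> {1..n}" for i
      using R that by (simp add: R_par_def)
    obtain T where T_all: "\<forall>i\<in>{1..n}. T i > 0 \<and> A * R i \<le> real (N_par T i)
        \<and> real (N_par T i) \<le> real (Suc i) * (A * R i)"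
      using iteration_numbers_exist[OF A1 R1 R_mono[rule_format]] by (rule exE)
    note T = bspec[OF T_all]
    have \<Omega>_bound: "nsq (z - z_in) \<le> \<Omega>" if "z \<in> Z" for z
    proof -
      have "(wnorm d P (z_in - z))\<^sup>2 \<le> \<Omega>"
        unfolding \<Omega> using that bdd by (rule cSUP_upper)
      moreover have "z_in - z \<in> Rspace d"
        using Z that by (auto intro: Rspace_diff)
      ultimately show ?thesis
        by (simp add: wnorm_sq nsq_diff_commute[of z z_in])
    qed
    show ?thesis
    proof (intro exI[of _ T] conjI allI impI)
      show "\<forall>i\<in>{1..n}. T i > 0"
        using T by blast
      fix G :: "nat \<Rightarrow> nat list \<Rightarrow> vect \<Rightarrow> vect"
      assume G: "\<forall>i\<in>{1..n}. \<forall>t. \<forall>u\<in>Z. G i t u \<in> subdifferential d (D i) (p i) u"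
      interpret sliding_problem d P n Z Q G T z_in \<Omega> M \<nu> H D p
        by unfold_locales
          (use comp G T Z \<Omega>_bound compact_if_bounded[OF Z(2,1,4) bdd] in blast)+
      have "real (p_evals i) \<le> C * R i \<and> real (Q_evals i) \<le> C * R i" if i: "i \<in> {1..n}" for i
      proof -
        have "p_evals i \<le> N_par T i" "Q_evals i \<le> 2 * N_par T i"
          using i by (auto intro: evals_le)
        moreover have "2 * real (N_par T i) \<le> C * R i"
        proof -
          have "2 * real (N_par T i) \<le> 2 * (real (Suc i) * (A * R i))"
            using T[OF i] by simp
          also have "\<dots> \<le> 2 * (real (Suc n) * (A * R i))"
            using i R1[OF i] A1 by (intro mult_left_mono mult_right_mono) auto
          finally show ?thesis
            by (simp add: C_def mult_ac)
        qed
        ultimately show ?thesis by linarith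
      qed
      then show "\<forall>i\<in>{1..n}. real (p_evals i) \<le> C * R i \<and> real (Q_evals i) \<le> C * R i"
        by blast
      have "(\<Sum>i=1..n. p i z_out) - (\<Sum>i=1..n. p i z) + ip (\<Sum>i=1..n. Q i z) (z_out - z) \<le> real n * \<epsilon>"
        if "z \<in> Z" for z
      proof -
        have "(\<Sum>i=1..n. 1/2 * \<Omega> * (lip i * 4 ^ i / (real (N_par T i))\<^sup>2 + M i * 2 ^ i / real (N_par T i))
            + acc i * real (N_par T i)) \<le> (\<Sum>i=1..n. \<epsilon>)"
          using \<nu> H_nonneg M_nonneg \<Omega>_nonneg \<epsilon> A16 T R
          by (intro sum_mono component_error_le[where A = A]) auto
        then show ?thesis
          using z_out_gap(2)[OF that] by simp
      qed
      then show "let z_out = z_out in z_out \<in> Z \<and>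
               (SUP z\<in>Z. ereal ((\<Sum>i=1..n. p i z_out) - (\<Sum>i=1..n. p i z)
                                + ip (\<Sum>i=1..n. Q i z) (z_out - z))) \<le> ereal (real n * \<epsilon>)"
        using z_out_gap(1) by (auto simp: Let_def intro!: SUP_least)
    qed
  qed
  moreover have "C > 0"
    by (simp add: C_def A_def)
  ultimately show "\<exists>C>0. \<forall>d Z z_in P D p Q M H \<nu> \<Omega> \<epsilon> R.
      ?hyps n d Z z_in P D p Q M H \<nu> \<Omega> \<epsilon> R \<longrightarrow> ?concl n C d Z z_in P D p Q M H \<nu> \<Omega> \<epsilon> R"
    by (intro exI[of _ C] conjI allI impI)
qed

end
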